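(* Let $G$ be an open $\sigma$-locally Polish groupoid (in particular, $G$ may be any open Polish groupoid). Then there exist a countable (multi-sorted relational) language $\mathcal L$ for continuous logic and a second-countable metric-étale $\mathcal L$-structure $\mathcal M$ over the space of objects $G^0$ such that there is an isomorphism of topological groupoids $G\cong\mathrm{Iso}_{G^0}(\mathcal M)$ which is the identity on objects.
   Context: Groupoids. A groupoid $G$ is a small category with all morphisms invertible; $G$ also denotes its set of morphisms and $G^0\subseteq G$ its set of objects (identified with unit morphisms); $\sigma,\tau:G\to G^0$ are source and target. A topological groupoid has topologies on $G^0,G$ making source, target, unit, multiplication and inverse continuous; it is open if $\sigma$ is an open map. A topological space is $\sigma$-locally Polish if it has a countable cover by open Polish subspaces; a topological groupoid is ($\sigma$-locally) Polish if $G^0$ and $G$ are. Topometric spaces. All metrics have diameter $\le1$. A topometric space is a set $A$ with a topology and a metric $d$ such that the open sets of $A$ are exactly the sets $\{a:V(a)<1\}$ for $V:A\to[0,1]$ which are upper semicontinuous (for the topology) and $1$-Lipschitz (for $d$). It is complete if $d$ is complete. Metric-étale spaces. Let $X$ be a topological space. For $p:A\to X$, $q:B\to X$: $A_x=p^{-1}(x)$ and $A\times_XB=\{(a,b):p(a)=q(b)\}$ with the subspace topology; the empty fiber product is $X$. A metric-étale space over $X$ is a complete topometric space $A$ with a continuous open map $p:A\to X$ (for the topology) such that $d(a,b)=1$ whenever $p(a)\ne p(b)$, and $d:A\times_XA\to[0,1]$ is upper semicontinuous, i.e., $\{(a,b)\in A\times_XA:d(a,b)<r\}$ is open in $A\times_XA$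 for all $r>0$. Metric-étale structures. A multi-sorted relational language $\mathcal L$ consists of sorts and relation symbols with arities finite tuples of sorts. A metric-étale $\mathcal L$-structure $\mathcal M$ over $X$ consists of a metric-étale space $P^{\mathcal M}$ over $X$ for each sort $P$, and for each $(P_0,\dots,P_{n-1})$-ary relation symbol $R$ an upper semicontinuous function $R^{\mathcal M}:P_0^{\mathcal M}\times_X\cdots\times_XP_{n-1}^{\mathcal M}\to[0,1]$ which is $1$-Lipschitz with respect to the sum metric (truncated at $1$). Over each $x\in X$ the fibers form a metric $\mathcal L$-structure $\mathcal M_x$ (complete metric spaces with $1$-Lipschitz $[0,1]$-valued relations). $\mathcal M$ is second-countable if $\mathcal L$ is countable and $X$ and all $P^{\mathcal M}$ are second-countable. Isomorphism groupoid. $\mathrm{Iso}_X(\mathcal M)$ has object space $X$, and morphisms $x\to y$ are triples $(x,y,f)$ with $f=(f_P)_P$ an isomorphism $\mathcal M_x\cong\mathcal M_y$ (isometric bijections $f_P:P^{\mathcal M}_x\cong P^{\mathcal M}_y$ preserving the value of every relation), composed as usual; the set of morphisms has the topology generated by continuity of the source and target maps to $X$ together with the sets $\{(x,y,f):f_P(S_x)\cap T_y\ne\emptyset\}$ for sorts $P$ and open $S,T\subseteq P^{\mathcal M}$, where $S_x=S\cap P^{\mathcal M}_x$. *)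

theory Defs
  imports "HOL-Analysis.Analysis"
begin

section \<open>Polish and \<open>\<sigma>\<close>-locally Polish spaces\<close>

definition Polish_space :: "'a topology \<Rightarrow> bool" where
  "Polish_space X \<longleftrightarrow> completely_metrizable_space X \<and> separable_space X"

definition sigma_locally_Polish_space :: "'a topology \<Rightarrow> bool" where
  "sigma_locally_Polish_space X \<longleftrightarrow>
     (\<exists>\<U>. countable \<U> \<and> (\<forall>U\<in>\<U>. openin X U \<and> Polish_space (subtopology X U)) \<and>
          \<Union>\<U> = topspace X)"

lemma Polish_imp_sigma_locally_Polish:
  assumes "Polish_space X"
  shows "sigma_locally_Polish_space X"
  unfolding sigma_locally_Polish_space_def
  by (rule exI[of _ "{topspace X}"]) (use assms in simp)


section \<open>Topological groupoids\<close>

text \<open>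
  Objects and morphisms may have different types; the identification of an object with its
  unit morphism is the map \<open>unit_mor\<close>.  A morphism \<open>g\<close> goes from \<open>source G g\<close> to \<open>target G g\<close>,
  and \<open>mult G g h\<close> (first \<open>h\<close>, then \<open>g\<close>) is meaningful only if \<open>source G g = target G h\<close>.
\<close>

record ('o, 'g) groupoid_data =
  obj_space :: "'o topology"
  mor_space :: "'g topology"
  source :: "'g \<Rightarrow> 'o"
  target :: "'g \<Rightarrow> 'o"
  unit_mor :: "'o \<Rightarrow> 'g"
  mult :: "'g \<Rightarrow> 'g \<Rightarrow> 'g"
  inv_mor :: "'g \<Rightarrow> 'g"

abbreviation Obj :: "('o, 'g) groupoid_data \<Rightarrow> 'o set" where
  "Obj G \<equiv> topspace (obj_space G)"

abbreviation Mor :: "('o, 'g) groupoid_data \<Rightarrow> 'g set" where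
  "Mor G \<equiv> topspace (mor_space G)"

definition composable :: "('o, 'g) groupoid_data \<Rightarrow> ('g \<times> 'g) set" where
  "composable G = {(g, h). g \<in> Mor G \<and> h \<in> Mor G \<and> source G g = target G h}"

locale groupoid =
  fixes G :: "('o, 'g) groupoid_data"
  assumes source_in: "g \<in> Mor G \<Longrightarrow> source G g \<in> Obj G"
    and target_in: "g \<in> Mor G \<Longrightarrow> target G g \<in> Obj G"
    and unit_in: "x \<in> Obj G \<Longrightarrow> unit_mor G x \<in> Mor G"
    and source_unit: "x \<in> Obj G \<Longrightarrow> source G (unit_mor G x) = x"
    and target_unit: "x \<in> Obj G \<Longrightarrow> target G (unit_mor G x) = x"
    and mult_in: "(g, h) \<in> composable G \<Longrightarrow> mult G g h \<in> Mor G"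
    and source_mult: "(g, h) \<in> composable G \<Longrightarrow> source G (mult G g h) = source G h"
    and target_mult: "(g, h) \<in> composable G \<Longrightarrow> target G (mult G g h) = target G g"
    and mult_assoc: "(g, h) \<in> composable G \<Longrightarrow> (h, k) \<in> composable G \<Longrightarrow>
          mult G (mult G g h) k = mult G g (mult G h k)"
    and mult_unit_source: "g \<in> Mor G \<Longrightarrow> mult G g (unit_mor G (source G g)) = g"
    and mult_unit_target: "g \<in> Mor G \<Longrightarrow> mult G (unit_mor G (target G g)) g = g"
    and inv_in: "g \<in> Mor G \<Longrightarrow> inv_mor G g \<in> Mor G"
    and source_inv: "g \<in> Mor G \<Longrightarrow> source G (inv_mor G g) = target G g"
    and target_inv: "g \<in> Mor G \<Longrightarrow> target G (inv_mor G g) = source G g"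
    and mult_inv_left: "g \<in> Mor G \<Longrightarrow> mult G (inv_mor G g) g = unit_mor G (source G g)"
    and mult_inv_right: "g \<in> Mor G \<Longrightarrow> mult G g (inv_mor G g) = unit_mor G (target G g)"

locale topological_groupoid = groupoid G
  for G :: "('o, 'g) groupoid_data" +
  assumes source_continuous: "continuous_map (mor_space G) (obj_space G) (source G)"
    and target_continuous: "continuous_map (mor_space G) (obj_space G) (target G)"
    and unit_continuous: "continuous_map (obj_space G) (mor_space G) (unit_mor G)"
    and inv_continuous: "continuous_map (mor_space G) (mor_space G) (inv_mor G)"
    and mult_continuous:
      "continuous_map (subtopology (prod_topology (mor_space G) (mor_space G)) (composable G))
         (mor_space G) (\<lambda>(g, h). mult G g h)"

locale open_topological_groupoid = topological_groupoid G
  for G :: "('o, 'g) groupoid_data" +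
  assumes source_open: "open_map (mor_space G) (obj_space G) (source G)"

definition Polish_groupoid :: "('o, 'g) groupoid_data \<Rightarrow> bool" where
  "Polish_groupoid G \<longleftrightarrow>
     topological_groupoid G \<and> Polish_space (obj_space G) \<and> Polish_space (mor_space G)"

definition sigma_locally_Polish_groupoid :: "('o, 'g) groupoid_data \<Rightarrow> bool" where
  "sigma_locally_Polish_groupoid G \<longleftrightarrow>
     topological_groupoid G \<and>
     sigma_locally_Polish_space (obj_space G) \<and> sigma_locally_Polish_space (mor_space G)"

lemma Polish_groupoid_imp_sigma_locally_Polish:
  "Polish_groupoid G \<Longrightarrow> sigma_locally_Polish_groupoid G"
  by (simp add: Polish_groupoid_def sigma_locally_Polish_groupoid_def
      Polish_imp_sigma_locally_Polish)

definition topological_groupoid_iso ::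
  "('o, 'g) groupoid_data \<Rightarrow> ('p, 'h) groupoid_data \<Rightarrow> ('o \<Rightarrow> 'p) \<Rightarrow> ('g \<Rightarrow> 'h) \<Rightarrow> bool" where
  "topological_groupoid_iso G H F \<Phi> \<longleftrightarrow>
     homeomorphic_map (obj_space G) (obj_space H) F \<and>
     homeomorphic_map (mor_space G) (mor_space H) \<Phi> \<and>
     (\<forall>g\<in>Mor G. source H (\<Phi> g) = F (source G g)) \<and>
     (\<forall>g\<in>Mor G. target H (\<Phi> g) = F (target G g)) \<and>
     (\<forall>x\<in>Obj G. \<Phi> (unit_mor G x) = unit_mor H (F x)) \<and>
     (\<forall>(g, h)\<in>composable G. \<Phi> (mult G g h) = mult H (\<Phi> g) (\<Phi> h))"


section \<open>Topometric spaces\<close>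

text \<open>
  The metric of a topometric space need not induce its topology.
\<close>

definition usc_on :: "'a topology \<Rightarrow> ('a \<Rightarrow> real) \<Rightarrow> bool" where
  "usc_on X V \<longleftrightarrow> (\<forall>r. openin X {a \<in> topspace X. V a < r})"

definition topometric_space :: "'a topology \<Rightarrow> ('a \<Rightarrow> 'a \<Rightarrow> real) \<Rightarrow> bool" where
  "topometric_space A d \<longleftrightarrow>
     Metric_space (topspace A) d \<and>
     (\<forall>a\<in>topspace A. \<forall>b\<in>topspace A. d a b \<le> 1) \<and>
     (\<forall>U. openin A U \<longleftrightarrow>
        (\<exists>V. V \<in> topspace A \<rightarrow> {0..1} \<and> usc_on A V \<and>
             (\<forall>a\<in>topspace A. \<forall>b\<in>topspace A. \<bar>V a - V b\<bar> \<le> d a b) \<and>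
             U = {a \<in> topspace A. V a < 1}))"

definition complete_topometric_space :: "'a topology \<Rightarrow> ('a \<Rightarrow> 'a \<Rightarrow> real) \<Rightarrow> bool" where
  "complete_topometric_space A d \<longleftrightarrow>
     topometric_space A d \<and> Metric_space.mcomplete (topspace A) d"


section \<open>Metric-etale spaces\<close>

definition metric_etale_space ::
  "'x topology \<Rightarrow> 'a topology \<Rightarrow> ('a \<Rightarrow> 'a \<Rightarrow> real) \<Rightarrow> ('a \<Rightarrow> 'x) \<Rightarrow> bool" where
  "metric_etale_space X A d p \<longleftrightarrow>
     complete_topometric_space A d \<and>
     continuous_map A X p \<and> open_map A X p \<and>
     (\<forall>a\<in>topspace A. \<forall>b\<in>topspace A. p a \<noteq> p b \<longrightarrow> d a b = 1) \<and>
     usc_on (subtopology (prod_topology A A) {(a, b). p a = p b}) (\<lambda>(a, b). d a b)"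

text \<open>
  The \<open>n\<close>-ary fibre product is encoded with the base point as an additional coordinate:
  its points are the pairs \<open>(x, a)\<close> with \<open>a i\<close> in the fibre of \<open>A i\<close> over \<open>x\<close> for \<open>i < n\<close>.
  For \<open>n = 0\<close> this is a copy of \<open>X\<close>; for \<open>n > 0\<close> the coordinate \<open>x = p 0 (a 0)\<close> is
  redundant, see \<open>fiber_product_homeomorphic\<close> below.
\<close>

definition fiber_product ::
  "'x topology \<Rightarrow> nat \<Rightarrow> (nat \<Rightarrow> 'a topology) \<Rightarrow> (nat \<Rightarrow> 'a \<Rightarrow> 'x) \<Rightarrow> ('x \<times> (nat \<Rightarrow> 'a)) topology" where
  "fiber_product X n A p =
     subtopology (prod_topology X (product_topology A {..<n})) {(x, a). \<forall>i<n. p i (a i) = x}"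

lemma fiber_product_homeomorphic:
  assumes "n > 0" and "\<And>i. i < n \<Longrightarrow> continuous_map (A i) X (p i)"
  shows "homeomorphic_map (fiber_product X n A p)
           (subtopology (product_topology A {..<n}) {a. \<forall>i<n. \<forall>j<n. p i (a i) = p j (a j)}) snd"
    (is "homeomorphic_map ?F ?S snd")
proof -
  have F: "p i (a i) = x" if "(x, a) \<in> topspace ?F" "i < n" for x a i
    using that by (simp add: fiber_product_def)
  have S: "p i (a i) = p j (a j)" if "a \<in> topspace ?S" "i < n" "j < n" for a i j
  proof -
    have "a \<in> {a. \<forall>i<n. \<forall>j<n. p i (a i) = p j (a j)}"
      using that(1) unfolding topspace_subtopology by (rule IntD2)
    with that(2,3) show ?thesis
      by blast
  qed
  have "continuous_map ?F (product_topology A {..<n}) snd"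
    unfolding fiber_product_def
    by (intro continuous_map_from_subtopology continuous_map_snd)
  then have 1: "continuous_map ?F ?S snd"
    unfolding continuous_map_in_subtopology
  proof
    show "snd \<in> topspace ?F \<rightarrow> {a. \<forall>i<n. \<forall>j<n. p i (a i) = p j (a j)}"
    proof
      fix z assume "z \<in> topspace ?F"
      then have "(fst z, snd z) \<in> topspace ?F"
        by simp
      then show "snd z \<in> {a. \<forall>i<n. \<forall>j<n. p i (a i) = p j (a j)}"
        by (intro CollectI allI impI) (rule trans[OF F F[symmetric]])
    qed
  qed
  have "continuous_map ?S (A 0) (\<lambda>a. a 0)"
    by (intro continuous_map_from_subtopology continuous_map_product_projection)
      (use \<open>n > 0\<close> in simp)
  from continuous_map_compose[OF this assms(2)[OF \<open>n > 0\<close>]]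
  have "continuous_map ?S X (\<lambda>a. p 0 (a 0))"
    unfolding o_def .
  then have "continuous_map ?S (prod_topology X (product_topology A {..<n})) (\<lambda>a. (p 0 (a 0), a))"
    by (rule continuous_map_pairedI)
      (intro continuous_map_from_subtopology continuous_map_id[unfolded id_def])
  then have 2: "continuous_map ?S ?F (\<lambda>a. (p 0 (a 0), a))"
    unfolding fiber_product_def continuous_map_in_subtopology
  proof
    show "(\<lambda>a. (p 0 (a 0), a)) \<in> topspace ?S \<rightarrow> {(x, a). \<forall>i<n. p i (a i) = x}"
      using S \<open>n > 0\<close> by blast
  qed
  have 3: "(p 0 (snd z 0), snd z) = z" if "z \<in> topspace ?F" for z
    using F[of "fst z" "snd z" 0] that \<open>n > 0\<close> by (simp add: prod_eq_iff)
  have "homeomorphic_maps ?F ?S snd (\<lambda>a. (p 0 (a 0), a))"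
    unfolding homeomorphic_maps_def by (intro conjI ballI 1 2 3 snd_conv)
  then show ?thesis
    unfolding homeomorphic_map_maps by (rule exI[of "homeomorphic_maps ?F ?S snd"])
qed


section \<open>Metric-etale structures\<close>

record ('s, 'r) language =
  sorts :: "'s set"
  rels :: "'r set"
  arity :: "'r \<Rightarrow> 's list"

definition language_wf :: "('s, 'r) language \<Rightarrow> bool" where
  "language_wf L \<longleftrightarrow> (\<forall>R\<in>rels L. set (arity L R) \<subseteq> sorts L)"

definition countable_language :: "('s, 'r) language \<Rightarrow> bool" where
  "countable_language L \<longleftrightarrow> countable (sorts L) \<and> countable (rels L)"

record ('s, 'r, 'x, 'a) metric_etale_data =
  sort_space :: "'s \<Rightarrow> 'a topology"
  sort_dist :: "'s \<Rightarrow> 'a \<Rightarrow> 'a \<Rightarrow> real"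
  sort_proj :: "'s \<Rightarrow> 'a \<Rightarrow> 'x"
  rel_interp :: "'r \<Rightarrow> 'x \<times> (nat \<Rightarrow> 'a) \<Rightarrow> real"

definition rel_domain ::
  "('s, 'r) language \<Rightarrow> 'x topology \<Rightarrow> ('s, 'r, 'x, 'a) metric_etale_data \<Rightarrow> 'r \<Rightarrow>
     ('x \<times> (nat \<Rightarrow> 'a)) topology" where
  "rel_domain L X M R =
     fiber_product X (length (arity L R))
       (\<lambda>i. sort_space M (arity L R ! i)) (\<lambda>i. sort_proj M (arity L R ! i))"

text \<open>
  The Lipschitz condition is imposed inside each fibre.  Tuples over distinct points of \<open>X\<close>
  are at distance \<open>1\<close>, so there the condition holds trivially; this includes the
  nullary fibre product \<open>X\<close>, where the empty sum would wrongly give distance \<open>0\<close>.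
\<close>

definition metric_etale_structure ::
  "('s, 'r) language \<Rightarrow> 'x topology \<Rightarrow> ('s, 'r, 'x, 'a) metric_etale_data \<Rightarrow> bool" where
  "metric_etale_structure L X M \<longleftrightarrow>
     language_wf L \<and>
     (\<forall>P\<in>sorts L. metric_etale_space X (sort_space M P) (sort_dist M P) (sort_proj M P)) \<and>
     (\<forall>R\<in>rels L.
        rel_interp M R \<in> topspace (rel_domain L X M R) \<rightarrow> {0..1} \<and>
        usc_on (rel_domain L X M R) (rel_interp M R) \<and>
        (\<forall>x a b. (x, a) \<in> topspace (rel_domain L X M R) \<longrightarrow>
                 (x, b) \<in> topspace (rel_domain L X M R) \<longrightarrow>
           \<bar>rel_interp M R (x, a) - rel_interp M R (x, b)\<bar>
             \<le> min 1 (\<Sum>i<length (arity L R). sort_dist M (arity L R ! i) (a i) (b i))))"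

definition second_countable_structure ::
  "('s, 'r) language \<Rightarrow> 'x topology \<Rightarrow> ('s, 'r, 'x, 'a) metric_etale_data \<Rightarrow> bool" where
  "second_countable_structure L X M \<longleftrightarrow>
     countable_language L \<and> second_countable X \<and>
     (\<forall>P\<in>sorts L. second_countable (sort_space M P))"


section \<open>The isomorphism groupoid\<close>

definition fiber :: "('s, 'r, 'x, 'a) metric_etale_data \<Rightarrow> 's \<Rightarrow> 'x \<Rightarrow> 'a set" where
  "fiber M P x = {a \<in> topspace (sort_space M P). sort_proj M P a = x}"

text \<open>
  Isomorphisms \<open>M\<^sub>x \<cong> M\<^sub>y\<close> are represented by total functions with the value \<open>undefined\<close>
  outside the sorts and outside the fibres over \<open>x\<close>, so that each
  isomorphism has exactly one representative.
\<close>

definition fiber_isos ::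
  "('s, 'r) language \<Rightarrow> 'x topology \<Rightarrow> ('s, 'r, 'x, 'a) metric_etale_data \<Rightarrow> 'x \<Rightarrow> 'x \<Rightarrow>
     ('s \<Rightarrow> 'a \<Rightarrow> 'a) set" where
  "fiber_isos L X M x y =
     {f \<in> extensional (sorts L).
        (\<forall>P\<in>sorts L. f P \<in> extensional (fiber M P x) \<and>
           bij_betw (f P) (fiber M P x) (fiber M P y) \<and>
           (\<forall>a\<in>fiber M P x. \<forall>b\<in>fiber M P x. sort_dist M P (f P a) (f P b) = sort_dist M P a b)) \<and>
        (\<forall>R\<in>rels L. \<forall>a. (x, a) \<in> topspace (rel_domain L X M R) \<longrightarrow>
           rel_interp M R (y, \<lambda>i\<in>{..<length (arity L R)}. f (arity L R ! i) (a i))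
             = rel_interp M R (x, a))}"

definition Iso_mor ::
  "('s, 'r) language \<Rightarrow> 'x topology \<Rightarrow> ('s, 'r, 'x, 'a) metric_etale_data \<Rightarrow>
     ('x \<times> 'x \<times> ('s \<Rightarrow> 'a \<Rightarrow> 'a)) set" where
  "Iso_mor L X M = {(x, y, f). x \<in> topspace X \<and> y \<in> topspace X \<and> f \<in> fiber_isos L X M x y}"

definition Iso_topology ::
  "('s, 'r) language \<Rightarrow> 'x topology \<Rightarrow> ('s, 'r, 'x, 'a) metric_etale_data \<Rightarrow>
     ('x \<times> 'x \<times> ('s \<Rightarrow> 'a \<Rightarrow> 'a)) topology" where
  "Iso_topology L X M = topology_generated_by
     ({{(x, y, f) \<in> Iso_mor L X M. x \<in> U} |U. openin X U} \<union>
      {{(x, y, f) \<in> Iso_mor L X M. y \<in> U} |U. openin X U} \<union>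
      {{(x, y, f) \<in> Iso_mor L X M. f P ` (S \<inter> fiber M P x) \<inter> (T \<inter> fiber M P y) \<noteq> {}} |P S T.
         P \<in> sorts L \<and> openin (sort_space M P) S \<and> openin (sort_space M P) T})"

lemma topspace_Iso_topology: "topspace (Iso_topology L X M) = Iso_mor L X M"
proof
  show "topspace (Iso_topology L X M) \<subseteq> Iso_mor L X M"
    unfolding Iso_topology_def topology_generated_by_topspace
    by (rule Union_least) auto
  have "Iso_mor L X M = {(x, y, f) \<in> Iso_mor L X M. x \<in> topspace X}"
    by (auto simp: Iso_mor_def)
  then have "Iso_mor L X M \<in> {{(x, y, f) \<in> Iso_mor L X M. x \<in> U} |U. openin X U}"
    using openin_topspace by (intro CollectI exI conjI)
  then show "Iso_mor L X M \<subseteq> topspace (Iso_topology L X M)"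
    unfolding Iso_topology_def topology_generated_by_topspace
    by (intro Union_upper UnI1)
qed

definition Iso_groupoid ::
  "('s, 'r) language \<Rightarrow> 'x topology \<Rightarrow> ('s, 'r, 'x, 'a) metric_etale_data \<Rightarrow>
     ('x, 'x \<times> 'x \<times> ('s \<Rightarrow> 'a \<Rightarrow> 'a)) groupoid_data" where
  "Iso_groupoid L X M =
     \<lparr>obj_space = X,
      mor_space = Iso_topology L X M,
      source = (\<lambda>(x, y, f). x),
      target = (\<lambda>(x, y, f). y),
      unit_mor = (\<lambda>x. (x, x, \<lambda>P\<in>sorts L. \<lambda>a\<in>fiber M P x. a)),
      mult = (\<lambda>(y, z, g) (x, y', f). (x, z, \<lambda>P\<in>sorts L. compose (fiber M P x) (g P) (f P))),
      inv_mor = (\<lambda>(x, y, f).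
        (y, x, \<lambda>P\<in>sorts L. \<lambda>b\<in>fiber M P y. inv_into (fiber M P x) (f P) b))\<rparr>"

end

theory Submission
  imports Defs
begin

text \<open>
The structure is made so that left translations are its only isomorphisms between fibres.  A groupoid \<open>G\<close>
acts by left multiplication on the fibres of its target map, and an arrow \<open>g\<close> is recovered from this action as the
translate of a unit.  It remains to turn the target fibres into complete metric spaces without losing any information.

\<^bold>\<open>Metrics.\<close>  Over an open metrizable set \<open>U\<close> of objects a Birkhoff--Kakutani argument gives an upper
semicontinuous norm \<open>\<rho>\<close> on the arrows with both ends in \<open>U\<close>; metrizability of \<open>U\<close> replaces the homogeneity
of a group, since it allows to halve neighbourhoods of all units over \<open>U\<close> at once (\<open>half_neighbourhood\<close>,
\<open>exists_norm\<close>).  Then \<open>\<rho> (h\<inverse> k)\<close> is a left-invariant distance between arrows \<open>h\<close>, \<open>k\<close> that have a common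
target and sources in \<open>U\<close>.  Completing it fibre by fibre gives a metric-etale space (\<open>metric_etale_ctop\<close>), with one
sort for each member of a countable cover of the objects by open Polish sets.

\<^bold>\<open>Relations.\<close>  For each pair of sorts and each basic open set \<open>B\<close> of arrows, a binary relation measures how far a
pair \<open>(a, b)\<close> is from the pairs \<open>(h, k)\<close> of arrows with \<open>h\<inverse> k \<in> B\<close>.  These relations are left-invariant, so left
translation by \<open>g\<close> is an isomorphism \<open>Phi g\<close> of fibres.  The map \<open>Phi\<close> is continuous because products of open
sets of arrows are open in an open groupoid (\<open>moves_open\<close>), and open onto its image because the norms are small only
near units (\<open>basic_neighbourhood\<close>).

\<^bold>\<open>Surjectivity.\<close>  The completions may contain points that are not arrows, and the main point is that an isomorphism
\<open>\<phi>\<close> from the fibre over \<open>x\<close> to the fibre over \<open>y\<close> still comes from an arrow.  In a sort given by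
some \<open>U\<close> with \<open>x \<in> U\<close>, the arrows form dense, locally completely metrizable subsets of both fibres; as \<open>\<phi>\<close> is
isometric, the Baire category theorem gives an arrow \<open>a\<close> into \<open>x\<close> that \<open>\<phi>\<close> sends to an arrow \<open>b\<close>
(\<open>isometry_meets_groupoid\<close>).  The relations force \<open>a\<close> and \<open>b\<close> to have the same source, and they force
\<open>\<phi>\<close> to send every arrow \<open>c\<close> into \<open>x\<close> to \<open>b a\<inverse> c\<close>, because \<open>c\<close> is pinned down by its position \<open>a\<inverse> c\<close>
relative to \<open>a\<close>.  By density \<open>\<phi>\<close> is translation by \<open>b a\<inverse>\<close> (\<open>Phi_surj\<close>).
\<close>

section \<open>Polish spaces, Baire category and paracompactness\<close>

lemma Polish_imp_second_countable:
  assumes "Polish_space X"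
  shows "second_countable X"
proof -
  obtain M d where M: "Metric_space M d" and X: "X = Metric_space.mtopology M d"
    using assms completely_metrizable_imp_metrizable_space
    unfolding Polish_space_def metrizable_space_def by blast
  interpret Metric_space M d by fact
  obtain C where C: "countable C" "C \<subseteq> M" "mtopology closure_of C = M"
    using assms X unfolding Polish_space_def separable_space_def by auto
  let ?B = "(\<lambda>(x, r). mball x r) ` (C \<times> {r \<in> \<rat>. 0 < r})"
  show ?thesis
    unfolding second_countable_def X
  proof (intro exI[of _ ?B] conjI allI impI ballI)
    show "countable ?B"
      using C(1) by (intro countable_image countable_SIGMA) (auto intro: countable_subset[OF _ countable_rat])
    show "openin mtopology V" if "V \<in> ?B" for V using that by auto
    fix Q x assume Q: "openin mtopology Q \<and> x \<in> Q"
    then obtain r where r: "r > 0" "mball x r \<subseteq> Q" "x \<in> M"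
      unfolding openin_mtopology by blast
    obtain q where q: "q \<in> \<rat>" "0 < q" "q < r / 2" using Rats_dense_in_real[of 0 "r / 2"] r by auto
    obtain c where c: "c \<in> C" "c \<in> mball x q" using C(3) r(3) q(2) unfolding metric_closure_of by blast
    have "mball c q \<subseteq> mball x r"
    proof
      fix y assume "y \<in> mball c q"
      then show "y \<in> mball x r" using c q triangle[of x c y] by auto
    qed
    moreover have "x \<in> mball c q" using c commute[of x c] r by auto
    ultimately show "\<exists>V\<in>?B. x \<in> V \<and> V \<subseteq> Q"
      using c(1) q r(2) by (intro bexI[of _ "mball c q"]) auto
  qed
qed

lemma sigma_locally_Polish_imp_second_countable:
  assumes "sigma_locally_Polish_space X"
  shows "second_countable X"
proof -
  obtain \<U> where U1: "countable \<U>"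
    and U23: "\<forall>U\<in>\<U>. openin X U \<and> Polish_space (subtopology X U)" and U4: "\<Union>\<U> = topspace X"
    using assms unfolding sigma_locally_Polish_space_def by (elim exE conjE) (rule that)
  have U2: "openin X U" and U3: "Polish_space (subtopology X U)" if "U \<in> \<U>" for U
    using U23 that by blast+
  have "\<exists>B. countable B \<and> (\<forall>V \<in> B. openin X V) \<and>
             (\<forall>Q x. openin (subtopology X U) Q \<and> x \<in> Q \<longrightarrow> (\<exists>V \<in> B. x \<in> V \<and> V \<subseteq> Q))"
    if Uin: "U \<in> \<U>" for U
  proof -
    obtain B where "countable B" "\<forall>V \<in> B. openin (subtopology X U) V"
      "\<forall>Q x. openin (subtopology X U) Q \<and> x \<in> Q \<longrightarrow> (\<exists>V \<in> B. x \<in> V \<and> V \<subseteq> Q)"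
      using Polish_imp_second_countable[OF U3[OF Uin]]
      unfolding second_countable_def by (elim exE conjE) (rule that)
    moreover have "openin X V" if "openin (subtopology X U) V" for V
      using openin_trans_full[OF that U2[OF Uin]] .
    ultimately show ?thesis by blast
  qed
  then have "\<forall>U\<in>\<U>. \<exists>B. countable B \<and> (\<forall>V \<in> B. openin X V) \<and>
             (\<forall>Q x. openin (subtopology X U) Q \<and> x \<in> Q \<longrightarrow> (\<exists>V \<in> B. x \<in> V \<and> V \<subseteq> Q))"
    by blast
  from bchoice[OF this] obtain B where B0: "\<forall>U\<in>\<U>. countable (B U) \<and> (\<forall>V \<in> B U. openin X V) \<and>
             (\<forall>Q x. openin (subtopology X U) Q \<and> x \<in> Q \<longrightarrow> (\<exists>V \<in> B U. x \<in> V \<and> V \<subseteq> Q))"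
    by (elim exE) (rule that)
  have B: "countable (B U)" "\<forall>V\<in>B U. openin X V"
    "\<forall>Q x. openin (subtopology X U) Q \<and> x \<in> Q \<longrightarrow> (\<exists>V \<in> B U. x \<in> V \<and> V \<subseteq> Q)" if "U \<in> \<U>" for U
    using B0 that by blast+
  show ?thesis
    unfolding second_countable_def
  proof (intro exI[of _ "\<Union>U\<in>\<U>. B U"] conjI allI impI ballI)
    show "countable (\<Union>U\<in>\<U>. B U)" using U1 B(1) by blast
    show "openin X V" if "V \<in> (\<Union>U\<in>\<U>. B U)" for V using that B(2) by blast
    fix Q x assume Q: "openin X Q \<and> x \<in> Q"
    then obtain U where Ux: "U \<in> \<U>" "x \<in> U" using U4 openin_subset by blast
    then have "openin (subtopology X U) (Q \<inter> U)" using Q openin_subtopology_Int by blast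
    then obtain V where "V \<in> B U" "x \<in> V" "V \<subseteq> Q \<inter> U" using B(3)[OF Ux(1)] Q Ux by blast
    then show "\<exists>V\<in>\<Union>U\<in>\<U>. B U. x \<in> V \<and> V \<subseteq> Q" using Ux by blast
  qed
qed

text \<open>
Completely metrizable subspaces of a complete metric space are \<open>G\<^sub>\<delta>\<close>, so on \<open>Z\<close> both sets are countable
intersections of dense open sets.
\<close>
lemma dense_completely_metrizable_meet:
  assumes M: "Metric_space M d" and cpl: "Metric_space.mcomplete M d"
    and A: "A \<subseteq> M" "completely_metrizable_space (subtopology (Metric_space.mtopology M d) A)"
    and B: "B \<subseteq> M" "completely_metrizable_space (subtopology (Metric_space.mtopology M d) B)"
    and Z: "openin (Metric_space.mtopology M d) Z" "Z \<noteq> {}"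
    and ZA: "Z \<subseteq> Metric_space.mtopology M d closure_of A"
    and ZB: "Z \<subseteq> Metric_space.mtopology M d closure_of B"
  shows "A \<inter> B \<noteq> {}"
proof -
  interpret Metric_space M d by fact
  have cm: "completely_metrizable_space mtopology"
    using cpl M completely_metrizable_space_def by blast
  have dense: "\<exists>C::nat \<Rightarrow> 'a set. \<Inter>(range C) = S \<and> (\<forall>n. openin (subtopology mtopology Z) (C n \<inter> Z) \<and>
      subtopology mtopology Z closure_of (C n \<inter> Z) = Z)"
    if S: "S \<subseteq> M" "completely_metrizable_space (subtopology mtopology S)" "Z \<subseteq> mtopology closure_of S" for S
  proof -
    have "gdelta_in mtopology S"
      using completely_metrizable_space_eq_gdelta_in[OF cm] S by simp
    then obtain C :: "nat \<Rightarrow> 'a set" where C: "\<forall>n. openin mtopology (C n)" "\<Inter>(range C) = S"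
      unfolding gdelta_in_descending by blast
    have "subtopology mtopology Z closure_of (C n \<inter> Z) = Z" for n
    proof
      show "subtopology mtopology Z closure_of (C n \<inter> Z) \<subseteq> Z"
        using closure_of_subset_topspace[of "subtopology mtopology Z"] by fastforce
      show "Z \<subseteq> subtopology mtopology Z closure_of (C n \<inter> Z)"
      proof
        fix z assume z: "z \<in> Z"
        have "\<exists>y\<in>C n \<inter> Z. y \<in> T" if T: "z \<in> T" "openin (subtopology mtopology Z) T" for T
        proof -
          have "openin mtopology T" using T(2) Z(1) openin_trans_full by blast
          moreover have "z \<in> mtopology closure_of S" using z S(3) by blast
          ultimately obtain y where "y \<in> S" "y \<in> T" using T(1) unfolding in_closure_of by blast
          moreover have "T \<subseteq> Z" using T(2) openin_imp_subset by blast
          ultimately show ?thesis using C(2) by blast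
        qed
        moreover have "z \<in> topspace (subtopology mtopology Z)"
          using z Z(1) openin_subset by fastforce
        ultimately show "z \<in> subtopology mtopology Z closure_of (C n \<inter> Z)"
          unfolding in_closure_of by blast
      qed
    qed
    moreover have "openin (subtopology mtopology Z) (C n \<inter> Z)" for n
      using C(1) openin_subtopology_Int by blast
    ultimately show ?thesis using C(2) by (intro exI[of _ C]) simp
  qed
  obtain CA :: "nat \<Rightarrow> 'a set" where CA: "\<Inter>(range CA) = A"
    "\<forall>n. openin (subtopology mtopology Z) (CA n \<inter> Z) \<and> subtopology mtopology Z closure_of (CA n \<inter> Z) = Z"
    using dense[OF A ZA] by (elim exE conjE) (rule that)
  obtain CB :: "nat \<Rightarrow> 'a set" where CB: "\<Inter>(range CB) = B"
    "\<forall>n. openin (subtopology mtopology Z) (CB n \<inter> Z) \<and> subtopology mtopology Z closure_of (CB n \<inter> Z) = Z"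
    using dense[OF B ZB] by (elim exE conjE) (rule that)
  let ?\<G> = "range (\<lambda>n. CA n \<inter> Z) \<union> range (\<lambda>n. CB n \<inter> Z)"
  have tZ: "topspace (subtopology mtopology Z) = Z" using Z(1) openin_subset by fastforce
  have "subtopology mtopology Z closure_of \<Inter>?\<G> = topspace (subtopology mtopology Z)"
  proof (rule Baire_category)
    show "completely_metrizable_space (subtopology mtopology Z) \<or>
       locally_compact_space (subtopology mtopology Z) \<and> regular_space (subtopology mtopology Z)"
      using completely_metrizable_space_openin[OF cm Z(1)] by simp
    show "countable ?\<G>" by simp
    show "openin (subtopology mtopology Z) T \<and>
       subtopology mtopology Z closure_of T = topspace (subtopology mtopology Z)" if "T \<in> ?\<G>" for T
      using that CA(2) CB(2) tZ by auto
  qed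
  then have "subtopology mtopology Z closure_of \<Inter>?\<G> \<noteq> {}" using tZ Z(2) by simp
  then have "\<Inter>?\<G> \<noteq> {}" by (metis closure_of_empty)
  then obtain w where "w \<in> \<Inter>?\<G>" by blast
  then have "w \<in> \<Inter>(range CA)" "w \<in> \<Inter>(range CB)" by auto
  then show ?thesis using CA(1) CB(1) by blast
qed

text \<open>
The two conditions express that \<open>f\<close> is a topological embedding in terms of the distances of the target only.
Injectivity is a consequence, as the topology of \<open>E\<close> separates points.
\<close>
lemma completely_metrizable_embedded_image:
  assumes M: "Metric_space M d" and E: "completely_metrizable_space E"
    and f: "\<And>h. h \<in> topspace E \<Longrightarrow> f h \<in> M"
    and cont: "\<And>h r. h \<in> topspace E \<Longrightarrow> 0 < r \<Longrightarrow> \<exists>S. openin E S \<and> h \<in> S \<and> (\<forall>k\<in>S. d (f h) (f k) < r)"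
    and emb: "\<And>h Q. openin E Q \<Longrightarrow> h \<in> Q \<Longrightarrow> \<exists>r>0. \<forall>k\<in>topspace E. d (f h) (f k) < r \<longrightarrow> k \<in> Q"
  shows "completely_metrizable_space (subtopology (Metric_space.mtopology M d) (f ` topspace E))"
proof -
  interpret Metric_space M d by fact
  have HE: "Hausdorff_space E"
    using E completely_metrizable_imp_metrizable_space metrizable_imp_Hausdorff_space by blast
  have inj: "inj_on f (topspace E)"
  proof (rule inj_onI, rule ccontr)
    fix h k assume hk: "h \<in> topspace E" "k \<in> topspace E" "f h = f k" "h \<noteq> k"
    then have "\<exists>Q R. openin E Q \<and> openin E R \<and> h \<in> Q \<and> k \<in> R \<and> disjnt Q R"
      using HE unfolding Hausdorff_space_def by simp
    then obtain Q R where Q: "openin E Q" "h \<in> Q" and "k \<in> R" "disjnt Q R"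
      by (elim exE conjE) (rule that)
    obtain r where "r > 0" "\<forall>k\<in>topspace E. d (f h) (f k) < r \<longrightarrow> k \<in> Q"
      using emb[OF Q] by (elim exE conjE) (rule that)
    then have "k \<in> Q" using hk f by force
    then show False using \<open>k \<in> R\<close> \<open>disjnt Q R\<close> by (auto simp: disjnt_iff)
  qed
  have "homeomorphic_map E (subtopology mtopology (f ` topspace E)) f"
  proof (rule bijective_open_imp_homeomorphic_map)
    have "continuous_map E mtopology f"
      unfolding continuous_map_def
    proof (intro conjI allI impI)
      show "f \<in> topspace E \<rightarrow> topspace mtopology" using f by simp
      fix W assume W: "openin mtopology W"
      show "openin E {x \<in> topspace E. f x \<in> W}"
      proof (subst openin_subopen, intro ballI)
        fix h assume h: "h \<in> {x \<in> topspace E. f x \<in> W}"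
        then obtain r where r: "r > 0" "mball (f h) r \<subseteq> W" using W unfolding openin_mtopology by blast
        have hE: "h \<in> topspace E" using h by simp
        obtain S where S: "openin E S" "h \<in> S" "\<forall>k\<in>S. d (f h) (f k) < r"
          using cont[OF hE r(1)] by (elim exE conjE) (rule that)
        have "S \<subseteq> {x \<in> topspace E. f x \<in> W}"
        proof
          fix k assume k: "k \<in> S"
          then have kE: "k \<in> topspace E" using S openin_subset by blast
          then have "f k \<in> mball (f h) r" using k S f h by simp
          then show "k \<in> {x \<in> topspace E. f x \<in> W}" using r kE by blast
        qed
        then show "\<exists>T. openin E T \<and> h \<in> T \<and> T \<subseteq> {x \<in> topspace E. f x \<in> W}" using S by blast
      qed
    qed
    then show "continuous_map E (subtopology mtopology (f ` topspace E)) f"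
      by (simp add: continuous_map_in_subtopology)
    show "open_map E (subtopology mtopology (f ` topspace E)) f"
      unfolding open_map_def
    proof (intro allI impI)
      fix Q assume Q: "openin E Q"
      show "openin (subtopology mtopology (f ` topspace E)) (f ` Q)"
      proof (subst openin_subopen, intro ballI)
        fix z assume "z \<in> f ` Q"
        then obtain h where h: "h \<in> Q" "z = f h" by blast
        then have hE: "h \<in> topspace E" using Q openin_subset by blast
        obtain r where r: "r > 0" "\<forall>k\<in>topspace E. d (f h) (f k) < r \<longrightarrow> k \<in> Q"
          using emb[OF Q h(1)] by (elim exE conjE) (rule that)
        have "openin (subtopology mtopology (f ` topspace E)) (mball z r \<inter> f ` topspace E)"
          using openin_subtopology_Int[OF openin_mball] .
        moreover have "z \<in> mball z r \<inter> f ` topspace E" using h hE f r by simp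
        moreover have "mball z r \<inter> f ` topspace E \<subseteq> f ` Q"
        proof
          fix w assume w: "w \<in> mball z r \<inter> f ` topspace E"
          then obtain k where k: "k \<in> topspace E" "w = f k" by blast
          then have "d (f h) (f k) < r" using w h by simp
          then show "w \<in> f ` Q" using k r by blast
        qed
        ultimately show "\<exists>T. openin (subtopology mtopology (f ` topspace E)) T \<and> z \<in> T \<and> T \<subseteq> f ` Q"
          by blast
      qed
    qed
    show "f ` topspace E = topspace (subtopology mtopology (f ` topspace E))" using f by auto
  qed (rule inj)
  then have "E homeomorphic_space subtopology mtopology (f ` topspace E)"
    by (rule homeomorphic_map_imp_homeomorphic_space)
  then show ?thesis using E homeomorphic_completely_metrizable_space by blast
qed

lemma mcomplete_if_Cauchy_converges:
  assumes "Metric_space M d"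
    and "\<And>s :: nat \<Rightarrow> _. range s \<subseteq> M \<Longrightarrow> (\<And>e. e > 0 \<Longrightarrow> \<exists>N. \<forall>m\<ge>N. \<forall>n\<ge>N. d (s m) (s n) < e) \<Longrightarrow>
           \<exists>l\<in>M. \<forall>e>0. \<exists>N. \<forall>n\<ge>N. d (s n) l < e"
  shows "Metric_space.mcomplete M d"
proof -
  interpret Metric_space M d by fact
  show ?thesis
    unfolding mcomplete_def
  proof (intro allI impI)
    fix s assume s: "MCauchy s"
    then have r: "range s \<subseteq> M"
      by (simp add: MCauchy_def)
    have "\<exists>N. \<forall>m\<ge>N. \<forall>n\<ge>N. d (s m) (s n) < e" if "e > 0" for e
      using s that by (simp add: MCauchy_def)
    then have "\<exists>l\<in>M. \<forall>e>0. \<exists>N. \<forall>n\<ge>N. d (s n) l < e"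
      by (rule assms(2)[OF r])
    with r show "\<exists>l. limitin mtopology s l sequentially"
      unfolding limit_metric_sequentially by (simp add: image_subset_iff) metis
  qed
qed

lemma attains_max_of_decaying:
  fixes f :: "nat \<Rightarrow> real"
  assumes "f m > 0" and "\<And>n. n \<ge> K \<Longrightarrow> f n < f m"
  shows "\<exists>n. \<forall>k. f k \<le> f n"
proof -
  have "m < K" using assms(2)[of m] by force
  have "Max (f ` {..<K}) \<in> f ` {..<K}"
    by (rule Max_in) (use \<open>m < K\<close> in auto)
  then obtain n where n: "n \<in> {..<K}" "f n = Max (f ` {..<K})"
    by force
  have "f k \<le> f n" for k
  proof (cases "k < K")
    case True then show ?thesis using n by simp
  next
    case False
    then have "f k < f m" using assms(2) by simp
    moreover have "f m \<le> f n" using n \<open>m < K\<close> by simp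
    ultimately show ?thesis by simp
  qed
  then show ?thesis by blast
qed

text \<open>
Metrizable Lindelof spaces are paracompact, in a form with closed sets: \<open>E n\<close> is a locally finite closed cover that
is subordinate to the given open cover.
\<close>
lemma closed_locally_finite_refinement:
  assumes "metrizable_space Z" "Lindelof_space Z" "topspace Z \<noteq> {}"
    and C: "\<forall>z\<in>topspace Z. openin Z (C z) \<and> z \<in> C z"
  shows "\<exists>(x :: nat \<Rightarrow> 'a) E.
    (\<forall>n. x n \<in> topspace Z \<and> closedin Z (E n) \<and> E n \<subseteq> C (x n)) \<and>
    (\<forall>z\<in>topspace Z. \<exists>n. z \<in> E n) \<and>
    (\<forall>z\<in>topspace Z. \<exists>Y K::nat. openin Z Y \<and> z \<in> Y \<and> (\<forall>n\<ge>K. E n \<inter> Y = {}))"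
proof -
  obtain M d where M: "Metric_space M d" and Z: "Z = Metric_space.mtopology M d"
    using assms(1) unfolding metrizable_space_def by blast
  interpret Metric_space M d by fact
  have tZ: "topspace Z = M" using Z by simp
  have "\<forall>z\<in>M. \<exists>r>0. mball z r \<subseteq> C z"
    using C openin_mtopology unfolding Z tZ by (metis topspace_mtopology)
  then obtain r0 where r0: "\<And>z. z \<in> M \<Longrightarrow> r0 z > 0 \<and> mball z (r0 z) \<subseteq> C z" by metis
  define r where "r z = min 1 (r0 z)" for z
  have r: "r z > 0" "r z \<le> 1" "mball z (r z) \<subseteq> C z" if "z \<in> M" for z
    using r0[OF that] mball_subset_concentric[of "r z" "r0 z" z] by (auto simp: r_def)
  let ?\<U> = "(\<lambda>z. mball z (r z)) ` M"
  have "\<forall>U\<in>?\<U>. openin Z U" unfolding Z by auto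
  moreover have "\<Union>?\<U> = topspace Z" using r by (auto simp: tZ)
  ultimately obtain \<V> where V: "countable \<V>" "\<V> \<subseteq> ?\<U>" "\<Union>\<V> = topspace Z"
    using assms(2) unfolding Lindelof_space_def by meson
  then obtain T where T: "countable T" "T \<subseteq> M" "\<V> = (\<lambda>z. mball z (r z)) ` T"
    using countable_subset_image[of \<V> "\<lambda>z. mball z (r z)" M] by blast
  have "T \<noteq> {}" using V(3) T(3) assms(3) by (metis image_empty Union_empty)
  define x where "x = from_nat_into T"
  have xM: "x n \<in> M" for n using from_nat_into[OF \<open>T \<noteq> {}\<close>] T by (auto simp: x_def)
  (* Bumps supported in the chosen balls.  The damping factor makes the later ones uniformly small, which gives
     local finiteness of the sets on which the n-th bump is the largest. *)
  define c where "c n z = max 0 (r (x n) - d z (x n)) / 2 ^ n" for n z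
  have c0: "0 \<le> c n z" for n z by (simp add: c_def)
  have c1: "c n z \<le> 1 / 2 ^ n" for n z
    using order.trans[OF diff_mono[OF r(2)[OF xM[of n]] nonneg[of z "x n"]]] unfolding c_def by (intro divide_right_mono) auto
  have cpos: "\<exists>n. c n z > 0" if z: "z \<in> M" for z
  proof -
    obtain y where y: "y \<in> T" "z \<in> mball y (r y)" using V T z tZ by blast
    then obtain n where "x n = y" unfolding x_def using from_nat_into_surj[OF T(1)] by blast
    then have "c n z > 0" using y commute[of y z] by (simp add: c_def)
    then show ?thesis by blast
  qed
  have clip: "c n z \<le> c n w + d z w" if "z \<in> M" "w \<in> M" for n z w
  proof -
    have "max 0 (r (x n) - d z (x n)) \<le> max 0 (r (x n) - d w (x n)) + d z w"
      using triangle[of w z "x n"] that xM[of n] commute[of z w] nonneg[of z w] by auto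
    then have "c n z \<le> c n w + d z w / 2 ^ n"
      unfolding c_def by (simp add: divide_right_mono flip: add_divide_distrib)
    also have "d z w / 2 ^ n \<le> d z w"
      using nonneg[of z w] by (simp add: divide_le_eq mult_ge1_I order.trans[OF _ mult_left_mono[of 1 "2 ^ n"]])
    finally show ?thesis by simp
  qed
  define E where "E n = {z \<in> M. \<forall>m. c m z \<le> c n z}" for n
  have c_tail: "\<exists>K. \<forall>n\<ge>K. \<forall>z. c n z < e" if e: "e > 0" for e
  proof -
    obtain K where K: "1 / 2 ^ K < e"
      using real_arch_pow_inv[OF e, of "1/2"] by (auto simp: power_one_over)
    have "c n z < e" if "n \<ge> K" for n z
    proof -
      have "1 / 2 ^ n \<le> (1::real) / 2 ^ K" using that by (simp add: frac_le)
      then show ?thesis using c1[of n z] K by linarith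
    qed
    then show ?thesis by blast
  qed
  show ?thesis
  proof (intro exI[of _ x] exI[of _ E] conjI allI ballI)
    show "x n \<in> topspace Z" for n using xM tZ by simp
    show "E n \<subseteq> C (x n)" for n
    proof
      fix z assume z: "z \<in> E n"
      then obtain m where "c m z > 0" using cpos by (auto simp: E_def)
      then have "c n z > 0" using z by (auto simp: E_def intro: less_le_trans)
      then have "d z (x n) < r (x n)" by (auto simp: c_def zero_less_divide_iff)
      then have "z \<in> mball (x n) (r (x n))" using z xM commute[of z "x n"] by (auto simp: E_def)
      then show "z \<in> C (x n)" using r(3)[OF xM] by blast
    qed
    show "\<exists>n. z \<in> E n" if z: "z \<in> topspace Z" for z
    proof -
      obtain m where m: "c m z > 0" using cpos z tZ by blast
      obtain K where "\<forall>n\<ge>K. \<forall>w. c n w < c m z" using c_tail[OF m] by blast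
      then obtain n where "\<forall>k. c k z \<le> c n z"
        using attains_max_of_decaying[of "\<lambda>k. c k z" m K] m by blast
      then show ?thesis using z tZ by (auto simp: E_def)
    qed
    show "closedin Z (E n)" for n
      unfolding closedin_def tZ
    proof
      show "openin Z (M - E n)"
        unfolding Z openin_mtopology
      proof (intro conjI allI impI)
        fix z assume z: "z \<in> M - E n"
        then obtain m where m: "c n z < c m z" by (auto simp: E_def not_le)
        have "mball z ((c m z - c n z) / 2) \<subseteq> M - E n"
        proof
          fix w assume w: "w \<in> mball z ((c m z - c n z) / 2)"
          then have "c n w < c m w"
            using clip[of w z n] clip[of z w m] z commute[of z w] by auto
          then show "w \<in> M - E n" using w by (auto simp: E_def not_le)
        qed
        then show "\<exists>r>0. mball z r \<subseteq> M - E n" using m by (intro exI[of _ "(c m z - c n z) / 2"]) auto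
      qed auto
    qed (auto simp: E_def)
    show "\<exists>Y K. openin Z Y \<and> z \<in> Y \<and> (\<forall>n\<ge>K. E n \<inter> Y = {})" if z: "z \<in> topspace Z" for z
    proof -
      obtain m where m: "c m z > 0" using cpos z tZ by blast
      obtain K where K: "\<And>n w. n \<ge> K \<Longrightarrow> c n w < c m z / 2" using c_tail[of "c m z / 2"] m by auto
      have "E n \<inter> mball z (c m z / 2) = {}" if n: "n \<ge> K" for n
      proof -
        have False if w: "w \<in> E n" "w \<in> mball z (c m z / 2)" for w
        proof -
          have "c m w \<le> c n w" "z \<in> M" "w \<in> M" "d z w < c m z / 2"
            using w by (auto simp: E_def)
          then show False using clip[of z w m] K[OF n, of w] by linarith
        qed
        then show ?thesis by blast
      qed
      then show ?thesis
        using m z tZ by (intro exI[of _ "mball z (c m z / 2)"] exI[of _ K]) (auto simp: Z)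
    qed
  qed
qed

section \<open>Fibrewise completion of a bundle of pseudometric spaces\<close>

text \<open>
The data of a metric-etale space before completion and separation: the pseudometric \<open>d\<close> is upper semicontinuous
on pairs over a common base point.
\<close>
locale pre_metric_etale =
  fixes X :: "'x topology" and Y :: "'y topology"
    and d :: "'y \<Rightarrow> 'y \<Rightarrow> real" and p :: "'y \<Rightarrow> 'x"
  assumes p_cont: "continuous_map Y X p"
    and p_open: "open_map Y X p"
    and d_le1: "h \<in> topspace Y \<Longrightarrow> k \<in> topspace Y \<Longrightarrow> d h k \<le> 1"
    and d_refl: "h \<in> topspace Y \<Longrightarrow> d h h = 0"
    and d_sym: "h \<in> topspace Y \<Longrightarrow> k \<in> topspace Y \<Longrightarrow> d h k = d k h"
    and d_tri: "h \<in> topspace Y \<Longrightarrow> k \<in> topspace Y \<Longrightarrow> l \<in> topspace Y \<Longrightarrow> d h l \<le> d h k + d k l"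
    and d_diff: "h \<in> topspace Y \<Longrightarrow> k \<in> topspace Y \<Longrightarrow> p h \<noteq> p k \<Longrightarrow> d h k = 1"
    and d_usc: "h \<in> topspace Y \<Longrightarrow> k \<in> topspace Y \<Longrightarrow> p h = p k \<Longrightarrow> d h k < r \<Longrightarrow>
      \<exists>S T. openin Y S \<and> openin Y T \<and> h \<in> S \<and> k \<in> T \<and>
        (\<forall>h'\<in>S. \<forall>k'\<in>T. p h' = p k' \<longrightarrow> d h' k' < r)"
begin

text \<open>
The completion is realised inside the functions on \<open>Y\<close> in the manner of Kuratowski: a point is given by
its distances to the elements of \<open>Y\<close>.  The inequalities are those of a one-point metric extension, and the
infimum \<open>0\<close> says that the new point is adherent to \<open>Y\<close>.  Points over different base points remain at distance \<open>1\<close>,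
so all fibres are completed at once.
\<close>
definition Compl :: "('y \<Rightarrow> real) set" where
  "Compl = {f. (\<forall>h. h \<notin> topspace Y \<longrightarrow> f h = 0) \<and>
     (\<forall>h\<in>topspace Y. \<forall>k\<in>topspace Y. f h \<le> f k + d h k \<and> d h k \<le> f h + f k) \<and>
     (\<forall>e>0. \<exists>h\<in>topspace Y. f h < e)}"

definition embed :: "'y \<Rightarrow> 'y \<Rightarrow> real" where
  "embed h = (\<lambda>k. if k \<in> topspace Y then d h k else 0)"

text \<open>
The infimum agrees with the usual supremum of \<open>\<bar>f h - g h\<bar>\<close>; one inequality is \<open>cdist_eval\<close>, and the other
follows by taking \<open>f h\<close> close to \<open>0\<close>.  This form makes strict upper
bounds on the distance existential, which is what upper semicontinuity needs.
\<close>
definition cdist :: "('y \<Rightarrow> real) \<Rightarrow> ('y \<Rightarrow> real) \<Rightarrow> real" where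
  "cdist f g = (if f \<in> Compl \<and> g \<in> Compl then Inf ((\<lambda>h. f h + g h) ` topspace Y) else 0)"

definition nbhd :: "'y set \<Rightarrow> real \<Rightarrow> ('y \<Rightarrow> real) set" where
  "nbhd S r = {f \<in> Compl. \<exists>h\<in>S. f h < r}"

text \<open>
The topology has as a base the \<open>r\<close>-neighbourhoods of the images of open sets of \<open>Y\<close>.  It is coarser
than the metric topology: such a neighbourhood spreads over many fibres.  The bound \<open>r \<le> 1\<close> ensures that a
point of the neighbourhood lies in the same fibre as its witness in \<open>S\<close>.
\<close>
definition ctop :: "('y \<Rightarrow> real) topology" where
  "ctop = topology (\<lambda>Op. Op \<subseteq> Compl \<and>
     (\<forall>f\<in>Op. \<exists>S r. openin Y S \<and> 0 < r \<and> r \<le> 1 \<and> f \<in> nbhd S r \<and> nbhd S r \<subseteq> Op))"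

definition cproj :: "('y \<Rightarrow> real) \<Rightarrow> 'x" where
  "cproj f = p (SOME h. h \<in> topspace Y \<and> f h < 1)"

lemma Compl_lip: "f \<in> Compl \<Longrightarrow> h \<in> topspace Y \<Longrightarrow> k \<in> topspace Y \<Longrightarrow> f h \<le> f k + d h k"
  by (simp add: Compl_def)

lemma Compl_ge: "f \<in> Compl \<Longrightarrow> h \<in> topspace Y \<Longrightarrow> k \<in> topspace Y \<Longrightarrow> d h k \<le> f h + f k"
  by (simp add: Compl_def)

lemma Compl_small: "f \<in> Compl \<Longrightarrow> e > 0 \<Longrightarrow> \<exists>h\<in>topspace Y. f h < e"
  by (simp add: Compl_def)

lemma Compl_out: "f \<in> Compl \<Longrightarrow> h \<notin> topspace Y \<Longrightarrow> f h = 0"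
  by (simp add: Compl_def)

lemma Compl_nonneg: "f \<in> Compl \<Longrightarrow> 0 \<le> f h"
  using Compl_ge[of f h h] d_refl Compl_out by (cases "h \<in> topspace Y") fastforce+

lemma Compl_le1: assumes "f \<in> Compl" shows "f h \<le> 1"
proof (cases "h \<in> topspace Y")
  case True
  show ?thesis
  proof (rule field_le_epsilon)
    fix e :: real assume "e > 0"
    then obtain k where "k \<in> topspace Y" "f k < e"
      using Compl_small assms by blast
    then show "f h \<le> 1 + e"
      using Compl_lip[OF assms True] d_le1[OF True] by fastforce
  qed
next
  case False then show ?thesis using Compl_out[OF assms] by simp
qed

lemma Compl_cong: "f \<in> Compl \<Longrightarrow> g \<in> Compl \<Longrightarrow> (\<And>h. h \<in> topspace Y \<Longrightarrow> f h = g h) \<Longrightarrow> f = g"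
  by (rule ext) (metis Compl_out)

lemma embed_in: "h \<in> topspace Y \<Longrightarrow> embed h \<in> Compl"
  unfolding Compl_def embed_def using d_tri d_sym d_refl
  by (auto intro!: bexI[of _ h]) (metis add.commute)+

lemma cdist_lt_iff:
  assumes "f \<in> Compl" "g \<in> Compl"
  shows "cdist f g < r \<longleftrightarrow> (\<exists>h\<in>topspace Y. f h + g h < r)"
proof -
  obtain h0 where "h0 \<in> topspace Y"
    using Compl_small[OF assms(1), of 1] by auto
  moreover have "bdd_below ((\<lambda>h. f h + g h) ` topspace Y)"
    by (rule bdd_belowI2[of _ 0]) (use Compl_nonneg assms in force)
  ultimately show ?thesis
    using assms by (subst cdist_def) (simp, subst cInf_less_iff, auto)
qed

lemma cdist_le: "f \<in> Compl \<Longrightarrow> g \<in> Compl \<Longrightarrow> h \<in> topspace Y \<Longrightarrow> cdist f g \<le> f h + g h"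
  using cdist_lt_iff[of f g "cdist f g"] by fastforce

lemma cdist_sym: "cdist f g = cdist g f"
  unfolding cdist_def by (simp add: add.commute conj_commute)

lemma cdist_nonneg: "0 \<le> cdist f g"
proof (cases "f \<in> Compl \<and> g \<in> Compl")
  case True
  then have "\<not> cdist f g < 0"
    using cdist_lt_iff[of f g 0] Compl_nonneg[of f] Compl_nonneg[of g] by (metis add_nonneg_nonneg not_less)
  then show ?thesis by simp
next
  case False
  then have "cdist f g = 0" unfolding cdist_def by (rule if_not_P)
  then show ?thesis by simp
qed

lemma cdist_le1: assumes "f \<in> Compl" "g \<in> Compl" shows "cdist f g \<le> 1"
proof (rule field_le_epsilon)
  fix e :: real assume "e > 0"
  then obtain h where "h \<in> topspace Y" "f h < e"
    using Compl_small assms by blast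
  then show "cdist f g \<le> 1 + e"
    using cdist_le[OF assms] Compl_le1[OF assms(2), of h] by fastforce
qed

lemma cdist_eval:
  assumes "f \<in> Compl" "g \<in> Compl"
  shows "f h \<le> g h + cdist f g"
proof (cases "h \<in> topspace Y")
  case True
  show ?thesis
  proof (rule field_le_epsilon)
    fix e :: real assume "e > 0"
    then obtain k where "k \<in> topspace Y" "f k + g k < cdist f g + e"
      using cdist_lt_iff[OF assms, of "cdist f g + e"] by auto
    then show "f h \<le> g h + cdist f g + e"
      using Compl_lip[OF assms(1) True, of k] Compl_ge[OF assms(2) True, of k] by linarith
  qed
next
  case False then show ?thesis using Compl_out[OF assms(1)] Compl_out[OF assms(2)] cdist_nonneg[of f g] by simp
qed

lemma cdist_self: assumes "f \<in> Compl" shows "cdist f f = 0"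
proof -
  have "cdist f f < 0 + e" if e: "e > 0" for e
  proof -
    obtain h where "h \<in> topspace Y" "f h < e/2"
      using Compl_small[OF assms, of "e/2"] e by auto
    then show ?thesis
      using cdist_le[OF assms assms, of h] by simp
  qed
  then have "cdist f f \<le> 0"
    by (metis field_le_epsilon less_imp_le)
  then show ?thesis using cdist_nonneg[of f f] by simp
qed

lemma cdist_0: assumes "f \<in> Compl" "g \<in> Compl" "cdist f g = 0" shows "f = g"
  using cdist_eval[of f g] cdist_eval[of g f] assms cdist_sym[of f g] by (intro ext) (simp add: order_antisym)

lemma cdist_tri: assumes "f \<in> Compl" "g \<in> Compl" "l \<in> Compl" shows "cdist f l \<le> cdist f g + cdist g l"
proof (rule field_le_epsilon)
  fix e :: real assume e: "e > 0"
  then obtain k where "k \<in> topspace Y" "g k + l k < cdist g l + e"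
    using cdist_lt_iff[of g l "cdist g l + e"] assms by auto
  then show "cdist f l \<le> cdist f g + cdist g l + e"
    using cdist_le[of f l k] cdist_eval[of f g k] assms by linarith
qed

lemma Metric_cdist: "Metric_space Compl cdist"
  using cdist_nonneg cdist_sym cdist_self cdist_0 cdist_tri by unfold_locales auto

lemma cdist_embed: assumes "f \<in> Compl" "h \<in> topspace Y" shows "cdist (embed h) f = f h"
proof (rule antisym)
  show "cdist (embed h) f \<le> f h"
    using cdist_le[of "embed h" f h] assms embed_in d_refl by (simp add: embed_def)
  show "f h \<le> cdist (embed h) f"
    using cdist_eval[of f "embed h" h] assms embed_in d_refl by (simp add: embed_def cdist_sym)
qed

lemma cdist_embed_embed: "h \<in> topspace Y \<Longrightarrow> k \<in> topspace Y \<Longrightarrow> cdist (embed h) (embed k) = d h k"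
  using cdist_embed[of "embed k" h] embed_in d_sym by (simp add: embed_def)

lemma cproj_eq:
  assumes "f \<in> Compl" "h \<in> topspace Y" "f h < 1"
  shows "cproj f = p h"
proof -
  have *: "p h1 = p h2" if "h1 \<in> topspace Y" "h2 \<in> topspace Y" "f h1 < e" "f h2 < 1 - e" for h1 h2 e
    using d_diff[of h1 h2] Compl_ge[OF assms(1), of h1 h2] that by argo
  have **: "p h1 = p h2" if h: "h1 \<in> topspace Y" "h2 \<in> topspace Y" "f h1 < 1" "f h2 < 1" for h1 h2
  proof -
    obtain k where "k \<in> topspace Y" "f k < min (1 - f h1) (1 - f h2)"
      using Compl_small[OF assms(1), of "min (1 - f h1) (1 - f h2)"] h by auto
    then show ?thesis
      using *[of k h1 "1 - f h1"] *[of k h2 "1 - f h2"] h d_diff[of k h1] d_diff[of k h2]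
        Compl_ge[OF assms(1), of k h1] Compl_ge[OF assms(1), of k h2] by force
  qed
  have "\<exists>h. h \<in> topspace Y \<and> f h < 1"
    using assms by blast
  then have "(SOME h. h \<in> topspace Y \<and> f h < 1) \<in> topspace Y \<and> f (SOME h. h \<in> topspace Y \<and> f h < 1) < 1"
    by (rule someI_ex)
  then show ?thesis
    unfolding cproj_def using ** assms by blast
qed

lemma cproj_neq: "f \<in> Compl \<Longrightarrow> h \<in> topspace Y \<Longrightarrow> cproj f \<noteq> p h \<Longrightarrow> f h = 1"
  using cproj_eq Compl_le1[of f h] by fastforce

lemma cproj_embed: "h \<in> topspace Y \<Longrightarrow> cproj (embed h) = p h"
  using cproj_eq[of "embed h" h] embed_in d_refl by (simp add: embed_def)

lemma Compl_small_fiber: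
  assumes "f \<in> Compl" "e > 0"
  shows "\<exists>h\<in>topspace Y. f h < e \<and> p h = cproj f"
  using Compl_small[OF assms(1), of "min e 1"] cproj_eq[OF assms(1)] assms(2) by auto

lemma cproj_in: assumes "f \<in> Compl" shows "cproj f \<in> topspace X"
  using Compl_small_fiber[OF assms, of 1] p_cont continuous_map_image_subset_topspace[of Y X p]
  by (fastforce simp: image_subset_iff)

lemma cdist_diff: assumes "f \<in> Compl" "g \<in> Compl" "cproj f \<noteq> cproj g" shows "cdist f g = 1"
proof (rule ccontr)
  assume "cdist f g \<noteq> 1"
  then have "cdist f g < 1" using cdist_le1[OF assms(1,2)] by simp
  then obtain h where "h \<in> topspace Y" "f h + g h < 1"
    using cdist_lt_iff assms by blast
  then show False
    using cproj_eq[of f h] cproj_eq[of g h] Compl_nonneg[of f h] Compl_nonneg[of g h] assms by fastforce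
qed

text \<open>
By \<open>cdist_eval\<close> a Cauchy sequence converges uniformly as a sequence of functions on \<open>Y\<close>, and the conditions that define
\<open>Compl\<close> are preserved by uniform limits.
\<close>
lemma mcomplete_cdist: "Metric_space.mcomplete Compl cdist"
proof (rule mcomplete_if_Cauchy_converges[OF Metric_cdist])
  fix s :: "nat \<Rightarrow> 'y \<Rightarrow> real" assume s: "range s \<subseteq> Compl"
    and c: "\<And>e. e > 0 \<Longrightarrow> \<exists>N. \<forall>m\<ge>N. \<forall>n\<ge>N. cdist (s m) (s n) < e"
  have sC: "s n \<in> Compl" for n using s by blast
  have "Cauchy (\<lambda>n. s n h)" for h
    unfolding Cauchy_altdef2
  proof (intro allI impI)
    fix e :: real assume "e > 0"
    then obtain N where N: "\<And>m n. m \<ge> N \<Longrightarrow> n \<ge> N \<Longrightarrow> cdist (s m) (s n) < e"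
      using c by blast
    have "dist (s n h) (s N h) < e" if "n \<ge> N" for n
      using N[of n N] N[of N n] that cdist_eval[OF sC sC, of n h N] cdist_eval[OF sC sC, of N h n]
      by (simp add: dist_real_def abs_less_iff)
    then show "\<exists>N. \<forall>n\<ge>N. dist (s n h) (s N h) < e" by blast
  qed
  then have "\<exists>l. (\<lambda>n. s n h) \<longlonglongrightarrow> l" for h
    using Cauchy_convergent convergent_def by blast
  then obtain l where l: "\<And>h. (\<lambda>n. s n h) \<longlonglongrightarrow> l h" by metis
  have unif: "\<exists>N. \<forall>n\<ge>N. \<forall>h. \<bar>s n h - l h\<bar> \<le> e" if e: "e > 0" for e
  proof -
    obtain N where N: "\<And>m n. m \<ge> N \<Longrightarrow> n \<ge> N \<Longrightarrow> cdist (s m) (s n) < e"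
      using c[OF e] by blast
    have "\<bar>s n h - l h\<bar> \<le> e" if "n \<ge> N" for n h
    proof (rule LIMSEQ_le_const2)
      show "(\<lambda>m. \<bar>s n h - s m h\<bar>) \<longlonglongrightarrow> \<bar>s n h - l h\<bar>"
        using l by (intro tendsto_intros)
      have "\<bar>s n h - s m h\<bar> \<le> e" if "m \<ge> N" for m
        using N[OF \<open>n \<ge> N\<close> that] cdist_eval[OF sC sC, of n h m] cdist_eval[OF sC sC, of m h n]
          cdist_sym[of "s n" "s m"] by (simp add: abs_le_iff)
      then show "\<exists>N. \<forall>m\<ge>N. \<bar>s n h - s m h\<bar> \<le> e" by blast
    qed
    then show ?thesis by blast
  qed
  have lC: "l \<in> Compl"
    unfolding Compl_def mem_Collect_eq
  proof (intro conjI allI impI ballI)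
    show "l h = 0" if "h \<notin> topspace Y" for h
      using l[of h] by (simp add: Compl_out[OF sC that] tendsto_const_iff)
    show "l h \<le> l k + d h k" if "h \<in> topspace Y" "k \<in> topspace Y" for h k
      using LIMSEQ_le[OF l[of h] tendsto_add[OF l[of k] tendsto_const]] Compl_lip[OF sC that] by blast
    show "d h k \<le> l h + l k" if "h \<in> topspace Y" "k \<in> topspace Y" for h k
      using LIMSEQ_le[OF tendsto_const tendsto_add[OF l[of h] l[of k]]] Compl_ge[OF sC that] by blast
    fix e :: real assume "e > 0"
    then obtain n where n: "\<And>h. \<bar>s n h - l h\<bar> \<le> e/2"
      using unif[of "e/2"] by auto
    obtain h where "h \<in> topspace Y" "s n h < e/2"
      using Compl_small[OF sC, of "e/2"] \<open>e > 0\<close> by auto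
    then show "\<exists>h\<in>topspace Y. l h < e"
      using n[of h] by (intro bexI[of _ h]) linarith+
  qed
  moreover have "\<exists>N. \<forall>n\<ge>N. cdist (s n) l < e" if e: "e > 0" for e
  proof -
    obtain N where N: "\<And>n h. n \<ge> N \<Longrightarrow> \<bar>s n h - l h\<bar> \<le> e/3"
      using unif[of "e/3"] e by auto
    obtain h where h: "h \<in> topspace Y" "l h < e/3"
      using Compl_small[OF lC, of "e/3"] e by auto
    have "cdist (s n) l < e" if "n \<ge> N" for n
      using N[OF that, of h] h cdist_le[OF sC lC h(1), of n] by linarith
    then show ?thesis by blast
  qed
  ultimately show "\<exists>l\<in>Compl. \<forall>e>0. \<exists>N. \<forall>n\<ge>N. cdist (s n) l < e" by blast
qed

text \<open>
This is where openness of \<open>p\<close> enters: the thickening is the projection of an open subset of the fibre square.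
\<close>
lemma openin_thickening:
  assumes "openin Y S" "r \<le> 1"
  shows "openin Y {w \<in> topspace Y. \<exists>h\<in>S. d w h < r}" (is "openin Y ?W")
proof (subst openin_subopen, intro ballI)
  fix w assume "w \<in> ?W"
  then obtain h where w: "w \<in> topspace Y" "h \<in> S" "d w h < r" by blast
  have h: "h \<in> topspace Y" using w assms openin_subset by blast
  then have "p w = p h" using d_diff w assms by force
  then obtain A B where AB: "openin Y A" "openin Y B" "w \<in> A" "h \<in> B"
    "\<forall>h'\<in>A. \<forall>k'\<in>B. p h' = p k' \<longrightarrow> d h' k' < r"
    using d_usc w h by metis
  let ?A = "A \<inter> {a \<in> topspace Y. p a \<in> p ` (B \<inter> S)}"
  have "openin X (p ` (B \<inter> S))"
    using p_open AB assms by (auto simp: open_map_def)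
  then have "openin Y ?A"
    using p_cont AB openin_continuous_map_preimage by blast
  moreover have "w \<in> ?A" using AB w \<open>p w = p h\<close> by blast
  moreover have "?A \<subseteq> ?W" using AB by auto
  ultimately show "\<exists>T. openin Y T \<and> w \<in> T \<and> T \<subseteq> ?W" by blast
qed

text \<open>
A common refinement is centred at an element \<open>w\<close> of \<open>Y\<close> that is much closer to \<open>f\<close> than the given witnesses.
\<close>
lemma nbhd_Int:
  assumes "openin Y S" "openin Y T" "r \<le> 1" "t \<le> 1" "f \<in> nbhd S r" "f \<in> nbhd T t"
  shows "\<exists>W e. openin Y W \<and> 0 < e \<and> e \<le> 1 \<and> f \<in> nbhd W e \<and> nbhd W e \<subseteq> nbhd S r \<inter> nbhd T t"
proof -
  obtain h k where h: "f \<in> Compl" "h \<in> S" "f h < r" "k \<in> T" "f k < t"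
    using assms by (auto simp: nbhd_def)
  define e where "e = min (r - f h) (t - f k) / 2"
  define W where "W = {w \<in> topspace Y. \<exists>h\<in>S. d w h < r - e} \<inter> {w \<in> topspace Y. \<exists>h\<in>T. d w h < t - e}"
  have e: "0 < e" "2 * e \<le> r - f h" "2 * e \<le> t - f k" using h by (auto simp: e_def)
  then have e1: "e \<le> 1" using assms Compl_nonneg[OF h(1), of h] by linarith
  have W: "openin Y W"
    unfolding W_def by (intro openin_Int openin_thickening) (use assms e in auto)
  have ST: "S \<subseteq> topspace Y" "T \<subseteq> topspace Y" using assms openin_subset by auto
  obtain w where w: "w \<in> topspace Y" "f w < e" using Compl_small h(1) e by blast
  have "w \<in> W"
    using w h e ST Compl_ge[OF h(1), of w h] Compl_ge[OF h(1), of w k]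
    unfolding W_def by (intro IntI CollectI conjI bexI[of _ h] bexI[of _ k]) auto
  then have "f \<in> nbhd W e" using w h by (auto simp: nbhd_def)
  moreover have "nbhd W e \<subseteq> nbhd S r \<inter> nbhd T t"
  proof
    fix g assume "g \<in> nbhd W e"
    then obtain w where g: "g \<in> Compl" "w \<in> W" "g w < e" by (auto simp: nbhd_def)
    then obtain a b where ab: "w \<in> topspace Y" "a \<in> S" "b \<in> T" "d w a < r - e" "d w b < t - e"
      by (auto simp: W_def)
    have "d a w = d w a" "d b w = d w b" using d_sym ab ST by blast+
    then have "g a < r" "g b < t"
      using ab g ST Compl_lip[OF g(1), of a w] Compl_lip[OF g(1), of b w] by fastforce+
    then show "g \<in> nbhd S r \<inter> nbhd T t" using ab g by (auto simp: nbhd_def)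
  qed
  ultimately show ?thesis using W e e1 by blast
qed

lemma openin_ctop: "openin ctop Op \<longleftrightarrow> Op \<subseteq> Compl \<and>
     (\<forall>f\<in>Op. \<exists>S r. openin Y S \<and> 0 < r \<and> r \<le> 1 \<and> f \<in> nbhd S r \<and> nbhd S r \<subseteq> Op)"
proof -
  have "istopology (\<lambda>Op. Op \<subseteq> Compl \<and>
     (\<forall>f\<in>Op. \<exists>S r. openin Y S \<and> 0 < r \<and> r \<le> 1 \<and> f \<in> nbhd S r \<and> nbhd S r \<subseteq> Op))"
    unfolding istopology_def
  proof (intro conjI allI impI; (elim conjE)?)
    fix S T assume S: "S \<subseteq> Compl" "T \<subseteq> Compl"
      "\<forall>f\<in>S. \<exists>S' r. openin Y S' \<and> 0 < r \<and> r \<le> 1 \<and> f \<in> nbhd S' r \<and> nbhd S' r \<subseteq> S"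
      "\<forall>f\<in>T. \<exists>S' r. openin Y S' \<and> 0 < r \<and> r \<le> 1 \<and> f \<in> nbhd S' r \<and> nbhd S' r \<subseteq> T"
    show "S \<inter> T \<subseteq> Compl" using S by blast
    show "\<forall>f\<in>S \<inter> T. \<exists>S' r. openin Y S' \<and> 0 < r \<and> r \<le> 1 \<and> f \<in> nbhd S' r \<and> nbhd S' r \<subseteq> S \<inter> T"
    proof
      fix f assume "f \<in> S \<inter> T"
      then obtain A r B t where "openin Y A" "openin Y B" "r \<le> 1" "t \<le> 1" "f \<in> nbhd A r" "f \<in> nbhd B t"
        "nbhd A r \<subseteq> S" "nbhd B t \<subseteq> T" using S by (meson IntE)
      then show "\<exists>S' r. openin Y S' \<and> 0 < r \<and> r \<le> 1 \<and> f \<in> nbhd S' r \<and> nbhd S' r \<subseteq> S \<inter> T"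
        using nbhd_Int[of A B r t f] by blast
    qed
  next
    fix \<K> assume K: "\<forall>S\<in>\<K>. S \<subseteq> Compl \<and> (\<forall>f\<in>S. \<exists>S' r. openin Y S' \<and> 0 < r \<and> r \<le> 1 \<and> f \<in> nbhd S' r \<and> nbhd S' r \<subseteq> S)"
    show "\<Union>\<K> \<subseteq> Compl" using K by blast
    show "\<forall>f\<in>\<Union>\<K>. \<exists>S' r. openin Y S' \<and> 0 < r \<and> r \<le> 1 \<and> f \<in> nbhd S' r \<and> nbhd S' r \<subseteq> \<Union>\<K>"
      using K by (meson UnionE Union_upper subset_trans)
  qed
  then show ?thesis unfolding ctop_def by simp
qed

lemma openin_ctopE:
  assumes "openin ctop Op" "f \<in> Op"
  obtains S r where "openin Y S" "0 < r" "r \<le> 1" "f \<in> nbhd S r" "nbhd S r \<subseteq> Op"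
  using assms unfolding openin_ctop by blast

lemma openin_nbhd: "openin Y S \<Longrightarrow> 0 < r \<Longrightarrow> r \<le> 1 \<Longrightarrow> openin ctop (nbhd S r)"
  unfolding openin_ctop nbhd_def by blast

lemma nbhd_top: "nbhd (topspace Y) 1 = Compl"
  using Compl_small[of _ 1] by (auto simp: nbhd_def)

lemma topspace_ctop [simp]: "topspace ctop = Compl"
proof
  show "topspace ctop \<subseteq> Compl" using openin_ctop openin_topspace by blast
  show "Compl \<subseteq> topspace ctop"
    using openin_nbhd[of "topspace Y" 1] openin_subset nbhd_top by auto
qed

text \<open>
An open set \<open>Op\<close> is cut out by the largest 1-Lipschitz function \<open>V \<le> 1\<close> that is at most \<open>1 - r\<close> on the image of
\<open>S\<close> whenever the \<open>r\<close>-neighbourhood of \<open>S\<close> is contained in \<open>Op\<close>.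
\<close>
lemma topometric_ctop: "topometric_space ctop cdist"
  unfolding topometric_space_def
proof (intro conjI allI)
  show "Metric_space (topspace ctop) cdist" using Metric_cdist by simp
  show "\<forall>a\<in>topspace ctop. \<forall>b\<in>topspace ctop. cdist a b \<le> 1" using cdist_le1 by simp
  fix Op
  show "openin ctop Op \<longleftrightarrow> (\<exists>V. V \<in> topspace ctop \<rightarrow> {0..1} \<and> usc_on ctop V \<and>
             (\<forall>a\<in>topspace ctop. \<forall>b\<in>topspace ctop. \<bar>V a - V b\<bar> \<le> cdist a b) \<and>
             Op = {a \<in> topspace ctop. V a < 1})" (is "?l \<longleftrightarrow> ?r")
  proof
    assume ?r then show ?l unfolding usc_on_def by blast
  next
    assume Op: ?l
    define Q where "Q = (\<lambda>f. insert 1 {1 - r + f h |S r h. openin Y S \<and> h \<in> S \<and> 0 < r \<and> r \<le> (1::real) \<and> nbhd S r \<subseteq> Op})"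
    define V where "V = (\<lambda>f. Inf (Q f))"
    have Q0: "0 \<le> x" if "f \<in> Compl" "x \<in> Q f" for f x
      using that Compl_nonneg by (fastforce simp: Q_def)
    then have bdd: "bdd_below (Q f)" if "f \<in> Compl" for f using that by (meson bdd_belowI)
    have ne: "Q f \<noteq> {}" for f by (simp add: Q_def)
    have V1: "V f \<le> 1" if "f \<in> Compl" for f
      unfolding V_def by (rule cInf_lower[OF _ bdd[OF that]]) (simp add: Q_def)
    have V0: "0 \<le> V f" if "f \<in> Compl" for f
      unfolding V_def by (rule cInf_greatest[OF ne]) (use Q0 that in blast)
    have Vlt: "V f < t \<longleftrightarrow> (\<exists>x\<in>Q f. x < t)" if "f \<in> Compl" for f t
      unfolding V_def using cInf_less_iff[OF ne bdd[OF that]] .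
    have lip: "V f \<le> V g + cdist f g" if fg: "f \<in> Compl" "g \<in> Compl" for f g
    proof (rule field_le_epsilon)
      fix e :: real assume "e > 0"
      then obtain x where x: "x \<in> Q g" "x < V g + e"
        using Vlt[OF fg(2), of "V g + e"] by auto
      show "V f \<le> V g + cdist f g + e"
      proof (cases "x = 1")
        case True then show ?thesis using V1[OF fg(1)] x cdist_nonneg[of f g] by linarith
      next
        case False
        then obtain S r h where *: "x = 1 - r + g h" "openin Y S" "h \<in> S" "0 < r" "r \<le> 1" "nbhd S r \<subseteq> Op"
          using x by (auto simp: Q_def)
        then have "1 - r + f h \<in> Q f" unfolding Q_def by blast
        then have "V f \<le> 1 - r + f h" unfolding V_def by (rule cInf_lower[OF _ bdd[OF fg(1)]])
        then show ?thesis using cdist_eval[OF fg, of h] * x by linarith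
      qed
    qed
    have small: "\<exists>S s. openin Y S \<and> 0 < s \<and> s \<le> 1 \<and> f \<in> nbhd S s \<and> nbhd S s \<subseteq> {f \<in> Compl. V f < t}"
      and inO: "f \<in> Op" if f: "f \<in> Compl" "V f < t" "t \<le> 1" for f t
    proof -
      obtain x where x: "x \<in> Q f" "x < t" using f Vlt by blast
      then have "x \<noteq> 1" using f by simp
      then obtain S r h where *: "x = 1 - r + f h" "openin Y S" "h \<in> S" "0 < r" "r \<le> 1" "nbhd S r \<subseteq> Op"
          using x by (auto simp: Q_def)
      let ?s = "r - 1 + t"
      have "f h < ?s" using * x by linarith
      then have s: "0 < ?s" "?s \<le> 1" "f \<in> nbhd S ?s" "f \<in> nbhd S r"
        using Compl_nonneg[OF f(1), of h] * f by (auto simp: nbhd_def intro!: bexI[of _ h])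
      then show "f \<in> Op" using * by blast
      have "nbhd S ?s \<subseteq> {f \<in> Compl. V f < t}"
      proof
        fix g assume "g \<in> nbhd S ?s"
        then obtain k where k: "g \<in> Compl" "k \<in> S" "g k < ?s" by (auto simp: nbhd_def)
        then have "1 - r + g k \<in> Q g" unfolding Q_def using * by blast
        then have "V g < t" using Vlt[OF k(1), of t] k by force
        then show "g \<in> {f \<in> Compl. V f < t}" using k by simp
      qed
      then show "\<exists>S s. openin Y S \<and> 0 < s \<and> s \<le> 1 \<and> f \<in> nbhd S s \<and> nbhd S s \<subseteq> {f \<in> Compl. V f < t}"
        using s * by blast
    qed
    show ?r
    proof (intro exI[of _ V] conjI)
      show "V \<in> topspace ctop \<rightarrow> {0..1}" using V0 V1 by simp
      show "usc_on ctop V"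
        unfolding usc_on_def
      proof
        fix t
        show "openin ctop {a \<in> topspace ctop. V a < t}"
        proof (cases "t \<le> 1")
          case True
          then show ?thesis unfolding openin_ctop topspace_ctop using small by blast
        next
          case False
          then have "{a \<in> topspace ctop. V a < t} = topspace ctop" using V1 by fastforce
          then show ?thesis by (metis openin_topspace)
        qed
      qed
      show "\<forall>a\<in>topspace ctop. \<forall>b\<in>topspace ctop. \<bar>V a - V b\<bar> \<le> cdist a b"
      proof (intro ballI)
        fix a b assume "a \<in> topspace ctop" "b \<in> topspace ctop"
        then show "\<bar>V a - V b\<bar> \<le> cdist a b"
          using lip[of a b] lip[of b a] cdist_sym[of a b] by (simp add: abs_le_iff)
      qed
      show "Op = {a \<in> topspace ctop. V a < 1}"
      proof (intro equalityI subsetI)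
        fix f assume f: "f \<in> Op"
        then obtain S r where "openin Y S" "0 < r" "r \<le> 1" "f \<in> nbhd S r" "nbhd S r \<subseteq> Op"
          using openin_ctopE[OF Op f] by metis
        then obtain h where h: "f \<in> Compl" "h \<in> S" "f h < r"
          by (auto simp: nbhd_def)
        then have "1 - r + f h \<in> Q f"
          unfolding Q_def using \<open>openin Y S\<close> \<open>0 < r\<close> \<open>r \<le> 1\<close> \<open>nbhd S r \<subseteq> Op\<close> by blast
        with h show "f \<in> {a \<in> topspace ctop. V a < 1}" using Vlt[of f 1]
          by force
      qed (use inO in auto)
    qed
  qed
qed

lemma cproj_nbhd:
  assumes "openin Y S" "0 < r" "r \<le> 1"
  shows "cproj ` nbhd S r = p ` S"
proof (intro equalityI subsetI)
  fix x assume "x \<in> cproj ` nbhd S r"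
  then obtain f h where "f \<in> Compl" "x = cproj f" "h \<in> S" "f h < r" by (auto simp: nbhd_def)
  then show "x \<in> p ` S" using cproj_eq[of f h] assms openin_subset by fastforce
next
  fix x assume "x \<in> p ` S"
  then obtain h where h: "h \<in> S" "x = p h" by blast
  then have "h \<in> topspace Y" using assms openin_subset by blast
  then have "embed h \<in> nbhd S r" "cproj (embed h) = x"
    using embed_in cproj_embed h d_refl assms by (auto simp: nbhd_def embed_def intro!: bexI[of _ h])
  then show "x \<in> cproj ` nbhd S r" by blast
qed

lemma metric_etale_ctop: "metric_etale_space X ctop cdist cproj"
  unfolding metric_etale_space_def
proof (intro conjI ballI impI)
  show "complete_topometric_space ctop cdist"
    unfolding complete_topometric_space_def using topometric_ctop mcomplete_cdist by simp
  show "continuous_map ctop X cproj"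
    unfolding continuous_map_def
  proof (intro conjI allI impI)
    show "cproj \<in> topspace ctop \<rightarrow> topspace X" using cproj_in by simp
    fix U assume U: "openin X U"
    have "{f \<in> topspace ctop. cproj f \<in> U} = nbhd {h \<in> topspace Y. p h \<in> U} 1"
    proof (intro equalityI subsetI)
      fix f assume f: "f \<in> {f \<in> topspace ctop. cproj f \<in> U}"
      then obtain h where "h \<in> topspace Y" "f h < 1 \<and> p h = cproj f"
        using Compl_small_fiber[of f 1] by auto
      with f show "f \<in> nbhd {h \<in> topspace Y. p h \<in> U} 1"
        by (auto simp: nbhd_def)
    next
      fix f assume "f \<in> nbhd {h \<in> topspace Y. p h \<in> U} 1"
      then obtain h where "f \<in> Compl" "h \<in> topspace Y" "p h \<in> U" "f h < 1"
        by (auto simp: nbhd_def)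
      then show "f \<in> {f \<in> topspace ctop. cproj f \<in> U}"
        using cproj_eq[of f h] by simp
    qed
    moreover have "openin Y {h \<in> topspace Y. p h \<in> U}"
      using p_cont U openin_continuous_map_preimage by blast
    ultimately show "openin ctop {f \<in> topspace ctop. cproj f \<in> U}" using openin_nbhd by simp
  qed
  show "open_map ctop X cproj"
    unfolding open_map_def
  proof (intro allI impI)
    fix U assume U: "openin ctop U"
    show "openin X (cproj ` U)"
    proof (subst openin_subopen, intro ballI)
      fix x assume "x \<in> cproj ` U"
      then obtain f where f: "f \<in> U" "x = cproj f" by blast
      then obtain S r where S: "openin Y S" "0 < r" "r \<le> 1" "f \<in> nbhd S r" "nbhd S r \<subseteq> U"
        using openin_ctopE[OF U f(1)] by metis
      then have "x \<in> p ` S" "p ` S \<subseteq> cproj ` U" using cproj_nbhd[of S r] f by blast+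
      moreover have "openin X (p ` S)" using p_open S by (simp add: open_map_def)
      ultimately show "\<exists>T. openin X T \<and> x \<in> T \<and> T \<subseteq> cproj ` U" by blast
    qed
  qed
  show "cdist a b = 1" if "a \<in> topspace ctop" "b \<in> topspace ctop" "cproj a \<noteq> cproj b" for a b
    using cdist_diff that by simp
  show "usc_on (subtopology (prod_topology ctop ctop) {(a, b). cproj a = cproj b}) (\<lambda>(a, b). cdist a b)"
    unfolding usc_on_def
  proof
    fix r
    define W where "W = {(f, g). f \<in> Compl \<and> g \<in> Compl \<and> cproj f = cproj g \<and> cdist f g < r}"
    have "openin (subtopology (prod_topology ctop ctop) {(a, b). cproj a = cproj b}) W"
    proof (subst openin_subopen, intro ballI)
      fix z assume "z \<in> W"
      then obtain f g where z: "z = (f, g)" "f \<in> Compl" "g \<in> Compl" "cproj f = cproj g" "cdist f g < r"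
        by (auto simp: W_def)
      show "\<exists>T. openin (subtopology (prod_topology ctop ctop) {(a, b). cproj a = cproj b}) T \<and> z \<in> T \<and> T \<subseteq> W"
      proof (cases "cdist f g = 1")
        case True
        then have "W = {(f, g). f \<in> Compl \<and> g \<in> Compl \<and> cproj f = cproj g}"
          using z cdist_le1 by (fastforce simp: W_def)
        also have "\<dots> = topspace (subtopology (prod_topology ctop ctop) {(a, b). cproj a = cproj b})" by auto
        finally have "openin (subtopology (prod_topology ctop ctop) {(a, b). cproj a = cproj b}) W"
          by (metis openin_topspace)
        then show ?thesis using \<open>z \<in> W\<close> by blast
      next
        case False
        then have "cdist f g < min r 1" using z cdist_le1[of f g] by auto
        then obtain h where h: "h \<in> topspace Y" "f h + g h < min r 1"
          using cdist_lt_iff z by metis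
        define e where "e = (min r 1 - (f h + g h)) / 3"
        have "3 * e = min r 1 - (f h + g h)" "min r 1 \<le> r" "min r 1 \<le> 1"
          by (auto simp: e_def)
        then have e: "e > 0" "f h + g h + 3 * e \<le> r" "f h + e \<le> 1" "g h + e \<le> 1"
          using h Compl_nonneg[OF z(2), of h] Compl_nonneg[OF z(3), of h] by linarith+
        obtain S T where S: "openin Y S" "openin Y T" "h \<in> S" "h \<in> T"
          "\<forall>h'\<in>S. \<forall>k'\<in>T. p h' = p k' \<longrightarrow> d h' k' < e"
          using d_usc[of h h e] h d_refl e by auto
        (* Two points that are close to embedded elements of S and T over the same base point differ by at most
           the three contributions, the middle one being smaller than e. *)
        let ?T = "(nbhd S (f h + e) \<times> nbhd T (g h + e)) \<inter> {(a, b). cproj a = cproj b}"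
        have "openin (prod_topology ctop ctop) (nbhd S (f h + e) \<times> nbhd T (g h + e))"
          by (intro openin_prod_Times_iff[THEN iffD2] disjI2 conjI openin_nbhd)
            (use S e Compl_nonneg[OF z(2), of h] Compl_nonneg[OF z(3), of h] in auto)
        then have "openin (subtopology (prod_topology ctop ctop) {(a, b). cproj a = cproj b}) ?T"
          by (rule openin_subtopology_Int)
        moreover have "z \<in> ?T" using z S e by (auto simp: nbhd_def intro!: bexI[of _ h])
        moreover have "?T \<subseteq> W"
        proof
          fix y assume "y \<in> ?T"
          then obtain f' g' h' k' where y: "y = (f', g')" "f' \<in> Compl" "g' \<in> Compl" "cproj f' = cproj g'"
            "h' \<in> S" "k' \<in> T" "f' h' < f h + e" "g' k' < g h + e" by (auto simp: nbhd_def)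
          have Y: "h' \<in> topspace Y" "k' \<in> topspace Y" using y S openin_subset by blast+
          have "p h' = cproj f'" "p k' = cproj g'"
            using cproj_eq[of f' h'] cproj_eq[of g' k'] y Y e by auto
          then have "d h' k' < e" using S y by auto
          then have "cdist f' g' < r"
            using cdist_le[OF y(2,3) Y(1)] Compl_lip[OF y(3) Y] y e by linarith
          then show "y \<in> W" using y by (auto simp: W_def)
        qed
        ultimately show ?thesis by blast
      qed
    qed
    moreover have "{a \<in> topspace (subtopology (prod_topology ctop ctop) {(a, b). cproj a = cproj b}). (case a of (a, b) \<Rightarrow> cdist a b) < r} = W"
      by (auto simp: W_def)
    ultimately show "openin (subtopology (prod_topology ctop ctop) {(a, b). cproj a = cproj b})
          {a \<in> topspace (subtopology (prod_topology ctop ctop) {(a, b). cproj a = cproj b}). (case a of (a, b) \<Rightarrow> cdist a b) < r}"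
      by simp
  qed
qed

lemma second_countable_ctop:
  assumes "second_countable Y"
  shows "second_countable ctop"
proof -
  obtain B where B: "countable B" "\<And>V. V \<in> B \<Longrightarrow> openin Y V"
    "\<And>U x. openin Y U \<Longrightarrow> x \<in> U \<Longrightarrow> \<exists>V\<in>B. x \<in> V \<and> V \<subseteq> U"
    using assms unfolding second_countable_def by metis
  define C where "C = (\<lambda>(S, r). nbhd S r) ` (B \<times> {r \<in> \<rat>. 0 < r \<and> r \<le> 1})"
  show ?thesis
    unfolding second_countable_def
  proof (intro exI[of _ C] conjI allI impI ballI)
    show "countable C"
      unfolding C_def using B(1) countable_rat
      by (intro countable_image countable_SIGMA) (auto intro: countable_subset[OF _ countable_rat])
    show "openin ctop V" if V: "V \<in> C" for V
      proof -
      obtain S r where "V = nbhd S r" "S \<in> B" "0 < r" "r \<le> 1"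
        using V by (auto simp: C_def)
      then show ?thesis using B(2) openin_nbhd by simp
    qed
    fix U f assume Uf: "openin ctop U \<and> f \<in> U"
    then obtain S r where S: "openin Y S" "0 < r" "r \<le> 1" "f \<in> nbhd S r" "nbhd S r \<subseteq> U"
      using openin_ctopE[OF conjunct1[OF Uf] conjunct2[OF Uf]] by metis
    then obtain h where h: "f \<in> Compl" "h \<in> S" "f h < r" by (auto simp: nbhd_def)
    obtain V where V: "V \<in> B" "h \<in> V" "V \<subseteq> S" using B S h by blast
    obtain q where q: "q \<in> \<rat>" "f h < q" "q < r" using Rats_dense_in_real h by blast
    have "0 < q" using q Compl_nonneg[OF h(1), of h] by linarith
    then have "nbhd V q \<in> C" using V q S unfolding C_def by (intro image_eqI[of _ _ "(V, q)"]) auto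
    moreover have "f \<in> nbhd V q" using V h q by (auto simp: nbhd_def)
    moreover have "nbhd V q \<subseteq> nbhd S r"
    proof
      fix g assume "g \<in> nbhd V q"
      then obtain k where "g \<in> Compl" "k \<in> V" "g k < q" by (auto simp: nbhd_def)
      then show "g \<in> nbhd S r" using V q by (auto simp: nbhd_def intro!: bexI[of _ k])
    qed
    ultimately show "\<exists>V\<in>C. f \<in> V \<and> V \<subseteq> U" using S by blast
  qed
qed

text \<open>
The given topology is coarser than the metric one.  As the embedded elements are metrically dense, each nonempty open
set contains some of them.
\<close>
lemma embed_near:
  assumes "openin ctop Q" "f \<in> Q"
  shows "\<exists>e>0. \<forall>w\<in>topspace Y. f w < e \<longrightarrow> embed w \<in> Q"
proof -
  obtain S r where S: "openin Y S" "0 < r" "r \<le> 1" "f \<in> nbhd S r" "nbhd S r \<subseteq> Q"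
    using openin_ctopE[OF assms] by metis
  then obtain h where h: "f \<in> Compl" "h \<in> S" "f h < r" by (auto simp: nbhd_def)
  have hY: "h \<in> topspace Y" using S h openin_subset by blast
  have "embed w \<in> Q" if w: "w \<in> topspace Y" "f w < r - f h" for w
  proof -
    have "d w h < r" using Compl_ge[OF h(1) w(1) hY] w by simp
    then have "embed w \<in> nbhd S r" using embed_in[OF w(1)] h hY by (auto simp: nbhd_def embed_def)
    then show ?thesis using S by blast
  qed
  then show ?thesis using h by (intro exI[of _ "r - f h"]) simp
qed

lemma embed_open:
  assumes "openin ctop Q"
  shows "openin Y {w \<in> topspace Y. embed w \<in> Q}"
proof (subst openin_subopen, intro ballI)
  fix w assume w: "w \<in> {w \<in> topspace Y. embed w \<in> Q}"
  then have "embed w \<in> Q" by simp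
  then obtain S r where S: "openin Y S" "0 < r" "r \<le> 1" "embed w \<in> nbhd S r" "nbhd S r \<subseteq> Q"
    using openin_ctopE[OF assms] by metis
  have SY: "S \<subseteq> topspace Y" using S openin_subset by blast
  have *: "embed v \<in> nbhd S r \<longleftrightarrow> (\<exists>h\<in>S. d v h < r)" if "v \<in> topspace Y" for v
    using SY embed_in[OF that] by (auto simp: nbhd_def embed_def subset_iff)
  have "openin Y {v \<in> topspace Y. \<exists>h\<in>S. d v h < r}" using openin_thickening[OF S(1,3)] .
  moreover have "w \<in> {v \<in> topspace Y. \<exists>h\<in>S. d v h < r}" using * S w by blast
  moreover have "{v \<in> topspace Y. \<exists>h\<in>S. d v h < r} \<subseteq> {w \<in> topspace Y. embed w \<in> Q}" using * S by blast
  ultimately show "\<exists>T. openin Y T \<and> w \<in> T \<and> T \<subseteq> {w \<in> topspace Y. embed w \<in> Q}" by blast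
qed

lemma eq_embedI: assumes "f \<in> Compl" "h \<in> topspace Y" "f h = 0" shows "f = embed h"
  using cdist_0[of "embed h" f] cdist_embed[OF assms(1,2)] embed_in[OF assms(2)] assms by simp

lemma cdist_less_1_cproj: "f \<in> Compl \<Longrightarrow> g \<in> Compl \<Longrightarrow> cdist f g < 1 \<Longrightarrow> cproj f = cproj g"
  using cdist_diff[of f g] by fastforce

end

section \<open>Topological groupoids\<close>

context groupoid
begin

abbreviation open_obj where "open_obj \<equiv> openin (obj_space G)"
abbreviation open_mor where "open_mor \<equiv> openin (mor_space G)"
abbreviation src where "src \<equiv> source G"
abbreviation tgt where "tgt \<equiv> target G"
abbreviation un where "un \<equiv> unit_mor G"
abbreviation iv where "iv \<equiv> inv_mor G"
abbreviation mul (infixl "\<cdot>" 70) where "g \<cdot> h \<equiv> mult G g h"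

lemma compI: "g \<in> Mor G \<Longrightarrow> h \<in> Mor G \<Longrightarrow> src g = tgt h \<Longrightarrow> (g, h) \<in> composable G"
  by (simp add: composable_def)

lemma mul_in: "g \<in> Mor G \<Longrightarrow> h \<in> Mor G \<Longrightarrow> src g = tgt h \<Longrightarrow> g \<cdot> h \<in> Mor G"
  using mult_in compI by blast

lemma src_mul: "g \<in> Mor G \<Longrightarrow> h \<in> Mor G \<Longrightarrow> src g = tgt h \<Longrightarrow> src (g \<cdot> h) = src h"
  using source_mult compI by blast

lemma tgt_mul: "g \<in> Mor G \<Longrightarrow> h \<in> Mor G \<Longrightarrow> src g = tgt h \<Longrightarrow> tgt (g \<cdot> h) = tgt g"
  using target_mult compI by blast

lemma assoc: "g \<in> Mor G \<Longrightarrow> h \<in> Mor G \<Longrightarrow> k \<in> Mor G \<Longrightarrow> src g = tgt h \<Longrightarrow> src h = tgt k \<Longrightarrow>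
    g \<cdot> h \<cdot> k = g \<cdot> (h \<cdot> k)"
  using mult_assoc compI by blast

lemmas grp_simps = mul_in src_mul tgt_mul inv_in source_inv target_inv unit_in source_unit target_unit
  source_in target_in mult_unit_source mult_unit_target mult_inv_left mult_inv_right

lemma cancel_inv: "g \<in> Mor G \<Longrightarrow> h \<in> Mor G \<Longrightarrow> src g = tgt h \<Longrightarrow> iv g \<cdot> (g \<cdot> h) = h"
  using assoc[of "iv g" g h] by (simp add: grp_simps)

lemma cancel_inv': "g \<in> Mor G \<Longrightarrow> h \<in> Mor G \<Longrightarrow> tgt g = tgt h \<Longrightarrow> g \<cdot> (iv g \<cdot> h) = h"
  using assoc[of g "iv g" h] by (simp add: grp_simps)

lemma cancel_inv_right: "g \<in> Mor G \<Longrightarrow> h \<in> Mor G \<Longrightarrow> src g = tgt h \<Longrightarrow> g \<cdot> h \<cdot> iv h = g"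
  using assoc[of g h "iv h"] mult_unit_source[of g] by (simp add: grp_simps)

lemma cancel_inv_right': "g \<in> Mor G \<Longrightarrow> h \<in> Mor G \<Longrightarrow> src g = src h \<Longrightarrow> g \<cdot> iv h \<cdot> h = g"
  using assoc[of g "iv h" h] mult_unit_source[of g] by (simp add: grp_simps)

lemma inv_inv: "g \<in> Mor G \<Longrightarrow> iv (iv g) = g"
  using cancel_inv'[of "iv g" g] mult_unit_source[of "iv (iv g)"] cancel_inv[of "iv g" g]
  by (simp add: grp_simps)

lemma inv_unit: "x \<in> Obj G \<Longrightarrow> iv (un x) = un x"
  using mult_unit_target[of "iv (un x)"] mult_inv_right[of "un x"] by (simp add: grp_simps)

lemma inv_unique: assumes "g \<in> Mor G" "h \<in> Mor G" "src g = tgt h" "g \<cdot> h = un (tgt g)"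
  shows "iv g = h"
  using cancel_inv[OF assms(1-3)] assms mult_unit_source[of "iv g"] by (simp add: grp_simps)

lemma inv_mul: assumes "g \<in> Mor G" "h \<in> Mor G" "src g = tgt h"
  shows "iv (g \<cdot> h) = iv h \<cdot> iv g"
proof (rule inv_unique)
  have "g \<cdot> h \<cdot> (iv h \<cdot> iv g) = g \<cdot> h \<cdot> iv h \<cdot> iv g"
    using assms assoc[of "g \<cdot> h" "iv h" "iv g"] by (simp add: grp_simps)
  then show "g \<cdot> h \<cdot> (iv h \<cdot> iv g) = un (tgt (g \<cdot> h))"
    using cancel_inv_right[OF assms] assms by (simp add: grp_simps)
qed (use assms in \<open>auto simp: grp_simps\<close>)

lemma inv_mul_translate: "g \<in> Mor G \<Longrightarrow> h \<in> Mor G \<Longrightarrow> k \<in> Mor G \<Longrightarrow> src g = tgt h \<Longrightarrow> src g = tgt k \<Longrightarrow>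
    iv (g \<cdot> h) \<cdot> (g \<cdot> k) = iv h \<cdot> k"
  using assoc[of "iv h" "iv g" "g \<cdot> k"] cancel_inv[of g k] by (simp add: inv_mul grp_simps)

lemma inv_mul_telescope: "g \<in> Mor G \<Longrightarrow> h \<in> Mor G \<Longrightarrow> k \<in> Mor G \<Longrightarrow> tgt g = tgt h \<Longrightarrow> tgt h = tgt k \<Longrightarrow>
    (iv g \<cdot> h) \<cdot> (iv h \<cdot> k) = iv g \<cdot> k"
  using assoc[of "iv g" h "iv h \<cdot> k"] cancel_inv'[of h k] by (simp add: grp_simps)

lemma inv_diff: "g \<in> Mor G \<Longrightarrow> h \<in> Mor G \<Longrightarrow> tgt g = tgt h \<Longrightarrow> iv (iv g \<cdot> h) = iv h \<cdot> g"
  by (simp add: inv_mul grp_simps inv_inv)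

end

context topological_groupoid
begin

lemma open_src: "open_obj Y \<Longrightarrow> open_mor {g \<in> Mor G. src g \<in> Y}"
  using source_continuous openin_continuous_map_preimage by blast

lemma open_tgt: "open_obj Y \<Longrightarrow> open_mor {g \<in> Mor G. tgt g \<in> Y}"
  using target_continuous openin_continuous_map_preimage by blast

lemma open_un: "open_mor W \<Longrightarrow> open_obj {x \<in> Obj G. un x \<in> W}"
  using unit_continuous openin_continuous_map_preimage by blast

lemma open_iv: "open_mor W \<Longrightarrow> open_mor {g \<in> Mor G. iv g \<in> W}"
  using inv_continuous openin_continuous_map_preimage by blast

lemma iv_image: "W \<subseteq> Mor G \<Longrightarrow> iv ` W = {g \<in> Mor G. iv g \<in> W}"
  using inv_inv inv_in by force

lemma mult_nbhd:
  assumes "g \<in> Mor G" "h \<in> Mor G" "src g = tgt h" "open_mor W" "g \<cdot> h \<in> W"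
  obtains A B where "open_mor A" "open_mor B" "g \<in> A" "h \<in> B"
    "\<And>a b. a \<in> A \<Longrightarrow> b \<in> B \<Longrightarrow> src a = tgt b \<Longrightarrow> a \<cdot> b \<in> W"
proof -
  let ?P = "subtopology (prod_topology (mor_space G) (mor_space G)) (composable G)"
  have "openin ?P {z \<in> topspace ?P. (\<lambda>(g, h). g \<cdot> h) z \<in> W}"
    using mult_continuous assms(4) by (rule openin_continuous_map_preimage)
  then obtain T where T: "openin (prod_topology (mor_space G) (mor_space G)) T"
    "{z \<in> topspace ?P. (\<lambda>(g, h). g \<cdot> h) z \<in> W} = T \<inter> composable G"
    unfolding openin_subtopology by blast
  have "(g, h) \<in> {z \<in> topspace ?P. (\<lambda>(g, h). g \<cdot> h) z \<in> W}"
    using assms by (simp add: composable_def)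
  then have "(g, h) \<in> T" using T by blast
  then obtain A B where AB: "open_mor A" "open_mor B" "g \<in> A" "h \<in> B" "A \<times> B \<subseteq> T"
    using T(1) unfolding openin_prod_topology_alt by meson
  have "a \<cdot> b \<in> W" if "a \<in> A" "b \<in> B" "src a = tgt b" for a b
  proof -
    have "a \<in> Mor G" "b \<in> Mor G" using AB that openin_subset by blast+
    then have "(a, b) \<in> T \<inter> composable G" using that AB compI by blast
    then have "(a, b) \<in> {z \<in> topspace ?P. (\<lambda>(g, h). g \<cdot> h) z \<in> W}" using T by simp
    then show ?thesis by simp
  qed
  then show ?thesis using that AB by blast
qed

end

context open_topological_groupoid
begin

lemma target_open: "open_map (mor_space G) (obj_space G) tgt"
  unfolding open_map_def
proof (intro allI impI)
  fix W assume W: "open_mor W"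
  then have WM: "W \<subseteq> Mor G" by (rule openin_subset)
  have "tgt ` W = src ` (iv ` W)"
    using WM by (auto simp: image_image source_inv subset_iff intro!: image_cong)
  also have "\<dots> = src ` {g \<in> Mor G. iv g \<in> W}" using iv_image[OF WM] by simp
  finally show "open_obj (tgt ` W)"
    using source_open open_iv[OF W] by (simp add: open_map_def)
qed

text \<open>
If \<open>w = a \<cdot> b\<close>, then every \<open>v\<close> near \<open>w\<close> has, by openness of the source map, the same source as some \<open>c\<close> near
\<open>b\<close>, and \<open>v = (v \<cdot> c\<inverse>) \<cdot> c\<close> with \<open>v \<cdot> c\<inverse>\<close> near \<open>a\<close>.
\<close>
lemma open_prod:
  assumes "open_mor A" "open_mor B"
  shows "open_mor {g. \<exists>a\<in>A. \<exists>b\<in>B. src a = tgt b \<and> g = a \<cdot> b}" (is "openin _ ?W")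
proof (subst openin_subopen, intro ballI)
  fix w assume "w \<in> ?W"
  then obtain a b where ab: "a \<in> A" "b \<in> B" "src a = tgt b" "w = a \<cdot> b" by blast
  have M: "a \<in> Mor G" "b \<in> Mor G" using ab assms openin_subset by blast+
  have "w \<cdot> iv b \<in> A" using cancel_inv_right[OF M ab(3)] ab by simp
  then obtain P Q where PQ: "open_mor P" "open_mor Q" "w \<in> P" "iv b \<in> Q"
    "\<And>a b. a \<in> P \<Longrightarrow> b \<in> Q \<Longrightarrow> src a = tgt b \<Longrightarrow> a \<cdot> b \<in> A"
    using mult_nbhd[of w "iv b" A] M ab assms by (auto simp: grp_simps)
  define B' where "B' = B \<inter> {g \<in> Mor G. iv g \<in> Q}"
  have B': "open_mor B'" unfolding B'_def using assms PQ open_iv by blast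
  define T where "T = P \<inter> {g \<in> Mor G. src g \<in> src ` B'}"
  have "open_mor T"
    unfolding T_def using PQ B' source_open open_src by (simp add: open_map_def openin_Int)
  moreover have "w \<in> T"
  proof -
    have "b \<in> B'" using M ab PQ by (simp add: B'_def)
    moreover have "src w = src b" "w \<in> Mor G" using M ab by (simp_all add: grp_simps)
    ultimately show ?thesis using PQ by (auto simp: T_def)
  qed
  moreover have "T \<subseteq> ?W"
  proof
    fix v assume "v \<in> T"
    then obtain c where v: "v \<in> P" "v \<in> Mor G" "src v = src c" "c \<in> B'" by (auto simp: T_def)
    then have c: "c \<in> B" "c \<in> Mor G" "iv c \<in> Q" by (auto simp: B'_def)
    then have "v \<cdot> iv c \<in> A" using PQ(5)[of v "iv c"] v by (simp add: grp_simps)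
    moreover have "v = v \<cdot> iv c \<cdot> c" using cancel_inv_right'[of v c] v c by simp
    moreover have "src (v \<cdot> iv c) = tgt c" using v c by (simp add: grp_simps)
    ultimately show "v \<in> ?W" using c by blast
  qed
  ultimately show "\<exists>T. open_mor T \<and> w \<in> T \<and> T \<subseteq> ?W" by blast
qed

definition restr :: "'o set \<Rightarrow> 'g set" where
  "restr U = {g \<in> Mor G. src g \<in> U \<and> tgt g \<in> U}"

lemma open_restr: "open_obj U \<Longrightarrow> open_mor (restr U)"
proof -
  assume "open_obj U"
  then have "open_mor ({g \<in> Mor G. src g \<in> U} \<inter> {g \<in> Mor G. tgt g \<in> U})"
    by (intro openin_Int open_src open_tgt)
  moreover have "restr U = {g \<in> Mor G. src g \<in> U} \<inter> {g \<in> Mor G. tgt g \<in> U}"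
    by (auto simp: restr_def)
  ultimately show ?thesis by simp
qed

text \<open>
Over a single object \<open>x\<close>, continuity gives a neighbourhood \<open>N x\<close> of the unit with \<open>N x \<cdot> N x \<subseteq> W\<close>.  To choose one
\<open>V\<close> for all objects of \<open>U\<close>, take a locally finite closed cover \<open>E n\<close> such that the units over \<open>E n\<close> lie in
\<open>N (x n)\<close>, and let \<open>V\<close> consist of the arrows that lie in \<open>N (x n)\<close> whenever one of their ends is in \<open>E n\<close>.
Two composable elements of \<open>V\<close> share an object, hence a common \<open>N (x n)\<close>; local finiteness makes \<open>V\<close> open.
\<close>
lemma half_neighbourhood:
  assumes U: "open_obj U"
    and met: "metrizable_space (subtopology (obj_space G) U)"
    and sc: "second_countable (obj_space G)"
    and W: "open_mor W" "\<And>x. x \<in> U \<Longrightarrow> un x \<in> W"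
  obtains V where "open_mor V" "V \<subseteq> W \<inter> restr U" "\<And>x. x \<in> U \<Longrightarrow> un x \<in> V"
    "\<And>a b. a \<in> V \<Longrightarrow> b \<in> V \<Longrightarrow> src a = tgt b \<Longrightarrow> a \<cdot> b \<in> W"
proof (cases "U = {}")
  case True
  then show ?thesis using that[of "{}"] by simp
next
  case False
  let ?Z = "subtopology (obj_space G) U"
  have U_subset_Obj: "U \<subseteq> Obj G" using U openin_subset by blast
  have tZ: "topspace ?Z = U" using U_subset_Obj by auto
  have "\<exists>N. open_mor N \<and> un x \<in> N \<and> (\<forall>a\<in>N. \<forall>b\<in>N. src a = tgt b \<longrightarrow> a \<cdot> b \<in> W)"
    if "x \<in> U" for x
  proof -
    have x: "x \<in> Obj G" using that U_subset_Obj by blast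
    have "un x \<cdot> un x \<in> W" using mult_unit_source[of "un x"] x W(2)[OF that] by (simp add: grp_simps)
    then obtain A B where "open_mor A" "open_mor B" "un x \<in> A" "un x \<in> B"
      "\<And>a b. a \<in> A \<Longrightarrow> b \<in> B \<Longrightarrow> src a = tgt b \<Longrightarrow> a \<cdot> b \<in> W"
      using mult_nbhd[of "un x" "un x" W] W(1) x by (auto simp: grp_simps)
    then show ?thesis by (intro exI[of _ "A \<inter> B"]) auto
  qed
  then obtain N where N: "\<And>x. x \<in> U \<Longrightarrow> open_mor (N x)" "\<And>x. x \<in> U \<Longrightarrow> un x \<in> N x"
    "\<And>x a b. x \<in> U \<Longrightarrow> a \<in> N x \<Longrightarrow> b \<in> N x \<Longrightarrow> src a = tgt b \<Longrightarrow> a \<cdot> b \<in> W"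
    by metis
  have L: "Lindelof_space ?Z"
    using sc second_countable_subtopology second_countable_imp_Lindelof_space by blast
  have C: "\<forall>x\<in>topspace ?Z. openin ?Z {z \<in> U. un z \<in> N x} \<and> x \<in> {z \<in> U. un z \<in> N x}"
  proof
    fix x assume "x \<in> topspace ?Z"
    then have x: "x \<in> U" using tZ by simp
    have "{z \<in> U. un z \<in> N x} = {z \<in> Obj G. un z \<in> N x} \<inter> U" using U_subset_Obj by auto
    then show "openin ?Z {z \<in> U. un z \<in> N x} \<and> x \<in> {z \<in> U. un z \<in> N x}" using open_un[OF N(1)[OF x]] N(2)[OF x] x by (auto intro: openin_subtopology_Int)
  qed
  have ne: "topspace ?Z \<noteq> {}" using False tZ by simp
  obtain x :: "nat \<Rightarrow> 'o" and E where
    xE: "\<forall>n. x n \<in> topspace ?Z \<and> closedin ?Z (E n) \<and> E n \<subseteq> {z \<in> U. un z \<in> N (x n)}"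
    and E4: "\<forall>z\<in>topspace ?Z. \<exists>n. z \<in> E n"
    and E5: "\<forall>z\<in>topspace ?Z. \<exists>Y K::nat. openin ?Z Y \<and> z \<in> Y \<and> (\<forall>n\<ge>K. E n \<inter> Y = {})"
    using closed_locally_finite_refinement[OF met L ne C] by (elim exE conjE) (rule that)
  have E: "x n \<in> topspace ?Z" "closedin ?Z (E n)" "E n \<subseteq> {z \<in> U. un z \<in> N (x n)}" for n
    using xE by blast+
  have xU: "x n \<in> U" for n using E(1) tZ by simp
  have opZ: "open_obj Y" if "openin ?Z Y" for Y
    using that U openin_trans_full by blast
  have opE: "open_obj (U - E n)" for n
    using E(2)[of n] opZ tZ by (simp add: closedin_def)
  have pieces: "open_mor {g \<in> Mor G. f g \<in> U \<and> (\<forall>n. f g \<in> E n \<longrightarrow> g \<in> N (x n))}"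
    (is "openin _ ?R") if f: "continuous_map (mor_space G) (obj_space G) f" for f
  proof (subst openin_subopen, intro ballI)
    fix g assume g: "g \<in> ?R"
    then obtain Y K where Y: "openin ?Z Y" "f g \<in> Y" "\<And>n. n \<ge> K \<Longrightarrow> E n \<inter> Y = {}"
      using bspec[OF E5, of "f g"] tZ by blast
    have pre: "open_mor {g \<in> Mor G. f g \<in> S}" if "open_obj S" for S
      using f that by (rule openin_continuous_map_preimage)
    let ?T = "{g \<in> Mor G. f g \<in> Y} \<inter> ((\<Inter>n\<in>{..<K}. {g \<in> Mor G. f g \<in> U - E n} \<union> N (x n)) \<inter> Mor G)"
    have "open_mor ?T"
    proof (rule openin_Int[OF pre openin_INT])
      show "open_obj Y" using Y opZ by blast
      show "open_mor ({g \<in> Mor G. f g \<in> U - E n} \<union> N (x n))" for n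
        using pre[OF opE] N(1)[OF xU] by blast
    qed auto
    moreover have "g \<in> ?T" using g Y by auto
    moreover have "?T \<subseteq> ?R"
    proof
      fix h assume h: "h \<in> ?T"
      have "Y \<subseteq> U" using Y(1) openin_subset tZ by blast
      have "h \<in> N (x n)" if n: "f h \<in> E n" for n
      proof -
        have "n < K" using Y(3)[of n] h n by (auto simp: not_less[symmetric])
        then have "h \<in> {g \<in> Mor G. f g \<in> U - E n} \<union> N (x n)" using h by blast
        then show ?thesis using n by blast
      qed
      then show "h \<in> ?R" using h \<open>Y \<subseteq> U\<close> by blast
    qed
    ultimately show "\<exists>T. open_mor T \<and> g \<in> T \<and> T \<subseteq> ?R" by blast
  qed
  define V where "V = W \<inter> ({g \<in> Mor G. src g \<in> U \<and> (\<forall>n. src g \<in> E n \<longrightarrow> g \<in> N (x n))} \<inter>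
     {g \<in> Mor G. tgt g \<in> U \<and> (\<forall>n. tgt g \<in> E n \<longrightarrow> g \<in> N (x n))})"
  show ?thesis
  proof
    show "open_mor V"
      unfolding V_def by (intro openin_Int W(1) pieces source_continuous target_continuous)
    show "V \<subseteq> W \<inter> restr U" by (auto simp: V_def restr_def)
    show "un z \<in> V" if "z \<in> U" for z
      using that U_subset_Obj W(2)[OF that] E(3) by (auto simp: V_def grp_simps subset_iff)
    show "a \<cdot> b \<in> W" if ab: "a \<in> V" "b \<in> V" "src a = tgt b" for a b
    proof -
      have "src a \<in> topspace ?Z" using ab tZ by (simp add: V_def)
      then obtain n where "src a \<in> E n" using E4 by blast
      then have "a \<in> N (x n)" "b \<in> N (x n)" using ab by (auto simp: V_def)
      then show ?thesis using N(3) xU ab by blast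
    qed
  qed
qed

end

section \<open>Norms on restrictions of a groupoid\<close>

context open_topological_groupoid
begin

lemma third_neighbourhood:
  assumes U: "open_obj U"
    and met: "metrizable_space (subtopology (obj_space G) U)"
    and sc: "second_countable (obj_space G)"
    and W: "open_mor W" "\<And>x. x \<in> U \<Longrightarrow> un x \<in> W"
  shows "\<exists>V. open_mor V \<and> V \<subseteq> W \<inter> restr U \<and> (\<forall>x\<in>U. un x \<in> V) \<and> (\<forall>a\<in>V. iv a \<in> V) \<and>
    (\<forall>a\<in>V. \<forall>b\<in>V. \<forall>c\<in>V. src a = tgt b \<longrightarrow> src b = tgt c \<longrightarrow> a \<cdot> b \<cdot> c \<in> W)"
proof -
  obtain A where A: "open_mor A" "A \<subseteq> W \<inter> restr U" "\<And>x. x \<in> U \<Longrightarrow> un x \<in> A"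
    "\<And>a b. a \<in> A \<Longrightarrow> b \<in> A \<Longrightarrow> src a = tgt b \<Longrightarrow> a \<cdot> b \<in> W"
    using half_neighbourhood[OF U met sc W] by metis
  obtain B where B: "open_mor B" "B \<subseteq> A \<inter> restr U" "\<And>x. x \<in> U \<Longrightarrow> un x \<in> B"
    "\<And>a b. a \<in> B \<Longrightarrow> b \<in> B \<Longrightarrow> src a = tgt b \<Longrightarrow> a \<cdot> b \<in> A"
    using half_neighbourhood[OF U met sc A(1,3)] by metis
  (* Two halvings give products of four, hence of three, elements. *)
  let ?V = "B \<inter> {g \<in> Mor G. iv g \<in> B}"
  have U_subset_Obj: "U \<subseteq> Obj G" using U openin_subset by blast
  have BM: "B \<subseteq> Mor G" using B openin_subset by blast
  show ?thesis
  proof (intro exI[of _ ?V] conjI ballI impI)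
    show "open_mor ?V" using B open_iv by blast
    show "?V \<subseteq> W \<inter> restr U" using A B by blast
    show "un x \<in> ?V" if "x \<in> U" for x using that B(3) U_subset_Obj inv_unit by (auto simp: grp_simps subset_iff)
    show "iv a \<in> ?V" if "a \<in> ?V" for a using that inv_inv by (auto simp: grp_simps)
    fix a b c assume *: "a \<in> ?V" "b \<in> ?V" "c \<in> ?V" "src a = tgt b" "src b = tgt c"
    then have "a \<cdot> b \<in> A" "c \<in> A" "src (a \<cdot> b) = tgt c"
      using B BM by (auto simp: grp_simps)
    then show "a \<cdot> b \<cdot> c \<in> W" by (rule A(4))
  qed
qed

text \<open>
A single sequence of neighbourhoods of all units over \<open>U\<close> determines the topology at each of these units, once
the target is also confined.  For basic open sets \<open>Y\<close> of objects and \<open>B\<close> of arrows such that the units over the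
closure of \<open>Y\<close> lie in \<open>B\<close>, require an arrow to lie in \<open>B\<close> if its target is in this closure.  Regularity of
\<open>U\<close> supplies enough such pairs.
\<close>
lemma countable_unit_neighbourhoods:
  assumes U: "open_obj U"
    and reg: "regular_space (subtopology (obj_space G) U)"
    and sco: "second_countable (obj_space G)" and scm: "second_countable (mor_space G)"
  shows "\<exists>W :: nat \<Rightarrow> 'g set. (\<forall>n. open_mor (W n) \<and> (\<forall>x\<in>U. un x \<in> W n)) \<and>
    (\<forall>z\<in>U. \<forall>Q. open_mor Q \<longrightarrow> un z \<in> Q \<longrightarrow>
       (\<exists>n Y. open_obj Y \<and> z \<in> Y \<and> {g \<in> W n. tgt g \<in> Y} \<subseteq> Q))"
proof -
  let ?Z = "subtopology (obj_space G) U"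
  have U_subset_Obj: "U \<subseteq> Obj G" using U openin_subset by blast
  have tZ: "topspace ?Z = U" using U_subset_Obj by auto
  obtain BO where BO: "countable BO" "\<And>V. V \<in> BO \<Longrightarrow> open_obj V"
    "\<And>Q x. open_obj Q \<Longrightarrow> x \<in> Q \<Longrightarrow> \<exists>V\<in>BO. x \<in> V \<and> V \<subseteq> Q"
    using sco unfolding second_countable_def by metis
  obtain BM where BM: "countable BM" "\<And>V. V \<in> BM \<Longrightarrow> open_mor V"
    "\<And>Q x. open_mor Q \<Longrightarrow> x \<in> Q \<Longrightarrow> \<exists>V\<in>BM. x \<in> V \<and> V \<subseteq> Q"
    using scm unfolding second_countable_def by metis
  define P where "P = insert ({}, {}) {(Y, B). Y \<in> BO \<and> B \<in> BM \<and> (\<forall>z \<in> ?Z closure_of Y. un z \<in> B)}"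
  have cP: "countable P"
    unfolding P_def using BO(1) BM(1)
    by (intro countable_insert countable_subset[OF _ countable_SIGMA[of BO "\<lambda>_. BM"]]) auto
  have neP: "P \<noteq> {}" by (simp add: P_def)
  have Pin: "(\<forall>z \<in> ?Z closure_of Y. un z \<in> B) \<and> open_mor B" if "(Y, B) \<in> P" for Y B
    using that BM(2) by (auto simp: P_def)
  define Wf where "Wf = (\<lambda>(Y, B). {g \<in> Mor G. tgt g \<in> U - ?Z closure_of Y} \<union> ({g \<in> Mor G. tgt g \<in> U} \<inter> B))"
  have op: "open_mor (Wf p)" if "p \<in> P" for p
  proof -
    obtain Y B where p: "p = (Y, B)" by force
    have "openin ?Z (U - ?Z closure_of Y)"
      using closedin_closure_of[of ?Z Y] tZ by (simp add: closedin_def)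
    then have "open_obj (U - ?Z closure_of Y)" using U openin_trans_full by blast
    moreover have "open_mor B" using Pin that p by blast
    ultimately have "open_mor
        ({g \<in> Mor G. tgt g \<in> U - ?Z closure_of Y} \<union> ({g \<in> Mor G. tgt g \<in> U} \<inter> B))"
      using U by (intro openin_Un openin_Int open_tgt)
    then show ?thesis by (simp only: p Wf_def case_prod_conv)
  qed
  have unW: "un x \<in> Wf p" if "p \<in> P" "x \<in> U" for p x
    using that Pin U_subset_Obj by (cases p) (auto simp: Wf_def grp_simps subset_iff)
  have base: "\<exists>p\<in>P. \<exists>Y. open_obj Y \<and> z \<in> Y \<and> {g \<in> Wf p. tgt g \<in> Y} \<subseteq> Q"
    if z: "z \<in> U" and Q: "open_mor Q" "un z \<in> Q" for z Q
  proof -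
    obtain B where B: "B \<in> BM" "un z \<in> B" "B \<subseteq> Q" using BM(3) Q by blast
    have "{x \<in> U. un x \<in> B} = {x \<in> Obj G. un x \<in> B} \<inter> U" using U_subset_Obj by auto
    then have "openin ?Z {x \<in> U. un x \<in> B}"
      using open_un[OF BM(2)[OF B(1)]] by (auto intro: openin_subtopology_Int)
    moreover have "z \<in> {x \<in> U. un x \<in> B}" using z B by simp
    ultimately have "\<exists>V C. openin ?Z V \<and> closedin ?Z C \<and> z \<in> V \<and> V \<subseteq> C \<and> C \<subseteq> {x \<in> U. un x \<in> B}"
      using reg unfolding neighbourhood_base_of_closedin[symmetric] neighbourhood_base_of by blast
    then obtain V C where V: "openin ?Z V" "closedin ?Z C" "z \<in> V" "V \<subseteq> C" "C \<subseteq> {x \<in> U. un x \<in> B}"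
      by blast
    have "open_obj V" using V(1) U openin_trans_full by blast
    then obtain Y where Y: "Y \<in> BO" "z \<in> Y" "Y \<subseteq> V" using BO(3) V(3) by blast
    have "?Z closure_of Y \<subseteq> C" using closure_of_minimal V Y by (metis subset_trans)
    then have "(Y, B) \<in> P" using Y B V by (auto simp: P_def)
    moreover have "Y \<subseteq> ?Z closure_of Y"
      using closure_of_subset[of Y ?Z] tZ Y V(1) openin_subset by blast
    then have "{g \<in> Wf (Y, B). tgt g \<in> Y} \<subseteq> Q" using B by (auto simp: Wf_def)
    ultimately show ?thesis using BO(2) Y by blast
  qed
  let ?W = "\<lambda>n. Wf (from_nat_into P n)"
  have inP: "from_nat_into P n \<in> P" for n using from_nat_into[OF neP] .
  show ?thesis
  proof (intro exI[of _ ?W] conjI allI ballI impI)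
    show "open_mor (?W n)" for n using op inP by blast
    show "un x \<in> ?W n" if "x \<in> U" for n x using unW inP that by blast
    fix z Q assume "z \<in> U" "open_mor Q" "un z \<in> Q"
    then obtain p Y where p: "p \<in> P" "open_obj Y" "z \<in> Y" "{g \<in> Wf p. tgt g \<in> Y} \<subseteq> Q"
      using base by blast
    obtain n where "from_nat_into P n = p" using from_nat_into_surj[OF cP p(1)] by blast
    then show "\<exists>n Y. open_obj Y \<and> z \<in> Y \<and> {g \<in> ?W n. tgt g \<in> Y} \<subseteq> Q"
      using p by blast
  qed
qed

end

text \<open>
A sequence as in the Birkhoff--Kakutani metrization theorem; the condition on triple products is the one used by
Frink's chain lemma.
\<close>
locale unit_filtration = open_topological_groupoid G
  for G :: "('o, 'g) groupoid_data" +
  fixes U :: "'o set" and V :: "nat \<Rightarrow> 'g set"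
  assumes U_open: "open_obj U"
    and V_0: "V 0 = restr U"
    and V_open: "open_mor (V n)"
    and V_unit: "x \<in> U \<Longrightarrow> un x \<in> V n"
    and V_inv: "a \<in> V n \<Longrightarrow> iv a \<in> V n"
    and V_Suc: "V (Suc n) \<subseteq> V n"
    and V_cube: "a \<in> V (Suc n) \<Longrightarrow> b \<in> V (Suc n) \<Longrightarrow> c \<in> V (Suc n) \<Longrightarrow>
      src a = tgt b \<Longrightarrow> src b = tgt c \<Longrightarrow> a \<cdot> b \<cdot> c \<in> V n"
begin

lemma V_mono: "m \<le> n \<Longrightarrow> V n \<subseteq> V m"
  using V_Suc by (rule lift_Suc_antimono_le)

lemma V_restr: "a \<in> V n \<Longrightarrow> a \<in> restr U"
  using V_mono[of 0 n] V_0 by blast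

definition weight :: "nat list \<Rightarrow> real" where
  "weight ns = (\<Sum>n\<leftarrow>ns. 1 / 2 ^ n)"

text \<open>
The list \<open>ns\<close> records a factorization of the arrow with the \<open>i\<close>-th factor in \<open>V (ns ! i)\<close>; the empty
factorization stands for a unit.
\<close>
fun chain :: "nat list \<Rightarrow> 'g \<Rightarrow> bool" where
  "chain [] g = (\<exists>x\<in>U. g = un x)"
| "chain (n # ns) g = (\<exists>a\<in>V n. \<exists>h. chain ns h \<and> src a = tgt h \<and> g = a \<cdot> h)"

lemma weight_simps [simp]: "weight [] = 0" "weight (n # ns) = 1 / 2 ^ n + weight ns" "weight (ns @ ms) = weight ns + weight ms"
  "weight (rev ns) = weight ns"
  by (simp_all add: weight_def rev_map[symmetric] sum_list_rev)

lemma weight_nonneg: "0 \<le> weight ns"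
  by (induction ns) auto

lemma U_subset_Obj: "U \<subseteq> Obj G"
  using U_open openin_subset by blast

lemma chain_in: "chain ns g \<Longrightarrow> g \<in> restr U"
proof (induction ns arbitrary: g)
  case Nil then show ?case using U_subset_Obj by (auto simp: restr_def grp_simps subset_iff)
next
  case (Cons n ns)
  then obtain a h where "a \<in> V n" "chain ns h" "src a = tgt h" "g = a \<cdot> h" by auto
  then show ?case using V_restr[of a n] Cons.IH[of h] by (auto simp: restr_def grp_simps)
qed

lemma chain_single: "a \<in> V n \<Longrightarrow> chain [n] a"
  using V_restr[of a n] mult_unit_source[of a] target_unit[OF source_in, of a]
  by (auto simp: restr_def intro!: bexI[of _ a] exI[of _ "un (src a)"])

lemma chain_append: "chain (ns @ ms) g \<longleftrightarrow> (\<exists>a b. chain ns a \<and> chain ms b \<and> src a = tgt b \<and> g = a \<cdot> b)"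
proof (induction ns arbitrary: g)
  case Nil
  show ?case
  proof
    assume "chain ([] @ ms) g"
    then have "chain ms g" by simp
    moreover have g: "g \<in> restr U" using \<open>chain ms g\<close> by (rule chain_in)
    then have "chain [] (un (tgt g))" by (auto simp: restr_def)
    ultimately show "\<exists>a b. chain [] a \<and> chain ms b \<and> src a = tgt b \<and> g = a \<cdot> b"
      using g mult_unit_target[of g] source_unit[OF target_in, of g] by (metis (no_types, lifting) restr_def mem_Collect_eq)
  next
    assume "\<exists>a b. chain [] a \<and> chain ms b \<and> src a = tgt b \<and> g = a \<cdot> b"
    then obtain x b where x: "x \<in> U" "chain ms b" "src (un x) = tgt b" "g = un x \<cdot> b" by auto
    then have "x = tgt b" "b \<in> Mor G" using chain_in[of ms b] U_subset_Obj source_unit[of x] by (auto simp: restr_def)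
    then have "g = b" using x mult_unit_target by simp
    then show "chain ([] @ ms) g" using x by simp
  qed
next
  case (Cons n ns)
  show ?case
  proof
    assume "chain ((n # ns) @ ms) g"
    then obtain c h where c: "c \<in> V n" "chain (ns @ ms) h" "src c = tgt h" "g = c \<cdot> h" by auto
    then obtain a b where a: "chain ns a" "chain ms b" "src a = tgt b" "h = a \<cdot> b" using Cons by blast
    have M: "a \<in> Mor G" "b \<in> Mor G" "c \<in> Mor G"
      using chain_in[OF a(1)] chain_in[OF a(2)] V_restr[OF c(1)] by (auto simp: restr_def)
    have ca: "src c = tgt a" using c a M by (simp add: grp_simps)
    then have "chain (n # ns) (c \<cdot> a)" using c a by auto
    moreover have "g = c \<cdot> a \<cdot> b" using assoc[OF M(3,1,2)] ca a c by simp
    moreover have "src (c \<cdot> a) = tgt b" using a M ca by (simp add: grp_simps)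
    ultimately show "\<exists>a b. chain (n # ns) a \<and> chain ms b \<and> src a = tgt b \<and> g = a \<cdot> b" using a by blast
  next
    assume "\<exists>a b. chain (n # ns) a \<and> chain ms b \<and> src a = tgt b \<and> g = a \<cdot> b"
    then obtain c a b where a: "c \<in> V n" "chain ns a" "src c = tgt a" "chain ms b" "src (c \<cdot> a) = tgt b" "g = c \<cdot> a \<cdot> b"
      by auto
    have M: "a \<in> Mor G" "b \<in> Mor G" "c \<in> Mor G"
      using chain_in[OF a(2)] chain_in[OF a(4)] V_restr[OF a(1)] by (auto simp: restr_def)
    have ab: "src a = tgt b" using a M by (simp add: grp_simps)
    then have "chain (ns @ ms) (a \<cdot> b)" using Cons a by blast
    moreover have "g = c \<cdot> (a \<cdot> b)" using assoc[OF M(3,1,2)] ab a by simp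
    moreover have "src c = tgt (a \<cdot> b)" using M ab a by (simp add: grp_simps)
    ultimately show "chain ((n # ns) @ ms) g" using a by auto
  qed
qed

lemma chain_inv: "chain ns g \<Longrightarrow> chain (rev ns) (iv g)"
proof (induction ns arbitrary: g)
  case Nil then show ?case using inv_unit U_subset_Obj by (auto simp: subset_iff)
next
  case (Cons n ns)
  then obtain a h where a: "a \<in> V n" "chain ns h" "src a = tgt h" "g = a \<cdot> h" by auto
  then have M: "a \<in> Mor G" "h \<in> Mor G" using chain_in[of ns h] V_restr[of a n] by (auto simp: restr_def)
  have "chain [n] (iv a)" using chain_single V_inv a by blast
  moreover have "chain (rev ns) (iv h)" using Cons a by blast
  moreover have "iv g = iv h \<cdot> iv a" "src (iv h) = tgt (iv a)" using inv_mul M a by (simp_all add: grp_simps)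
  ultimately show ?case using chain_append[of "rev ns" "[n]" "iv g"] unfolding rev.simps by blast
qed

lemma weight_split: "weight ns < c + c' \<Longrightarrow> ns \<noteq> [] \<Longrightarrow> c > 0 \<Longrightarrow> c' > 0 \<Longrightarrow>
   \<exists>as m bs. ns = as @ m # bs \<and> weight as < c \<and> weight bs < c'"
proof (induction ns arbitrary: c)
  case (Cons n ns)
  show ?case
  proof (cases "weight ns < c'")
    case True
    then show ?thesis using Cons.prems by (intro exI[of _ "[]"] exI[of _ n] exI[of _ ns]) simp
  next
    case False
    then have "ns \<noteq> []" using Cons.prems by auto
    moreover have "weight ns < (c - 1 / 2 ^ n) + c'" "c - 1 / 2 ^ n > 0" using Cons.prems False by simp_all
    ultimately obtain as m bs where "ns = as @ m # bs" "weight as < c - 1 / 2 ^ n" "weight bs < c'"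
      using Cons.IH[of "c - 1 / 2 ^ n"] Cons.prems by blast
    then show ?thesis by (intro exI[of _ "n # as"] exI[of _ m] exI[of _ bs]) simp
  qed
qed simp

text \<open>
Frink's chain lemma.  A factorization of weight below \<open>2\<^sup>-\<^sup>k\<close> splits into two parts of weight below \<open>2\<^sup>-\<^sup>k\<^sup>-\<^sup>1\<close> and
one factor between them, whose index must exceed \<open>k\<close>.  By induction all three pieces lie in \<open>V (Suc k)\<close>.
\<close>
lemma chain_small: "weight ns < 1 / 2 ^ k \<Longrightarrow> chain ns g \<Longrightarrow> g \<in> V k"
proof (induction ns arbitrary: k g rule: length_induct)
  case (1 ns)
  show ?case
  proof (cases "ns = []")
    case True then show ?thesis using 1 V_unit by auto
  next
    case False
    have "weight ns < 1 / 2 ^ Suc k + 1 / 2 ^ Suc k" using 1 by simp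
    then obtain as m bs where ns: "ns = as @ m # bs" "weight as < 1 / 2 ^ Suc k" "weight bs < 1 / 2 ^ Suc k"
      using weight_split[OF _ False, of "1 / 2 ^ Suc k" "1 / 2 ^ Suc k"] by auto
    have "1 / 2 ^ m < (1::real) / 2 ^ k" using 1(2) ns(1) weight_nonneg[of as] weight_nonneg[of bs] by simp
    then have "(2::real) ^ k < 2 ^ m" by (simp add: field_simps)
    then have "Suc k \<le> m" by simp
    obtain a h where a: "chain as a" "chain (m # bs) h" "src a = tgt h" "g = a \<cdot> h"
      using 1(3) ns chain_append by blast
    then obtain b c where b: "b \<in> V m" "chain bs c" "src b = tgt c" "h = b \<cdot> c" by auto
    have V: "a \<in> V (Suc k)" "b \<in> V (Suc k)" "c \<in> V (Suc k)"
    proof -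
      have "length as < length ns" "length bs < length ns" using ns(1) by simp_all
      then show "a \<in> V (Suc k)" "c \<in> V (Suc k)" using 1(1) a(1) b(2) ns(2,3) by blast+
      show "b \<in> V (Suc k)" using b(1) V_mono[OF \<open>Suc k \<le> m\<close>] by blast
    qed
    then have M: "a \<in> Mor G" "b \<in> Mor G" "c \<in> Mor G" using V_restr by (auto simp: restr_def)
    have ab: "src a = tgt b" using a b M by (simp add: grp_simps)
    then have "g = a \<cdot> b \<cdot> c" using assoc[OF M] a b by simp
    then show ?thesis using V_cube[OF V ab b(3)] by simp
  qed
qed

text \<open>
The unit at the end of a factorization may be replaced by a factor of arbitrarily small weight, and products of open
sets are open.
\<close>
lemma chain_nbhd:
  "chain ns g \<Longrightarrow> weight ns < r \<Longrightarrow> \<exists>T. open_mor T \<and> g \<in> T \<and> (\<forall>h\<in>T. \<exists>ms. chain ms h \<and> weight ms < r)"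
proof (induction ns arbitrary: g r)
  case Nil
  then have "r > 0" by simp
  then obtain n where n: "1 / 2 ^ n < r"
    using real_arch_pow_inv[of r "1/2"] by (auto simp: power_one_over)
  show ?case
  proof (intro exI[of _ "V n"] conjI ballI)
    show "g \<in> V n" using Nil V_unit by auto
    show "\<exists>ms. chain ms h \<and> weight ms < r" if "h \<in> V n" for h
      using chain_single[OF that] n by (intro exI[of _ "[n]"]) simp
  qed (rule V_open)
next
  case (Cons n ns)
  then obtain a h where a: "a \<in> V n" "chain ns h" "src a = tgt h" "g = a \<cdot> h" by auto
  obtain T where T: "open_mor T" "h \<in> T" "\<forall>h\<in>T. \<exists>ms. chain ms h \<and> weight ms < r - 1 / 2 ^ n"
    using Cons.IH[OF a(2), of "r - 1 / 2 ^ n"] Cons.prems by auto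
  let ?T = "{g. \<exists>a\<in>V n. \<exists>b\<in>T. src a = tgt b \<and> g = a \<cdot> b}"
  show ?case
  proof (intro exI[of _ ?T] conjI ballI)
    show "open_mor ?T" using open_prod[OF V_open T(1)] .
    show "g \<in> ?T" using a T by blast
    fix w assume "w \<in> ?T"
    then obtain a b where ab: "a \<in> V n" "b \<in> T" "src a = tgt b" "w = a \<cdot> b" by blast
    then obtain ms where "chain ms b" "weight ms < r - 1 / 2 ^ n" using T by blast
    then show "\<exists>ms. chain ms w \<and> weight ms < r" using ab by (intro exI[of _ "n # ms"]) auto
  qed
qed

definition chain_norm :: "'g \<Rightarrow> real" where
  "chain_norm g = Inf (weight ` {ns. chain ns g})"

lemma chain_norm_lt_iff:
  assumes "g \<in> restr U"
  shows "chain_norm g < r \<longleftrightarrow> (\<exists>ns. chain ns g \<and> weight ns < r)"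
proof -
  have "chain [0] g" using chain_single V_0 assms by blast
  moreover have "bdd_below (weight ` {ns. chain ns g})" using weight_nonneg by (intro bdd_belowI2)
  ultimately show ?thesis
    unfolding chain_norm_def by (subst cInf_less_iff) (blast, blast, blast)
qed

lemma chain_norm_le: "chain ns g \<Longrightarrow> chain_norm g \<le> weight ns"
  using chain_norm_lt_iff[OF chain_in, of ns g "chain_norm g"] by (meson less_irrefl not_le)

lemma chain_norm_nonneg: "g \<in> restr U \<Longrightarrow> 0 \<le> chain_norm g"
  using chain_norm_lt_iff[of g 0] weight_nonneg by (meson not_le)

lemma chain_norm_le1: "g \<in> restr U \<Longrightarrow> chain_norm g \<le> 1"
  using chain_norm_le[of "[0]" g] chain_single[of g 0] V_0 by simp

lemma chain_norm_unit: "x \<in> U \<Longrightarrow> chain_norm (un x) = 0"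
  using chain_norm_le[of "[]" "un x"] chain_norm_nonneg[OF chain_in, of "[]" "un x"] by fastforce

lemma chain_norm_inv_le: "g \<in> restr U \<Longrightarrow> chain_norm (iv g) \<le> chain_norm g"
proof (rule field_le_epsilon)
  fix e :: real assume "g \<in> restr U" "e > 0"
  then obtain ns where "chain ns g" "weight ns < chain_norm g + e" using chain_norm_lt_iff[of g "chain_norm g + e"] by auto
  then show "chain_norm (iv g) \<le> chain_norm g + e" using chain_norm_le[OF chain_inv, of ns g] by simp
qed

lemma chain_norm_inv: "g \<in> restr U \<Longrightarrow> chain_norm (iv g) = chain_norm g"
  using chain_norm_inv_le[of g] chain_norm_inv_le[of "iv g"] inv_inv[of g] by (auto simp: restr_def grp_simps)

lemma chain_norm_mul:
  assumes "g \<in> restr U" "h \<in> restr U" "src g = tgt h"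
  shows "chain_norm (g \<cdot> h) \<le> chain_norm g + chain_norm h"
proof (rule field_le_epsilon)
  fix e :: real assume "e > 0"
  then obtain ns ms where "chain ns g" "weight ns < chain_norm g + e/2" "chain ms h" "weight ms < chain_norm h + e/2"
    using chain_norm_lt_iff[OF assms(1), of "chain_norm g + e/2"] chain_norm_lt_iff[OF assms(2), of "chain_norm h + e/2"] by auto
  then show "chain_norm (g \<cdot> h) \<le> chain_norm g + chain_norm h + e"
    using chain_norm_le[of "ns @ ms" "g \<cdot> h"] chain_append assms(3) by fastforce
qed

lemma chain_norm_open: "open_mor {g \<in> restr U. chain_norm g < r}"
proof (subst openin_subopen, intro ballI)
  fix g assume "g \<in> {g \<in> restr U. chain_norm g < r}"
  then obtain ns where ns: "chain ns g" "weight ns < r" using chain_norm_lt_iff by auto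
  obtain T where T: "open_mor T" "g \<in> T" "\<forall>h\<in>T. \<exists>ms. chain ms h \<and> weight ms < r"
    using chain_nbhd[OF ns] by (elim exE conjE) (rule that)
  then have "T \<subseteq> {g \<in> restr U. chain_norm g < r}"
    using chain_in chain_norm_lt_iff by blast
  then show "\<exists>T. open_mor T \<and> g \<in> T \<and> T \<subseteq> {g \<in> restr U. chain_norm g < r}" using T by blast
qed

lemma chain_norm_small: "g \<in> restr U \<Longrightarrow> chain_norm g < 1 / 2 ^ k \<Longrightarrow> g \<in> V k"
  using chain_norm_lt_iff chain_small by blast

end

text \<open>
The metric data on one member \<open>U\<close> of the cover.  Unlike in the case of groups, smallness of \<open>\<rho>\<close> alone does not
confine an arrow to a neighbourhood of a given unit: the arrow could be a unit elsewhere.  Therefore \<open>rho_base\<close>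
also restricts the target.
\<close>
locale normed_open = open_topological_groupoid G
  for G :: "('o, 'g) groupoid_data" +
  fixes U :: "'o set" and \<rho> :: "'g \<Rightarrow> real"
  assumes U_open: "open_obj U"
    and U_Hausdorff: "Hausdorff_space (subtopology (obj_space G) U)"
    and rho_nonneg: "g \<in> restr U \<Longrightarrow> 0 \<le> \<rho> g"
    and rho_le1: "g \<in> restr U \<Longrightarrow> \<rho> g \<le> 1"
    and rho_unit: "x \<in> U \<Longrightarrow> \<rho> (un x) = 0"
    and rho_inv: "g \<in> restr U \<Longrightarrow> \<rho> (iv g) = \<rho> g"
    and rho_mul: "g \<in> restr U \<Longrightarrow> h \<in> restr U \<Longrightarrow> src g = tgt h \<Longrightarrow> \<rho> (g \<cdot> h) \<le> \<rho> g + \<rho> h"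
    and rho_open: "open_mor {g \<in> restr U. \<rho> g < r}"
    and rho_base: "z \<in> U \<Longrightarrow> open_mor Q \<Longrightarrow> un z \<in> Q \<Longrightarrow>
      \<exists>Y r. open_obj Y \<and> z \<in> Y \<and> r > 0 \<and> {g \<in> restr U. \<rho> g < r \<and> tgt g \<in> Y} \<subseteq> Q"

context open_topological_groupoid
begin

lemma exists_norm:
  assumes U: "open_obj U"
    and met: "metrizable_space (subtopology (obj_space G) U)"
    and sco: "second_countable (obj_space G)" and scm: "second_countable (mor_space G)"
  shows "\<exists>\<rho>. normed_open G U \<rho>"
proof -
  have U_subset_Obj: "U \<subseteq> Obj G" using U openin_subset by blast
  obtain W :: "nat \<Rightarrow> 'g set" where
    W0: "\<forall>n. open_mor (W n) \<and> (\<forall>x\<in>U. un x \<in> W n)"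
    and Wbase: "\<forall>z\<in>U. \<forall>Q. open_mor Q \<longrightarrow> un z \<in> Q \<longrightarrow>
       (\<exists>n Y. open_obj Y \<and> z \<in> Y \<and> {g \<in> W n. tgt g \<in> Y} \<subseteq> Q)"
    using countable_unit_neighbourhoods[OF U metrizable_imp_regular_space[OF met] sco scm]
    by (elim exE conjE) (rule that)
  have W: "open_mor (W n)" "x \<in> U \<Longrightarrow> un x \<in> W n" for n x
    using W0 by blast+
  define P where "P = (\<lambda>V. open_mor V \<and> (\<forall>x\<in>U. un x \<in> V) \<and> (\<forall>a\<in>V. iv a \<in> V) \<and> V \<subseteq> restr U)"
  define Q where "Q = (\<lambda>n V V'. V' \<subseteq> V \<inter> W n \<and> (\<forall>a\<in>V'. \<forall>b\<in>V'. \<forall>c\<in>V'. src a = tgt b \<longrightarrow> src b = tgt c \<longrightarrow> a \<cdot> b \<cdot> c \<in> V))"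
  have P0: "P (restr U)"
    using open_restr[OF U] U_subset_Obj by (auto simp: P_def restr_def grp_simps subset_iff)
  have step: "\<exists>V'. P V' \<and> Q n V V'" if "P V" for n V
  proof -
    have VW: "open_mor (V \<inter> W n)" "\<And>x. x \<in> U \<Longrightarrow> un x \<in> V \<inter> W n"
      using that W by (auto simp: P_def)
    have "\<exists>V'. open_mor V' \<and> V' \<subseteq> V \<inter> W n \<inter> restr U \<and> (\<forall>x\<in>U. un x \<in> V') \<and>
        (\<forall>a\<in>V'. iv a \<in> V') \<and> (\<forall>a\<in>V'. \<forall>b\<in>V'. \<forall>c\<in>V'.
          src a = tgt b \<longrightarrow> src b = tgt c \<longrightarrow> a \<cdot> b \<cdot> c \<in> V \<inter> W n)"
      by (rule third_neighbourhood[OF U met sco VW])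
    then show ?thesis
      unfolding P_def Q_def by (elim exE, intro exI conjI) blast+
  qed
  have "\<exists>f. f 0 = restr U \<and> (\<forall>n. P (f n)) \<and> (\<forall>n. Q n (f n) (f (Suc n)))"
  proof -
    have "\<exists>f. \<forall>n. (P (f n) \<and> (n = 0 \<longrightarrow> f n = restr U)) \<and> Q n (f n) (f (Suc n))"
      by (rule dependent_nat_choice) (use P0 step in auto)
    then show ?thesis by blast
  qed
  then obtain V where V: "V 0 = restr U" "\<And>n. P (V n)" "\<And>n. Q n (V n) (V (Suc n))" by blast
  interpret F: unit_filtration G U V
    using V U by unfold_locales (auto simp: P_def Q_def)
  have "normed_open G U F.chain_norm"
  proof unfold_locales
    show "Hausdorff_space (subtopology (obj_space G) U)" using metrizable_imp_Hausdorff_space[OF met] .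
    fix z Q assume z: "z \<in> U" "open_mor Q" "un z \<in> Q"
    then have "\<exists>n Y. open_obj Y \<and> z \<in> Y \<and> {g \<in> W n. tgt g \<in> Y} \<subseteq> Q"
      using Wbase by blast
    then obtain n Y where Y: "open_obj Y" "z \<in> Y" "{g \<in> W n. tgt g \<in> Y} \<subseteq> Q"
      by (elim exE conjE) (rule that)
    have "V (Suc n) \<subseteq> W n" using V(3)[of n] by (auto simp: Q_def)
    then have "{g \<in> restr U. F.chain_norm g < 1 / 2 ^ Suc n \<and> tgt g \<in> Y} \<subseteq> Q"
      using F.chain_norm_small Y by blast
    then show "\<exists>Y r. open_obj Y \<and> z \<in> Y \<and> r > 0 \<and> {g \<in> restr U. F.chain_norm g < r \<and> tgt g \<in> Y} \<subseteq> Q"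
      using Y by (intro exI[of _ Y] exI[of _ "1 / 2 ^ Suc n"]) auto
  qed (rule U F.chain_norm_nonneg F.chain_norm_le1 F.chain_norm_unit F.chain_norm_inv F.chain_norm_mul F.chain_norm_open; assumption)+
  then show ?thesis by blast
qed

end

section \<open>Left-invariant distances and the action by left translation\<close>

context normed_open
begin

text \<open>
Left translation preserves sources, so it acts on the arrows with source in \<open>U\<close>.
\<close>
definition sdom :: "'g topology" where
  "sdom = subtopology (mor_space G) {h. src h \<in> U}"

definition ldist :: "'g \<Rightarrow> 'g \<Rightarrow> real" where
  "ldist h k = (if tgt h = tgt k then \<rho> (iv h \<cdot> k) else 1)"

text \<open>
The extension of left translation by \<open>g\<close> to the completion: \<open>g\<close> carries the point with distance
function \<open>f\<close> to the point whose distance from \<open>h\<close> is that of the former from \<open>g\<inverse> h\<close>.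
\<close>
definition act :: "'g \<Rightarrow> ('g \<Rightarrow> real) \<Rightarrow> 'g \<Rightarrow> real" where
  "act g f = (\<lambda>h. if h \<in> topspace sdom then if tgt h = tgt g then f (iv g \<cdot> h) else 1 else 0)"

lemma topspace_sdom: "topspace sdom = {h \<in> Mor G. src h \<in> U}"
  by (auto simp: sdom_def)

lemma openin_sdom: "openin sdom S \<longleftrightarrow> open_mor S \<and> S \<subseteq> topspace sdom"
proof -
  have "open_mor (topspace sdom)" using open_src[OF U_open] topspace_sdom by simp
  moreover have "sdom = subtopology (mor_space G) (topspace sdom)"
    unfolding sdom_def topspace_subtopology by (metis subtopology_restrict)
  ultimately show ?thesis by (metis openin_open_subtopology)
qed

lemma sdom_restr: "h \<in> topspace sdom \<Longrightarrow> k \<in> topspace sdom \<Longrightarrow> tgt h = tgt k \<Longrightarrow> iv h \<cdot> k \<in> restr U"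
  by (simp add: topspace_sdom restr_def grp_simps)

lemma ldist_le1: "h \<in> topspace sdom \<Longrightarrow> k \<in> topspace sdom \<Longrightarrow> ldist h k \<le> 1"
  using rho_le1 sdom_restr by (simp add: ldist_def)

lemma ldist_nonneg: "h \<in> topspace sdom \<Longrightarrow> k \<in> topspace sdom \<Longrightarrow> 0 \<le> ldist h k"
  using rho_nonneg sdom_restr by (simp add: ldist_def)

lemma ldist_tri:
  assumes "h \<in> topspace sdom" "k \<in> topspace sdom" "l \<in> topspace sdom"
  shows "ldist h l \<le> ldist h k + ldist k l"
proof (cases "tgt h = tgt k \<and> tgt k = tgt l")
  case True
  have M: "h \<in> Mor G" "k \<in> Mor G" "l \<in> Mor G" using assms topspace_sdom by auto
  then have "(iv h \<cdot> k) \<cdot> (iv k \<cdot> l) = iv h \<cdot> l" "src (iv h \<cdot> k) = tgt (iv k \<cdot> l)"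
    using True inv_mul_telescope by (simp_all add: grp_simps)
  then show ?thesis
    using rho_mul[of "iv h \<cdot> k" "iv k \<cdot> l"] sdom_restr assms True by (simp add: ldist_def)
next
  case False
  then have "ldist h k = 1 \<or> ldist k l = 1" by (auto simp: ldist_def)
  then show ?thesis using ldist_le1 ldist_nonneg assms by smt
qed

lemma ldist_usc:
  assumes "h \<in> topspace sdom" "k \<in> topspace sdom" "tgt h = tgt k" "ldist h k < r"
  shows "\<exists>S T. openin sdom S \<and> openin sdom T \<and> h \<in> S \<and> k \<in> T \<and>
        (\<forall>h'\<in>S. \<forall>k'\<in>T. tgt h' = tgt k' \<longrightarrow> ldist h' k' < r)"
proof -
  have M: "h \<in> Mor G" "k \<in> Mor G" using assms topspace_sdom by auto
  have "iv h \<cdot> k \<in> {g \<in> restr U. \<rho> g < r}" using assms sdom_restr by (simp add: ldist_def)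
  then obtain A B where AB: "open_mor A" "open_mor B" "iv h \<in> A" "k \<in> B"
    "\<And>a b. a \<in> A \<Longrightarrow> b \<in> B \<Longrightarrow> src a = tgt b \<Longrightarrow> a \<cdot> b \<in> {g \<in> restr U. \<rho> g < r}"
    using mult_nbhd[of "iv h" k, OF _ _ _ rho_open[of r]] M assms by (auto simp: grp_simps)
  have opY: "openin sdom (S \<inter> topspace sdom)" if "open_mor S" for S
    using that openin_sdom openin_topspace by blast
  show ?thesis
  proof (intro exI conjI ballI impI)
    show "openin sdom ({g \<in> Mor G. iv g \<in> A} \<inter> topspace sdom)" using opY open_iv AB by blast
    show "openin sdom (B \<inter> topspace sdom)" using opY AB by blast
    show "h \<in> {g \<in> Mor G. iv g \<in> A} \<inter> topspace sdom" "k \<in> B \<inter> topspace sdom" using AB assms M by auto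
    fix h' k' assume hk: "h' \<in> {g \<in> Mor G. iv g \<in> A} \<inter> topspace sdom" "k' \<in> B \<inter> topspace sdom" "tgt h' = tgt k'"
    then have "src (iv h') = tgt k'" by (simp add: grp_simps)
    then show "ldist h' k' < r" using AB(5)[of "iv h'" k'] hk by (simp add: ldist_def)
  qed
qed

sublocale pre_metric_etale "obj_space G" sdom ldist tgt
proof
  show "continuous_map sdom (obj_space G) tgt"
    unfolding sdom_def using target_continuous continuous_map_from_subtopology by blast
  show "open_map sdom (obj_space G) tgt"
    using target_open openin_sdom by (auto simp: open_map_def)
  show "ldist h h = 0" if "h \<in> topspace sdom" for h
    using that rho_unit by (simp add: ldist_def topspace_sdom grp_simps)
  show "ldist h k = ldist k h" if "h \<in> topspace sdom" "k \<in> topspace sdom" for h k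
    using rho_inv[OF sdom_restr, of h k] inv_diff[of h k] that by (auto simp: ldist_def topspace_sdom)
  show "ldist h k \<le> 1" if "h \<in> topspace sdom" "k \<in> topspace sdom" for h k
    using ldist_le1 that .
  show "ldist h l \<le> ldist h k + ldist k l" if "h \<in> topspace sdom" "k \<in> topspace sdom" "l \<in> topspace sdom" for h k l
    using ldist_tri that .
  show "ldist h k = 1" if "tgt h \<noteq> tgt k" for h k
    using that by (simp add: ldist_def)
qed (rule ldist_usc)

lemma embed_apply: "h \<in> topspace sdom \<Longrightarrow> k \<in> topspace sdom \<Longrightarrow> embed h k = ldist h k"
  by (simp add: embed_def)

lemma sdom_mul: "g \<in> Mor G \<Longrightarrow> h \<in> topspace sdom \<Longrightarrow> tgt h = src g \<Longrightarrow> g \<cdot> h \<in> topspace sdom"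
  by (simp add: topspace_sdom grp_simps)

lemma sdom_Mor: "h \<in> topspace sdom \<Longrightarrow> h \<in> Mor G"
  by (simp add: topspace_sdom)

lemma act_eval:
  assumes "g \<in> Mor G" "k \<in> topspace sdom" "tgt k = src g"
  shows "act g f (g \<cdot> k) = f k"
  using assms sdom_mul[OF assms] sdom_Mor[OF assms(2)] cancel_inv[of g k] by (simp add: act_def grp_simps)

lemma ldist_mul:
  assumes "g \<in> Mor G" "h \<in> topspace sdom" "k \<in> topspace sdom" "tgt h = src g" "tgt k = src g"
  shows "ldist (g \<cdot> h) (g \<cdot> k) = ldist h k"
proof -
  have M: "h \<in> Mor G" "k \<in> Mor G" using assms sdom_Mor by blast+
  have "iv (g \<cdot> h) \<cdot> (g \<cdot> k) = iv h \<cdot> k"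
    by (rule inv_mul_translate[OF assms(1) M]) (simp_all add: assms)
  moreover have "tgt (g \<cdot> h) = tgt g" "tgt (g \<cdot> k) = tgt g"
    using tgt_mul[OF assms(1) M(1)] tgt_mul[OF assms(1) M(2)] assms by simp_all
  ultimately show ?thesis using assms by (simp add: ldist_def)
qed

lemma sdom_act_cases:
  assumes "g \<in> Mor G" "h \<in> topspace sdom" "tgt h = tgt g"
  shows "iv g \<cdot> h \<in> topspace sdom" "tgt (iv g \<cdot> h) = src g" "g \<cdot> (iv g \<cdot> h) = h"
  using assms cancel_inv'[of g h] by (simp_all add: topspace_sdom grp_simps)

lemma act_in:
  assumes g: "g \<in> Mor G" and f: "f \<in> Compl" "cproj f = src g"
  shows "act g f \<in> Compl" "cproj (act g f) = tgt g"
proof -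
  have out: "f h = 1" if "h \<in> topspace sdom" "tgt h \<noteq> src g" for h using cproj_neq[OF f(1) that(1)] f(2) that by simp
  have ldist_iv: "ldist (iv g \<cdot> h) (iv g \<cdot> k) = ldist h k"
    if "h \<in> topspace sdom" "k \<in> topspace sdom" "tgt h = tgt g" "tgt k = tgt g" for h k
    using ldist_mul[of g "iv g \<cdot> h" "iv g \<cdot> k"] sdom_act_cases g that by simp
  have *: "act g f h \<le> act g f k + ldist h k \<and> ldist h k \<le> act g f h + act g f k"
    if hk: "h \<in> topspace sdom" "k \<in> topspace sdom" for h k
  proof (cases "tgt h = tgt k")
    case True
    show ?thesis
    proof (cases "tgt h = tgt g")
      case t: True
      then show ?thesis
        using Compl_lip[OF f(1), of "iv g \<cdot> h" "iv g \<cdot> k"] Compl_ge[OF f(1), of "iv g \<cdot> h" "iv g \<cdot> k"]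
          ldist_iv[of h k] sdom_act_cases(1)[OF g] hk True by (simp add: act_def)
    next
      case False
      then show ?thesis using hk True ldist_le1[OF hk] ldist_nonneg[OF hk] by (simp add: act_def)
    qed
  next
    case False
    then have "ldist h k = 1" by (simp add: ldist_def)
    moreover have "0 \<le> act g f l" "act g f l \<le> 1" for l
      using Compl_nonneg[OF f(1)] Compl_le1[OF f(1)] by (auto simp: act_def)
    moreover have "act g f h = 1 \<or> act g f k = 1" using False hk by (auto simp: act_def)
    ultimately show ?thesis by (smt (verit))
  qed
  have small: "\<exists>h\<in>topspace sdom. act g f h < e \<and> tgt h = tgt g" if "e > 0" for e
  proof -
    obtain h where "h \<in> topspace sdom" "f h < e" "tgt h = src g"
      using Compl_small_fiber[OF f(1) \<open>e > 0\<close>] f(2) by auto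
    then show ?thesis
      using act_eval[OF g] sdom_mul[OF g] sdom_Mor[of h] g by (intro bexI[of _ "g \<cdot> h"]) (auto simp: grp_simps)
  qed
  have "\<exists>h\<in>topspace sdom. act g f h < e" if "e > 0" for e
    using small[OF that] by blast
  moreover have "act g f h = 0" if "h \<notin> topspace sdom" for h
    using that by (simp add: act_def)
  ultimately show "act g f \<in> Compl"
    unfolding Compl_def using * by blast
  then show "cproj (act g f) = tgt g" using small[of 1] cproj_eq by auto
qed

lemma act_embed: assumes "g \<in> Mor G" "h \<in> topspace sdom" "tgt h = src g"
  shows "act g (embed h) = embed (g \<cdot> h)"
proof (rule Compl_cong)
  have h: "h \<in> Mor G" using assms sdom_Mor by blast
  show "act g (embed h) \<in> Compl" using act_in embed_in cproj_embed assms by simp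
  show "embed (g \<cdot> h) \<in> Compl" using embed_in sdom_mul assms by simp
  fix k assume k: "k \<in> topspace sdom"
  show "act g (embed h) k = embed (g \<cdot> h) k"
  proof (cases "tgt k = tgt g")
    case True
    then show ?thesis
      using ldist_mul[OF assms(1,2), of "iv g \<cdot> k"] sdom_act_cases[OF assms(1) k True] assms k sdom_mul
      by (simp add: embed_apply act_def)
  next
    case False
    then show ?thesis using k assms h by (auto simp: act_def embed_apply sdom_mul ldist_def grp_simps)
  qed
qed

lemma act_act:
  assumes "g \<in> Mor G" "g' \<in> Mor G" "src g = tgt g'"
  shows "act g (act g' f) = act (g \<cdot> g') f"
proof
  fix h
  show "act g (act g' f) h = act (g \<cdot> g') f h"
  proof (cases "h \<in> topspace sdom \<and> tgt h = tgt g")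
    case True
    then have "h \<in> Mor G" using sdom_Mor by blast
    then have "iv (g \<cdot> g') \<cdot> h = iv g' \<cdot> (iv g \<cdot> h)"
      using assms True assoc[of "iv g'" "iv g" h] by (simp add: inv_mul grp_simps)
    then show ?thesis using sdom_act_cases[OF assms(1), of h] True assms by (simp add: act_def grp_simps)
  qed (use assms in \<open>auto simp: act_def grp_simps\<close>)
qed

lemma act_unit: assumes "f \<in> Compl" shows "act (un (cproj f)) f = f"
proof
  fix h
  have x: "cproj f \<in> Obj G" using cproj_in assms by blast
  show "act (un (cproj f)) f h = f h"
  proof (cases "h \<in> topspace sdom \<and> tgt h = cproj f")
    case True
    then have "un (cproj f) \<cdot> h = h" using mult_unit_target[of h] sdom_Mor[of h] by simp
    then show ?thesis using True x by (simp add: act_def inv_unit target_unit)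
  next
    case False
    then show ?thesis
      using cproj_neq[OF assms, of h] Compl_out[OF assms, of h] x by (auto simp: act_def target_unit)
  qed
qed

lemma cdist_act_le:
  assumes g: "g \<in> Mor G" and f: "f \<in> Compl" "cproj f = src g" "f' \<in> Compl" "cproj f' = src g"
  shows "cdist (act g f) (act g f') \<le> cdist f f'"
proof (cases "cdist f f' < 1")
  case True
  show ?thesis
  proof (rule field_le_epsilon)
    fix e :: real assume "e > 0"
    then have "cdist f f' < min 1 (cdist f f' + e)" using True by simp
    then obtain h where h: "h \<in> topspace sdom" "f h + f' h < min 1 (cdist f f' + e)"
      using cdist_lt_iff[OF f(1,3)] by blast
    then have "f h < 1" using Compl_nonneg[OF f(3), of h] by simp
    then have t: "tgt h = src g" using cproj_eq[OF f(1) h(1)] f(2) by simp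
    have "cdist (act g f) (act g f') \<le> act g f (g \<cdot> h) + act g f' (g \<cdot> h)"
      using cdist_le act_in f g sdom_mul[OF g h(1) t] by blast
    then show "cdist (act g f) (act g f') \<le> cdist f f' + e" using act_eval[OF g h(1) t] h by simp
  qed
next
  case False then show ?thesis using cdist_le1[OF act_in(1)[OF g f(1,2)] act_in(1)[OF g f(3,4)]] by simp
qed

lemma act_inv: assumes "g \<in> Mor G" "f \<in> Compl" "cproj f = src g" shows "act (iv g) (act g f) = f"
  using act_act[of "iv g" g f] act_unit[OF assms(2)] assms by (simp add: grp_simps)

lemma cdist_act:
  assumes g: "g \<in> Mor G" and f: "f \<in> Compl" "cproj f = src g" "f' \<in> Compl" "cproj f' = src g"
  shows "cdist (act g f) (act g f') = cdist f f'"
  using cdist_act_le[OF assms] cdist_act_le[of "iv g" "act g f" "act g f'"] act_in[OF g f(1,2)] act_in[OF g f(3,4)]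
    act_inv[OF g f(1,2)] act_inv[OF g f(3,4)] g by (simp add: grp_simps)

text \<open>
Together with \<open>ldist_continuous\<close> this says that \<open>ldist\<close> induces the topology of \<open>G\<close> on each target fibre.
\<close>
lemma ldist_small_imp:
  assumes "h \<in> topspace sdom" "open_mor Q" "h \<in> Q"
  shows "\<exists>r. 0 < r \<and> r \<le> 1 \<and> (\<forall>k\<in>topspace sdom. ldist h k < r \<longrightarrow> k \<in> Q)"
proof -
  have h: "h \<in> Mor G" "src h \<in> U" "src h \<in> Obj G" using assms topspace_sdom by (auto simp: grp_simps)
  obtain A B where AB: "open_mor A" "open_mor B" "h \<in> A" "un (src h) \<in> B"
    "\<And>a b. a \<in> A \<Longrightarrow> b \<in> B \<Longrightarrow> src a = tgt b \<Longrightarrow> a \<cdot> b \<in> Q"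
    using mult_nbhd[of h "un (src h)" Q] h assms by (auto simp: grp_simps)
  obtain Y r where Y: "open_obj Y" "src h \<in> Y" "r > 0" "{g \<in> restr U. \<rho> g < r \<and> tgt g \<in> Y} \<subseteq> B"
    using rho_base[OF h(2) AB(2,4)] by blast
  have "k \<in> Q" if k: "k \<in> topspace sdom" "ldist h k < min r 1" for k
  proof -
    have t: "tgt h = tgt k" using k by (auto simp: ldist_def split: if_splits)
    then have "iv h \<cdot> k \<in> restr U" "\<rho> (iv h \<cdot> k) < r" using k sdom_restr assms by (auto simp: ldist_def)
    moreover have M: "k \<in> Mor G" "tgt (iv h \<cdot> k) = src h" using k h t sdom_Mor by (simp_all add: grp_simps)
    ultimately have "iv h \<cdot> k \<in> B" using Y by auto
    then have "h \<cdot> (iv h \<cdot> k) \<in> Q" using AB(5)[OF AB(3)] M by simp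
    then show ?thesis using cancel_inv'[OF h(1) M(1) t] by simp
  qed
  then show ?thesis using Y by (intro exI[of _ "min r 1"]) auto
qed

lemma ldist_continuous:
  assumes "h \<in> topspace sdom" "r > 0"
  shows "\<exists>S. open_mor S \<and> h \<in> S \<and> (\<forall>k\<in>S. k \<in> topspace sdom \<and> (tgt k = tgt h \<longrightarrow> ldist h k < r))"
proof -
  obtain S T where S: "openin sdom S" "openin sdom T" "h \<in> S" "h \<in> T"
      "\<forall>h'\<in>S. \<forall>k'\<in>T. tgt h' = tgt k' \<longrightarrow> ldist h' k' < r"
    using d_usc[of h h r] assms d_refl by auto
  then show ?thesis using openin_sdom by (intro exI[of _ T]) auto
qed

lemma nbhd_open: "open_mor S \<Longrightarrow> S \<subseteq> topspace sdom \<Longrightarrow> 0 < r \<Longrightarrow> r \<le> 1 \<Longrightarrow> openin ctop (nbhd S r)"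
  using openin_nbhd openin_sdom by blast

end

section \<open>The structure of a groupoid\<close>

text \<open>
The cover \<open>U i\<close> indexes the sorts and the base \<open>B n\<close> of the topology indexes the relations.
\<close>
locale groupoid_representation = open_topological_groupoid G
  for G :: "('o, 'g) groupoid_data" +
  fixes U :: "nat \<Rightarrow> 'o set" and \<rho> :: "nat \<Rightarrow> 'g \<Rightarrow> real" and B :: "nat \<Rightarrow> 'g set"
  assumes norms: "normed_open G (U i) (\<rho> i)"
    and cover: "x \<in> Obj G \<Longrightarrow> \<exists>i. x \<in> U i"
    and B_open: "open_mor (B n)"
    and B_base: "open_mor Q \<Longrightarrow> g \<in> Q \<Longrightarrow> \<exists>n. g \<in> B n \<and> B n \<subseteq> Q"
    and locally_complete: "g \<in> Mor G \<Longrightarrow>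
      \<exists>Q. open_mor Q \<and> g \<in> Q \<and> completely_metrizable_space (subtopology (mor_space G) Q)"
begin

sublocale S: normed_open G "U i" "\<rho> i" for i by (rule norms)

definition rel_pairs :: "nat \<Rightarrow> nat \<Rightarrow> nat \<Rightarrow> ('g \<times> 'g) set" where
  "rel_pairs i j n = {(h, k). h \<in> topspace (S.sdom i) \<and> k \<in> topspace (S.sdom j) \<and> tgt h = tgt k \<and> iv h \<cdot> k \<in> B n}"

text \<open>
The distance of the pair \<open>(a, b)\<close> from \<open>rel_pairs i j n\<close> in the sum metric; the inserted value \<open>1\<close> is the
truncation and takes care of an empty set of pairs.
\<close>
definition rel_val :: "nat \<Rightarrow> nat \<Rightarrow> nat \<Rightarrow> ('g \<Rightarrow> real) \<Rightarrow> ('g \<Rightarrow> real) \<Rightarrow> real" where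
  "rel_val i j n a b = Inf (insert 1 ((\<lambda>(h, k). a h + b k) ` rel_pairs i j n))"

lemma rel_val_bdd: "a \<in> S.Compl i \<Longrightarrow> b \<in> S.Compl j \<Longrightarrow> bdd_below (insert 1 ((\<lambda>(h, k). a h + b k) ` rel_pairs i j n))"
  using S.Compl_nonneg[of a i] S.Compl_nonneg[of b j]
  by (intro bdd_belowI[of _ 0]) (auto intro: add_nonneg_nonneg)

lemma rel_val_lt_iff:
  assumes "a \<in> S.Compl i" "b \<in> S.Compl j"
  shows "rel_val i j n a b < t \<longleftrightarrow> 1 < t \<or> (\<exists>h k. (h, k) \<in> rel_pairs i j n \<and> a h + b k < t)"
  unfolding rel_val_def by (subst cInf_less_iff[OF _ rel_val_bdd[OF assms]]) auto

lemma rel_val_le1: "a \<in> S.Compl i \<Longrightarrow> b \<in> S.Compl j \<Longrightarrow> rel_val i j n a b \<le> 1"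
  using rel_val_lt_iff[of a i b j n "rel_val i j n a b"] by fastforce

lemma rel_val_le: "a \<in> S.Compl i \<Longrightarrow> b \<in> S.Compl j \<Longrightarrow> (h, k) \<in> rel_pairs i j n \<Longrightarrow> rel_val i j n a b \<le> a h + b k"
  using rel_val_lt_iff[of a i b j n "rel_val i j n a b"] by fastforce

lemma rel_val_nonneg: assumes "a \<in> S.Compl i" "b \<in> S.Compl j" shows "0 \<le> rel_val i j n a b"
proof -
  have "\<not> rel_val i j n a b < 0"
    unfolding rel_val_lt_iff[OF assms] using S.Compl_nonneg[OF assms(1)] S.Compl_nonneg[OF assms(2)]
    by (meson add_nonneg_nonneg not_less zero_less_one less_asym)
  then show ?thesis by simp
qed

lemma rel_val_lip_le:
  assumes "a \<in> S.Compl i" "b \<in> S.Compl j" "a' \<in> S.Compl i" "b' \<in> S.Compl j"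
  shows "rel_val i j n a b \<le> rel_val i j n a' b' + (S.cdist i a a' + S.cdist j b b')"
proof (rule field_le_epsilon)
  fix e :: real assume "e > 0"
  then have "rel_val i j n a' b' < rel_val i j n a' b' + e" by simp
  then consider "1 < rel_val i j n a' b' + e" | h k where "(h, k) \<in> rel_pairs i j n" "a' h + b' k < rel_val i j n a' b' + e"
    unfolding rel_val_lt_iff[OF assms(3,4)] by blast
  then show "rel_val i j n a b \<le> rel_val i j n a' b' + (S.cdist i a a' + S.cdist j b b') + e"
  proof cases
    case 1
    then show ?thesis
      using rel_val_le1[OF assms(1,2), of n] S.cdist_nonneg[of i a a'] S.cdist_nonneg[of j b b'] by linarith
  next
    case 2
    then show ?thesis
      using rel_val_le[OF assms(1,2) 2(1)] S.cdist_eval[OF assms(1,3), of h] S.cdist_eval[OF assms(2,4), of k] by linarith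
  qed
qed

lemma rel_val_act_le:
  assumes g: "g \<in> Mor G" and a: "a \<in> S.Compl i" "S.cproj i a = src g" and b: "b \<in> S.Compl j" "S.cproj j b = src g"
  shows "rel_val i j n (S.act i g a) (S.act j g b) \<le> rel_val i j n a b"
proof (rule ccontr)
  assume "\<not> ?thesis"
  then have lt: "rel_val i j n a b < rel_val i j n (S.act i g a) (S.act j g b)" by simp
  have in': "S.act i g a \<in> S.Compl i" "S.act j g b \<in> S.Compl j" using S.act_in g a b by blast+
  have le1: "rel_val i j n (S.act i g a) (S.act j g b) \<le> 1" using rel_val_le1 in' by blast
  obtain h k where hk: "(h, k) \<in> rel_pairs i j n" "a h + b k < rel_val i j n (S.act i g a) (S.act j g b)"
    using lt le1 rel_val_lt_iff[OF a(1) b(1)] by fastforce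
  then have Y: "h \<in> topspace (S.sdom i)" "k \<in> topspace (S.sdom j)" "tgt h = tgt k" "iv h \<cdot> k \<in> B n"
    by (auto simp: rel_pairs_def)
  have "a h < 1" using hk le1 S.Compl_nonneg[OF b(1), of k] by linarith
  then have t: "tgt h = src g" "tgt k = src g" using S.cproj_eq[OF a(1) Y(1)] a(2) Y(3) by simp_all
  have M: "h \<in> Mor G" "k \<in> Mor G" using Y S.sdom_Mor by blast+
  have "iv (g \<cdot> h) \<cdot> (g \<cdot> k) = iv h \<cdot> k" by (rule inv_mul_translate[OF g M]) (simp_all add: t)
  moreover have "tgt (g \<cdot> h) = tgt (g \<cdot> k)"
    using tgt_mul[OF g M(1)] tgt_mul[OF g M(2)] t by simp
  ultimately have "(g \<cdot> h, g \<cdot> k) \<in> rel_pairs i j n"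
    using Y S.sdom_mul[OF g Y(1) t(1)] S.sdom_mul[OF g Y(2) t(2)] by (simp add: rel_pairs_def)
  then have "rel_val i j n (S.act i g a) (S.act j g b) \<le> S.act i g a (g \<cdot> h) + S.act j g b (g \<cdot> k)"
    using rel_val_le in' by blast
  then show False using S.act_eval[OF g Y(1) t(1), of a] S.act_eval[OF g Y(2) t(2), of b] hk by simp
qed

lemma rel_val_act:
  assumes g: "g \<in> Mor G" and a: "a \<in> S.Compl i" "S.cproj i a = src g" and b: "b \<in> S.Compl j" "S.cproj j b = src g"
  shows "rel_val i j n (S.act i g a) (S.act j g b) = rel_val i j n a b"
proof (rule antisym[OF rel_val_act_le[OF assms]])
  have "S.act i (iv g) (S.act i g a) = a" "S.act j (iv g) (S.act j g b) = b"
    using S.act_inv g a b by blast+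
  then show "rel_val i j n a b \<le> rel_val i j n (S.act i g a) (S.act j g b)"
    using rel_val_act_le[of "iv g" "S.act i g a" i "S.act j g b" j n] S.act_in[OF g a] S.act_in[OF g b] g
    by (simp add: grp_simps)
qed

definition ri where "ri R = fst (prod_decode R)"
definition rj where "rj R = fst (prod_decode (snd (prod_decode R)))"
definition rn where "rn R = snd (prod_decode (snd (prod_decode R)))"

lemma rel_index: "\<exists>R. ri R = i \<and> rj R = j \<and> rn R = n"
  by (intro exI[of _ "prod_encode (i, prod_encode (j, n))"]) (simp add: ri_def rj_def rn_def)

definition lang :: "(nat, nat) language" where
  "lang = \<lparr>sorts = UNIV, rels = UNIV, arity = (\<lambda>R. [ri R, rj R])\<rparr>"

definition lstr :: "(nat, nat, 'o, 'g \<Rightarrow> real) metric_etale_data" where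
  "lstr = \<lparr>sort_space = S.ctop, sort_dist = S.cdist, sort_proj = S.cproj,
     rel_interp = (\<lambda>R (x, a). rel_val (ri R) (rj R) (rn R) (a 0) (a 1))\<rparr>"

lemma lang_simps [simp]: "sorts lang = UNIV" "rels lang = UNIV" "arity lang R = [ri R, rj R]"
  by (simp_all add: lang_def)

lemma lstr_simps [simp]: "sort_space lstr = S.ctop" "sort_dist lstr = S.cdist" "sort_proj lstr = S.cproj"
  "rel_interp lstr R (x, a) = rel_val (ri R) (rj R) (rn R) (a 0) (a 1)"
  by (simp_all add: lstr_def)

lemma less_2_iff: "i < Suc (Suc 0) \<longleftrightarrow> i = 0 \<or> i = Suc 0" by auto

lemma rel_domain_iff: "(x, a) \<in> topspace (rel_domain lang (obj_space G) lstr R) \<longleftrightarrow>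
   x \<in> Obj G \<and> a \<in> extensional {..<2} \<and> a 0 \<in> S.Compl (ri R) \<and> a 1 \<in> S.Compl (rj R) \<and>
   S.cproj (ri R) (a 0) = x \<and> S.cproj (rj R) (a 1) = x"
  unfolding rel_domain_def fiber_product_def
  by (auto simp: PiE_iff less_2_iff numeral_2_eq_2 lessThan_Suc)

lemma rel_proj_continuous:
  "continuous_map (rel_domain lang (obj_space G) lstr R) (S.ctop (ri R)) (\<lambda>z. snd z 0)"
  "continuous_map (rel_domain lang (obj_space G) lstr R) (S.ctop (rj R)) (\<lambda>z. snd z 1)"
proof -
  let ?A = "\<lambda>i. S.ctop ([ri R, rj R] ! i)"
  have *: "continuous_map (rel_domain lang (obj_space G) lstr R) (?A i) (\<lambda>z. snd z i)" if "i < 2" for i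
  proof -
    have "continuous_map (prod_topology (obj_space G) (product_topology ?A {..<2})) (?A i) ((\<lambda>a. a i) \<circ> snd)"
      using that by (intro continuous_map_compose[OF continuous_map_snd] continuous_map_product_projection) simp
    then show ?thesis
      unfolding rel_domain_def fiber_product_def
      by (intro continuous_map_from_subtopology) (simp add: o_def numeral_2_eq_2)
  qed
  show "continuous_map (rel_domain lang (obj_space G) lstr R) (S.ctop (ri R)) (\<lambda>z. snd z 0)"
    using *[of 0] by simp
  show "continuous_map (rel_domain lang (obj_space G) lstr R) (S.ctop (rj R)) (\<lambda>z. snd z 1)"
    using *[of 1] by simp
qed

text \<open>
As \<open>h\<inverse> \<cdot> k\<close> depends continuously on \<open>h\<close> and \<open>k\<close>, a pair that witnesses a small value can be replaced by
two open sets of arrows, and neighbourhoods of these sets in the completions serve for all nearby pairs.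
\<close>
lemma rel_usc: "usc_on (rel_domain lang (obj_space G) lstr R) (rel_interp lstr R)"
  unfolding usc_on_def
proof
  fix r
  let ?Dom = "rel_domain lang (obj_space G) lstr R"
  let ?i = "ri R" and ?j = "rj R" and ?n = "rn R"
  let ?W = "{z \<in> topspace ?Dom. rel_interp lstr R z < r}"
  show "openin ?Dom ?W"
  proof (subst openin_subopen, intro ballI)
    fix z assume z: "z \<in> ?W"
    obtain x a where za: "z = (x, a)" by force
    then have dom: "(x, a) \<in> topspace ?Dom" and lt: "rel_val ?i ?j ?n (a 0) (a 1) < r" using z by auto
    then have a: "a 0 \<in> S.Compl ?i" "a 1 \<in> S.Compl ?j" using rel_domain_iff by blast+
    consider "1 < r" | h k where "r \<le> 1" "(h, k) \<in> rel_pairs ?i ?j ?n" "a 0 h + a 1 k < r"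
      using lt rel_val_lt_iff[OF a] by fastforce
    then show "\<exists>T. openin ?Dom T \<and> z \<in> T \<and> T \<subseteq> ?W"
    proof cases
      case 1
      have "rel_interp lstr R w < r" if w: "w \<in> topspace ?Dom" for w
      proof -
        obtain y b where wy: "w = (y, b)" by force
        then have "b 0 \<in> S.Compl ?i" "b 1 \<in> S.Compl ?j" using w rel_domain_iff by blast+
        then show ?thesis using rel_val_le1[of "b 0" ?i "b 1" ?j ?n] 1 wy by simp
      qed
      then have "?W = topspace ?Dom" by blast
      then have "openin ?Dom ?W" by (metis openin_topspace)
      then show ?thesis using z by blast
    next
      case 2
      have hk: "h \<in> topspace (S.sdom ?i)" "k \<in> topspace (S.sdom ?j)" "tgt h = tgt k" "iv h \<cdot> k \<in> B ?n"
        using 2 by (auto simp: rel_pairs_def)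
      have M: "h \<in> Mor G" "k \<in> Mor G" using hk S.sdom_Mor by blast+
      obtain A C where AC: "open_mor A" "open_mor C" "iv h \<in> A" "k \<in> C"
        "\<And>a b. a \<in> A \<Longrightarrow> b \<in> C \<Longrightarrow> src a = tgt b \<Longrightarrow> a \<cdot> b \<in> B ?n"
        by (rule mult_nbhd[of "iv h" k "B ?n"]) (use M hk B_open in \<open>auto simp: grp_simps\<close>)
      define e where "e = (r - (a 0 h + a 1 k)) / 2"
      define s t where "s = a 0 h + e" and "t = a 1 k + e"
      have e: "e > 0" "s + t = r" using 2 by (auto simp: e_def s_def t_def field_simps)
      have st: "0 < s" "s \<le> 1" "0 < t" "t \<le> 1"
        using e 2(1) S.Compl_nonneg[OF a(1), of h] S.Compl_nonneg[OF a(2), of k]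
        unfolding s_def t_def by linarith+
      let ?S = "{g \<in> Mor G. iv g \<in> A} \<inter> topspace (S.sdom ?i)" and ?T = "C \<inter> topspace (S.sdom ?j)"
      have oY: "open_mor (topspace (S.sdom i))" for i
        using S.openin_sdom openin_topspace by blast
      have oN: "openin (S.ctop ?i) (S.nbhd ?i ?S s)" "openin (S.ctop ?j) (S.nbhd ?j ?T t)"
        using st open_iv[OF AC(1)] AC(2) oY by (auto intro!: S.nbhd_open)
      let ?V = "{z \<in> topspace ?Dom. snd z 0 \<in> S.nbhd ?i ?S s} \<inter> {z \<in> topspace ?Dom. snd z 1 \<in> S.nbhd ?j ?T t}"
      have "openin ?Dom ?V"
        by (intro openin_Int openin_continuous_map_preimage[OF rel_proj_continuous(1) oN(1)]
            openin_continuous_map_preimage[OF rel_proj_continuous(2) oN(2)])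
      moreover have "z \<in> ?V"
      proof -
        have "a 0 h < s" "a 1 k < t" using e by (auto simp: s_def t_def)
        then have "a 0 \<in> S.nbhd ?i ?S s" "a 1 \<in> S.nbhd ?j ?T t"
          unfolding S.nbhd_def using a hk AC(3,4) M by blast+
        then show ?thesis using za dom by simp
      qed
      moreover have "?V \<subseteq> ?W"
      proof
        fix w assume w: "w \<in> ?V"
        obtain y b where wy: "w = (y, b)" by force
        then have b: "(y, b) \<in> topspace ?Dom" "b 0 \<in> S.nbhd ?i ?S s" "b 1 \<in> S.nbhd ?j ?T t" using w by auto
        then obtain h' k' where h': "h' \<in> ?S" "b 0 h' < s" and k': "k' \<in> ?T" "b 1 k' < t"
          unfolding S.nbhd_def by blast
        have bC: "b 0 \<in> S.Compl ?i" "b 1 \<in> S.Compl ?j" "S.cproj ?i (b 0) = y" "S.cproj ?j (b 1) = y"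
          using b rel_domain_iff by blast+
        have "tgt h' = tgt k'"
          using S.cproj_eq[OF bC(1), of h'] S.cproj_eq[OF bC(2), of k'] h' k' st bC by simp
        moreover have "h' \<in> Mor G" using h' by simp
        ultimately have "iv h' \<cdot> k' \<in> B ?n" using AC(5)[of "iv h'" k'] h' k' by (simp add: grp_simps)
        then have "(h', k') \<in> rel_pairs ?i ?j ?n" using h' k' \<open>tgt h' = tgt k'\<close> by (simp add: rel_pairs_def)
        then have "rel_val ?i ?j ?n (b 0) (b 1) < r"
          using rel_val_le[OF bC(1,2), of h' k' ?n] h' k' e by linarith
        then show "w \<in> ?W" using b wy by simp
      qed
      ultimately show ?thesis by blast
    qed
  qed
qed

lemma lstr_metric_etale: "metric_etale_structure lang (obj_space G) lstr"
  unfolding metric_etale_structure_def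
proof (intro conjI ballI allI impI)
  show "language_wf lang" by (simp add: language_wf_def)
  show "metric_etale_space (obj_space G) (sort_space lstr P) (sort_dist lstr P) (sort_proj lstr P)" for P
    using S.metric_etale_ctop by simp
  fix R
  show "rel_interp lstr R \<in> topspace (rel_domain lang (obj_space G) lstr R) \<rightarrow> {0..1}"
  proof
    fix z assume z: "z \<in> topspace (rel_domain lang (obj_space G) lstr R)"
    obtain y b where wy: "z = (y, b)" by force
    then have "b 0 \<in> S.Compl (ri R)" "b 1 \<in> S.Compl (rj R)" using z rel_domain_iff by blast+
    then show "rel_interp lstr R z \<in> {0..1}"
      using rel_val_le1[of "b 0" "ri R" "b 1" "rj R" "rn R"] rel_val_nonneg[of "b 0" "ri R" "b 1" "rj R" "rn R"] wy by simp
  qed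
  show "usc_on (rel_domain lang (obj_space G) lstr R) (rel_interp lstr R)" by (rule rel_usc)
  fix x a b
  assume "(x, a) \<in> topspace (rel_domain lang (obj_space G) lstr R)"
    "(x, b) \<in> topspace (rel_domain lang (obj_space G) lstr R)"
  then have C: "a 0 \<in> S.Compl (ri R)" "a 1 \<in> S.Compl (rj R)" "b 0 \<in> S.Compl (ri R)" "b 1 \<in> S.Compl (rj R)"
    using rel_domain_iff by blast+
  have "\<bar>rel_val (ri R) (rj R) (rn R) (a 0) (a 1) - rel_val (ri R) (rj R) (rn R) (b 0) (b 1)\<bar>
     \<le> S.cdist (ri R) (a 0) (b 0) + S.cdist (rj R) (a 1) (b 1)"
    using rel_val_lip_le[OF C, of "rn R"] rel_val_lip_le[OF C(3,4) C(1,2), of "rn R"]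
      S.cdist_sym[of "ri R" "a 0" "b 0"] S.cdist_sym[of "rj R" "a 1" "b 1"] by (simp add: abs_le_iff)
  moreover have "\<bar>rel_val (ri R) (rj R) (rn R) (a 0) (a 1) - rel_val (ri R) (rj R) (rn R) (b 0) (b 1)\<bar> \<le> 1"
    using rel_val_le1[OF C(1,2), of "rn R"] rel_val_le1[OF C(3,4), of "rn R"]
      rel_val_nonneg[OF C(1,2), of "rn R"] rel_val_nonneg[OF C(3,4), of "rn R"] by (simp add: abs_le_iff)
  ultimately show "\<bar>rel_interp lstr R (x, a) - rel_interp lstr R (x, b)\<bar>
             \<le> min 1 (\<Sum>i<length (arity lang R). sort_dist lstr (arity lang R ! i) (a i) (b i))"
    by simp
qed

lemma fiber_lstr: "fiber lstr i x = {a \<in> S.Compl i. S.cproj i a = x}"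
  by (simp add: fiber_def)

definition Phi :: "'g \<Rightarrow> 'o \<times> 'o \<times> (nat \<Rightarrow> ('g \<Rightarrow> real) \<Rightarrow> 'g \<Rightarrow> real)" where
  "Phi g = (src g, tgt g, \<lambda>i. \<lambda>a\<in>fiber lstr i (src g). S.act i g a)"

lemma act_fiber: "g \<in> Mor G \<Longrightarrow> a \<in> fiber lstr i (src g) \<Longrightarrow> S.act i g a \<in> fiber lstr i (tgt g)"
  using S.act_in by (simp add: fiber_lstr)

lemma Phi_in: assumes g: "g \<in> Mor G" shows "Phi g \<in> Iso_mor lang (obj_space G) lstr"
proof -
  let ?f = "\<lambda>i. \<lambda>a\<in>fiber lstr i (src g). S.act i g a"
  have bij: "bij_betw (?f P) (fiber lstr P (src g)) (fiber lstr P (tgt g))" for P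
  proof (rule bij_betwI[where g = "S.act P (iv g)"])
    show "?f P \<in> fiber lstr P (src g) \<rightarrow> fiber lstr P (tgt g)" using act_fiber[OF g] by simp
    show "S.act P (iv g) \<in> fiber lstr P (tgt g) \<rightarrow> fiber lstr P (src g)"
      using act_fiber[of "iv g"] g by (simp add: grp_simps)
    show "S.act P (iv g) (?f P a) = a" if "a \<in> fiber lstr P (src g)" for a
      using that S.act_inv[OF g, of a P] by (simp add: fiber_lstr)
    show "?f P (S.act P (iv g) a) = a" if a: "a \<in> fiber lstr P (tgt g)" for a
    proof -
      have "S.act P (iv g) a \<in> fiber lstr P (src g)" using act_fiber[of "iv g" a P] a g by (simp add: grp_simps)
      moreover have "S.act P (iv (iv g)) (S.act P (iv g) a) = a"
        using S.act_inv[of "iv g" a P] a g by (simp add: fiber_lstr grp_simps)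
      ultimately show ?thesis using inv_inv[OF g] by simp
    qed
  qed
  have rel: "rel_interp lstr R (tgt g, \<lambda>i\<in>{..<length (arity lang R)}. ?f (arity lang R ! i) (a i))
             = rel_interp lstr R (src g, a)"
    if a: "(src g, a) \<in> topspace (rel_domain lang (obj_space G) lstr R)" for R a
  proof -
    have C: "a 0 \<in> S.Compl (ri R)" "S.cproj (ri R) (a 0) = src g" "a 1 \<in> S.Compl (rj R)" "S.cproj (rj R) (a 1) = src g"
      using a rel_domain_iff by blast+
    then show ?thesis using rel_val_act[OF g C, of "rn R"] by (simp add: fiber_lstr)
  qed
  have "?f \<in> fiber_isos lang (obj_space G) lstr (src g) (tgt g)"
    unfolding fiber_isos_def
  proof (intro CollectI conjI ballI allI impI)
    show "?f \<in> extensional (sorts lang)" by (simp add: extensional_def)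
    fix P
    show "?f P \<in> extensional (fiber lstr P (src g))" by simp
    show "bij_betw (?f P) (fiber lstr P (src g)) (fiber lstr P (tgt g))" by (rule bij)
    show "sort_dist lstr P (?f P a) (?f P b) = sort_dist lstr P a b"
      if "a \<in> fiber lstr P (src g)" "b \<in> fiber lstr P (src g)" for a b
      using that S.cdist_act[OF g, of a P b] by (simp add: fiber_lstr)
  qed (rule rel)
  then show ?thesis
    unfolding Phi_def Iso_mor_def using g by (simp add: grp_simps)
qed

lemma Phi_unit: "x \<in> Obj G \<Longrightarrow> Phi (un x) = unit_mor (Iso_groupoid lang (obj_space G) lstr) x"
  using S.act_unit by (auto simp: Phi_def Iso_groupoid_def grp_simps fiber_lstr fun_eq_iff restrict_def)

lemma Phi_mult:
  assumes "g \<in> Mor G" "h \<in> Mor G" "src g = tgt h"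
  shows "Phi (g \<cdot> h) = mult (Iso_groupoid lang (obj_space G) lstr) (Phi g) (Phi h)"
proof -
  have "(\<lambda>i. \<lambda>a\<in>fiber lstr i (src h). S.act i (g \<cdot> h) a) =
    (\<lambda>i. compose (fiber lstr i (src h)) (\<lambda>a\<in>fiber lstr i (src g). S.act i g a) (\<lambda>a\<in>fiber lstr i (src h). S.act i h a))"
  proof (intro ext)
    fix i a k
    show "(\<lambda>a\<in>fiber lstr i (src h). S.act i (g \<cdot> h) a) a k =
      compose (fiber lstr i (src h)) (\<lambda>a\<in>fiber lstr i (src g). S.act i g a) (\<lambda>a\<in>fiber lstr i (src h). S.act i h a) a k"
    proof (cases "a \<in> fiber lstr i (src h)")
      case True
      then have "S.act i h a \<in> fiber lstr i (src g)" using act_fiber[OF assms(2) True] assms by simp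
      then show ?thesis using True S.act_act[OF assms, of i a] by (simp add: compose_def)
    qed (simp add: compose_def)
  qed
  then show ?thesis
    using assms by (simp add: Phi_def Iso_groupoid_def grp_simps restrict_def)
qed

section \<open>Left translation is a homeomorphism onto the isomorphism groupoid\<close>

text \<open>
The set is the product of an open set with the inverse of an open set: \<open>g\<close> moves a point of \<open>S\<close> into \<open>T\<close> if
and only if it moves an embedded arrow \<open>w\<close> from \<open>S\<close> into \<open>T\<close>, and then \<open>g = (g \<cdot> w) \<cdot> w\<inverse>\<close>.
\<close>
lemma moves_open:
  assumes S: "openin (S.ctop i) S" and T: "openin (S.ctop i) T"
  shows "open_mor {g \<in> Mor G. \<exists>a\<in>S \<inter> fiber lstr i (src g). S.act i g a \<in> T}"
proof -
  let ?So = "{w \<in> topspace (S.sdom i). S.embed i w \<in> S}" and ?To = "{w \<in> topspace (S.sdom i). S.embed i w \<in> T}"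
  have o: "open_mor ?So" "open_mor ?To"
    using S.embed_open[OF S] S.embed_open[OF T] S.openin_sdom by blast+
  let ?P = "{g. \<exists>a\<in>?To. \<exists>b\<in>{g \<in> Mor G. iv g \<in> ?So}. src a = tgt b \<and> g = a \<cdot> b}"
  have "{g \<in> Mor G. \<exists>a\<in>S \<inter> fiber lstr i (src g). S.act i g a \<in> T} = ?P"
  proof (intro equalityI subsetI)
    fix g assume "g \<in> {g \<in> Mor G. \<exists>a\<in>S \<inter> fiber lstr i (src g). S.act i g a \<in> T}"
    then obtain a where g: "g \<in> Mor G" and a: "a \<in> S" "a \<in> S.Compl i" "S.cproj i a = src g" "S.act i g a \<in> T"
      by (auto simp: fiber_lstr)
    obtain e1 where e1: "e1 > 0" "\<forall>w\<in>topspace (S.sdom i). a w < e1 \<longrightarrow> S.embed i w \<in> S"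
      using S.embed_near[OF S a(1)] by blast
    obtain e2 where e2: "e2 > 0" "\<forall>w\<in>topspace (S.sdom i). S.act i g a w < e2 \<longrightarrow> S.embed i w \<in> T"
      using S.embed_near[OF T a(4)] by blast
    obtain w where w: "w \<in> topspace (S.sdom i)" "a w < min e1 e2" "tgt w = S.cproj i a"
      using S.Compl_small_fiber[OF a(2), of "min e1 e2"] e1(1) e2(1) by auto
    have tw: "tgt w = src g" and M: "w \<in> Mor G" using w(3) a(3) S.sdom_Mor[OF w(1)] by simp_all
    have "S.act i g a (g \<cdot> w) < e2" using S.act_eval[OF g w(1) tw, of a] w(2) by simp
    then have "g \<cdot> w \<in> ?To" using e2 S.sdom_mul[OF g w(1) tw] by simp
    moreover have "iv w \<in> {g \<in> Mor G. iv g \<in> ?So}" using M inv_inv[OF M] w e1 by (simp add: grp_simps)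
    moreover have "g = g \<cdot> w \<cdot> iv w" using cancel_inv_right[OF g M] tw by simp
    moreover have "src (g \<cdot> w) = tgt (iv w)" using src_mul[OF g M] target_inv[OF M] tw by simp
    ultimately show "g \<in> ?P" by blast
  next
    fix g assume "g \<in> ?P"
    then obtain a b where ab: "a \<in> ?To" "b \<in> Mor G" "iv b \<in> ?So" "src a = tgt b" "g = a \<cdot> b" by blast
    have M: "a \<in> Mor G" "b \<in> Mor G" using ab S.sdom_Mor by blast+
    have gM: "g \<in> Mor G" "src g = src b" using ab M by (simp_all add: grp_simps)
    have ib: "iv b \<in> topspace (S.sdom i)" "tgt (iv b) = src g" using ab M gM by (simp_all add: grp_simps)
    have "S.act i g (S.embed i (iv b)) = S.embed i (g \<cdot> iv b)" using S.act_embed[OF gM(1) ib] .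
    also have "g \<cdot> iv b = a" using cancel_inv_right[OF M ab(4)] ab(5) by simp
    finally have "S.act i g (S.embed i (iv b)) \<in> T" using ab by simp
    moreover have "S.embed i (iv b) \<in> S \<inter> fiber lstr i (src g)"
      using ab S.embed_in[OF ib(1)] S.cproj_embed[OF ib(1)] ib(2) by (simp add: fiber_lstr)
    ultimately show "g \<in> {g \<in> Mor G. \<exists>a\<in>S \<inter> fiber lstr i (src g). S.act i g a \<in> T}" using gM by blast
  qed
  moreover have "open_mor ?P" using open_prod[OF o(2) open_iv[OF o(1)]] .
  ultimately show ?thesis by simp
qed

lemma Phi_moves:
  assumes g: "g \<in> Mor G"
  shows "Phi g \<in> {(x, y, f) \<in> Iso_mor lang (obj_space G) lstr. f i ` (S \<inter> fiber lstr i x) \<inter> (T \<inter> fiber lstr i y) \<noteq> {}} \<longleftrightarrow>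
    (\<exists>a\<in>S \<inter> fiber lstr i (src g). S.act i g a \<in> T)"
proof -
  have "(\<lambda>a\<in>fiber lstr i (src g). S.act i g a) ` (S \<inter> fiber lstr i (src g)) = S.act i g ` (S \<inter> fiber lstr i (src g))"
    by (intro image_cong) auto
  moreover have "S.act i g ` (S \<inter> fiber lstr i (src g)) \<subseteq> fiber lstr i (tgt g)"
    using act_fiber[OF g] by blast
  ultimately have "(\<lambda>a\<in>fiber lstr i (src g). S.act i g a) ` (S \<inter> fiber lstr i (src g)) \<inter> (T \<inter> fiber lstr i (tgt g)) \<noteq> {} \<longleftrightarrow>
    (\<exists>a\<in>S \<inter> fiber lstr i (src g). S.act i g a \<in> T)" by auto
  then show ?thesis using Phi_in[OF g] unfolding Phi_def by (simp only: mem_Collect_eq case_prod_conv simp_thms)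
qed

lemma Phi_continuous: "continuous_map (mor_space G) (Iso_topology lang (obj_space G) lstr) Phi"
  unfolding Iso_topology_def
proof (rule continuous_on_generated_topo)
  let ?\<S> = "{{(x, y, f) \<in> Iso_mor lang (obj_space G) lstr. x \<in> U} |U. open_obj U} \<union>
      {{(x, y, f) \<in> Iso_mor lang (obj_space G) lstr. y \<in> U} |U. open_obj U} \<union>
      {{(x, y, f) \<in> Iso_mor lang (obj_space G) lstr. f P ` (S \<inter> fiber lstr P x) \<inter> (T \<inter> fiber lstr P y) \<noteq> {}} |P S T.
         P \<in> sorts lang \<and> openin (sort_space lstr P) S \<and> openin (sort_space lstr P) T}"
  have "\<Union> ?\<S> = topspace (Iso_topology lang (obj_space G) lstr)"
    unfolding Iso_topology_def topology_generated_by_topspace by (rule refl)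
  then have "\<Union> ?\<S> = Iso_mor lang (obj_space G) lstr" unfolding topspace_Iso_topology .
  moreover have "Phi ` Mor G \<subseteq> Iso_mor lang (obj_space G) lstr" using Phi_in by blast
  ultimately show "Phi ` topspace (mor_space G) \<subseteq> \<Union> ?\<S>" by (simp only:)
  fix W assume "W \<in> ?\<S>"
  then consider V where "open_obj V" "W = {(x, y, f) \<in> Iso_mor lang (obj_space G) lstr. x \<in> V}"
    | V where "open_obj V" "W = {(x, y, f) \<in> Iso_mor lang (obj_space G) lstr. y \<in> V}"
    | P S T where "openin (S.ctop P) S" "openin (S.ctop P) T"
       "W = {(x, y, f) \<in> Iso_mor lang (obj_space G) lstr. f P ` (S \<inter> fiber lstr P x) \<inter> (T \<inter> fiber lstr P y) \<noteq> {}}"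
    by auto
  then show "open_mor (Phi -` W \<inter> topspace (mor_space G))"
  proof cases
    case 1
    have "Phi -` W \<inter> Mor G = {g \<in> Mor G. src g \<in> V}" using Phi_in 1 by (auto simp: Phi_def)
    then show ?thesis using open_src 1 by simp
  next
    case 2
    have "Phi -` W \<inter> Mor G = {g \<in> Mor G. tgt g \<in> V}" using Phi_in 2 by (auto simp: Phi_def)
    then show ?thesis using open_tgt 2 by simp
  next
    case 3
    have "Phi -` W \<inter> Mor G = {g \<in> Mor G. \<exists>a\<in>S \<inter> fiber lstr P (src g). S.act P g a \<in> T}"
    proof -
      have "Phi g \<in> W \<longleftrightarrow> (\<exists>a\<in>S \<inter> fiber lstr P (src g). S.act P g a \<in> T)" if "g \<in> Mor G" for g
        using Phi_moves[OF that, of P S T] 3(3) by (simp only:)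
      then show ?thesis by blast
    qed
    then show ?thesis using moves_open 3 by simp
  qed
qed

text \<open>
Let \<open>S\<close> and \<open>T\<close> be small neighbourhoods of the images of the unit \<open>u\<close> and of \<open>g\<close>.  If \<open>g'\<close> moves a point of
\<open>S\<close> into \<open>T\<close>, then there are arrows \<open>s\<close> near \<open>u\<close> and \<open>t\<close> near \<open>g\<close> such that \<open>t\<inverse> g' s\<close> has small
norm, so \<open>g' = t (t\<inverse> g' s) s\<inverse>\<close> is a product of an arrow near \<open>g\<close> with two arrows near \<open>u\<close>.
\<close>
lemma basic_neighbourhood:
  assumes Q: "open_mor Q" "g \<in> Q"
  shows "\<exists>i S T. openin (S.ctop i) S \<and> openin (S.ctop i) T \<and>
    (\<exists>a\<in>S \<inter> fiber lstr i (src g). S.act i g a \<in> T) \<and>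
    (\<forall>g'\<in>Mor G. (\<exists>a\<in>S \<inter> fiber lstr i (src g'). S.act i g' a \<in> T) \<longrightarrow> g' \<in> Q)"
proof -
  have g: "g \<in> Mor G" using Q openin_subset by blast
  then have x: "src g \<in> Obj G" by (simp add: grp_simps)
  define u where "u = un (src g)"
  have u: "u \<in> Mor G" "src u = src g" "tgt u = src g" "g \<cdot> u = g" "iv u = u"
    using x g by (simp_all add: u_def grp_simps inv_unit)
  obtain i where i: "src g \<in> U i" using cover x by blast
  obtain P C where PC: "open_mor P" "open_mor C" "g \<in> P" "u \<in> C"
    "\<And>a b. a \<in> P \<Longrightarrow> b \<in> C \<Longrightarrow> src a = tgt b \<Longrightarrow> a \<cdot> b \<in> Q"
    by (rule mult_nbhd[of g u Q]) (use g u Q in auto)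
  obtain T0 A where TA: "open_mor T0" "open_mor A" "g \<in> T0" "u \<in> A"
    "\<And>a b. a \<in> T0 \<Longrightarrow> b \<in> A \<Longrightarrow> src a = tgt b \<Longrightarrow> a \<cdot> b \<in> P"
    by (rule mult_nbhd[of g u P]) (use g u PC in auto)
  obtain Y r where Y: "open_obj Y" "src g \<in> Y" "r > 0"
    "{g \<in> restr (U i). \<rho> i g < r \<and> tgt g \<in> Y} \<subseteq> A"
    using S.rho_base[OF i TA(2)] TA(4) by (auto simp: u_def)
  define S' where "S' = {s \<in> Mor G. iv s \<in> C} \<inter> topspace (S.sdom i)"
  define T' where "T' = T0 \<inter> {t \<in> Mor G. src t \<in> Y} \<inter> topspace (S.sdom i)"
  define r' where "r' = min (r / 2) 1"
  have r': "0 < r'" "r' \<le> 1" "r' + r' \<le> r" using Y(3) by (auto simp: r'_def)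
  have oY: "open_mor (topspace (S.sdom i))" using S.openin_sdom openin_topspace by blast
  have oN: "openin (S.ctop i) (S.nbhd i S' r')" "openin (S.ctop i) (S.nbhd i T' r')"
    unfolding S'_def T'_def
    using open_iv[OF PC(2)] TA(1) open_src[OF Y(1)] oY r' by (auto intro!: S.nbhd_open)
  have uY: "u \<in> topspace (S.sdom i)" "g \<in> topspace (S.sdom i)" using u g i by (simp_all add: S.topspace_sdom)
  have "S.embed i u \<in> S.nbhd i S' r' \<inter> fiber lstr i (src g)"
    using S.embed_in[OF uY(1)] S.cproj_embed[OF uY(1)] u PC(4) uY r' S.d_refl[OF uY(1)]
    by (auto simp: S.nbhd_def S'_def S.embed_apply fiber_lstr intro!: bexI[of _ u])
  moreover have "S.act i g (S.embed i u) = S.embed i g" using S.act_embed[OF g uY(1)] u by simp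
  then have "S.act i g (S.embed i u) \<in> S.nbhd i T' r'"
    using S.embed_in[OF uY(2)] TA(3) Y(2) g uY r' S.d_refl[OF uY(2)]
    by (auto simp: S.nbhd_def T'_def S.embed_apply intro!: bexI[of _ g])
  moreover have "g' \<in> Q" if g': "g' \<in> Mor G" and a: "a \<in> S.nbhd i S' r' \<inter> fiber lstr i (src g')" "S.act i g' a \<in> S.nbhd i T' r'" for g' a
  proof -
    obtain s where s: "s \<in> S'" "a s < r'" "a \<in> S.Compl i" "S.cproj i a = src g'"
      using a(1) by (auto simp: S.nbhd_def fiber_lstr)
    obtain t where t: "t \<in> T'" "S.act i g' a t < r'" using a(2) by (auto simp: S.nbhd_def)
    have sY: "s \<in> topspace (S.sdom i)" "s \<in> Mor G" "iv s \<in> C" using s by (auto simp: S'_def)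
    have tY: "t \<in> topspace (S.sdom i)" "t \<in> Mor G" "t \<in> T0" "src t \<in> Y" using t by (auto simp: T'_def)
    have ts: "tgt s = src g'" using S.cproj_eq[OF s(3) sY(1)] s r' by simp
    note ac = S.act_in[OF g' s(3,4)]
    have tt: "tgt t = tgt g'" using S.cproj_eq[OF ac(1) tY(1)] ac(2) t r' by simp
    let ?v = "g' \<cdot> s"
    have v: "?v \<in> topspace (S.sdom i)" "?v \<in> Mor G" "tgt ?v = tgt g'" "src ?v = src s"
      using S.sdom_mul[OF g' sY(1) ts] g' sY ts by (simp_all add: grp_simps)
    have "S.act i g' a ?v = a s" using S.act_eval[OF g' sY(1) ts] .
    then have "S.ldist i t ?v < r" using S.Compl_ge[OF ac(1) tY(1) v(1)] s t r' by linarith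
    then have "\<rho> i (iv t \<cdot> ?v) < r" using tt v by (simp add: S.ldist_def)
    moreover have "iv t \<cdot> ?v \<in> restr (U i)" using S.sdom_restr[OF tY(1) v(1)] tt v by simp
    moreover have tu: "tgt (iv t \<cdot> ?v) = src t" using tt v tY by (simp add: grp_simps)
    ultimately have "iv t \<cdot> ?v \<in> A" using Y(4) tY(4) by auto
    then have "t \<cdot> (iv t \<cdot> ?v) \<in> P" using TA(5)[OF tY(3)] tu by simp
    then have "?v \<in> P" using cancel_inv'[OF tY(2) v(2)] tt v by simp
    then have "?v \<cdot> iv s \<in> Q" using PC(5)[OF _ sY(3)] v sY by (simp add: grp_simps)
    then show ?thesis using cancel_inv_right[OF g' sY(2)] ts by simp
  qed
  ultimately show ?thesis
    using oN by (intro exI[of _ i] exI[of _ "S.nbhd i S' r'"] exI[of _ "S.nbhd i T' r'"]) blast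
qed

lemma Mor_T1:
  assumes "g \<in> Mor G" "g' \<in> Mor G" "g \<noteq> g'"
  shows "\<exists>Q. open_mor Q \<and> g \<in> Q \<and> g' \<notin> Q"
proof -
  obtain Q where Q: "open_mor Q" "g \<in> Q" "completely_metrizable_space (subtopology (mor_space G) Q)"
    using locally_complete[OF assms(1)] by blast
  show ?thesis
  proof (cases "g' \<in> Q")
    case True
    have "Hausdorff_space (subtopology (mor_space G) Q)"
      using Q(3) completely_metrizable_imp_metrizable_space metrizable_imp_Hausdorff_space by blast
    then have "\<exists>V W. openin (subtopology (mor_space G) Q) V \<and> openin (subtopology (mor_space G) Q) W \<and> g \<in> V \<and> g' \<in> W \<and> disjnt V W"
      unfolding Hausdorff_space_def using True Q assms by simp
    then obtain V where "openin (subtopology (mor_space G) Q) V" "g \<in> V" "g' \<notin> V"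
      by (auto simp: disjnt_iff)
    then show ?thesis using openin_trans_full Q(1) by blast
  qed (use Q in blast)
qed

lemma eq_if_ldist_0:
  assumes "h \<in> topspace (S.sdom i)" "k \<in> topspace (S.sdom i)" "S.ldist i h k = 0"
  shows "h = k"
proof (rule ccontr)
  assume "h \<noteq> k"
  then obtain Q where Q: "open_mor Q" "h \<in> Q" "k \<notin> Q"
    using Mor_T1[of h k] S.sdom_Mor assms by blast
  obtain r where "0 < r" "\<forall>k\<in>topspace (S.sdom i). S.ldist i h k < r \<longrightarrow> k \<in> Q"
    using S.ldist_small_imp[OF assms(1) Q(1,2)] by blast
  then show False using Q assms by simp
qed

lemma Phi_inj: "inj_on Phi (Mor G)"
proof (rule inj_onI)
  fix g g' assume g: "g \<in> Mor G" "g' \<in> Mor G" and eq: "Phi g = Phi g'"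
  define u where "u = un (src g)"
  have s: "src g' = src g" "tgt g' = tgt g" using eq by (auto simp: Phi_def)
  obtain i where i: "src g \<in> U i" using cover[of "src g"] g by (auto simp: grp_simps)
  have u: "u \<in> Mor G" "src u = src g" "tgt u = src g" "g \<cdot> u = g" "g' \<cdot> u = g'"
    using g s mult_unit_source[of g'] by (simp_all add: u_def grp_simps)
  have Y: "u \<in> topspace (S.sdom i)" "g \<in> topspace (S.sdom i)" "g' \<in> topspace (S.sdom i)"
    using u g s i by (simp_all add: S.topspace_sdom)
  have "S.embed i u \<in> fiber lstr i (src g)" using S.embed_in[OF Y(1)] S.cproj_embed[OF Y(1)] u by (simp add: fiber_lstr)
  moreover have "(\<lambda>a\<in>fiber lstr i (src g). S.act i g a) = (\<lambda>a\<in>fiber lstr i (src g). S.act i g' a)"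
    using eq s by (auto simp: Phi_def dest: fun_cong[of _ _ i])
  ultimately have "S.act i g (S.embed i u) = S.act i g' (S.embed i u)" by (metis restrict_apply')
  then have "S.embed i g = S.embed i g'"
    using S.act_embed[OF g(1) Y(1)] S.act_embed[OF g(2) Y(1)] u s by simp
  then have "S.embed i g g' = S.embed i g' g'" by simp
  then have "S.ldist i g g' = 0" using S.embed_apply Y S.d_refl[OF Y(3)] by simp
  then show "g = g'" using eq_if_ldist_0 Y by blast
qed

text \<open>
Points are closed in the Hausdorff open set \<open>U j\<close>, so the target fibre is closed in an open subspace of \<open>Q\<close>.
\<close>
lemma fiber_completely_metrizable:
  assumes Q: "open_mor Q" "completely_metrizable_space (subtopology (mor_space G) Q)"
    and y: "y \<in> Obj G"
  shows "completely_metrizable_space (subtopology (mor_space G) {h \<in> Q. src h \<in> U i \<and> tgt h = y})"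
proof -
  obtain j where j: "y \<in> U j" using cover y by blast
  have QM: "Q \<subseteq> Mor G" using Q openin_subset by blast
  define Q' where "Q' = Q \<inter> {h \<in> Mor G. src h \<in> U i} \<inter> {h \<in> Mor G. tgt h \<in> U j}"
  have Q': "open_mor Q'" "Q' \<subseteq> Q"
    using Q open_src[OF S.U_open] open_tgt[OF S.U_open] by (auto simp: Q'_def)
  then have "openin (subtopology (mor_space G) Q) Q'"
    using openin_open_subtopology[OF Q(1)] by blast
  then have "completely_metrizable_space (subtopology (subtopology (mor_space G) Q) Q')"
    using completely_metrizable_space_openin Q(2) by blast
  moreover have "subtopology (subtopology (mor_space G) Q) Q' = subtopology (mor_space G) Q'"
    using Q'(2) by (simp add: subtopology_subtopology Int_absorb1)
  ultimately have cm: "completely_metrizable_space (subtopology (mor_space G) Q')" by simp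
  let ?E = "{h \<in> Q. src h \<in> U i \<and> tgt h = y}"
  have EQ: "?E \<subseteq> Q'" using QM j by (auto simp: Q'_def)
  have tU: "topspace (subtopology (obj_space G) (U j)) = U j"
    using S.U_open[of j] openin_subset by fastforce
  have "closedin (subtopology (obj_space G) (U j)) {y}"
    using closedin_Hausdorff_sing_eq[OF S.U_Hausdorff[of j]] tU j by blast
  then have "openin (subtopology (obj_space G) (U j)) (U j - {y})" using tU by (simp add: closedin_def)
  then have "open_obj (U j - {y})" using openin_trans_full S.U_open by blast
  then have "open_mor ({h \<in> Mor G. tgt h \<in> U j - {y}} \<inter> Q')" using open_tgt Q'(1) by blast
  moreover have "Q' - ?E = {h \<in> Mor G. tgt h \<in> U j - {y}} \<inter> Q'" by (auto simp: Q'_def)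
  ultimately have "open_mor (Q' - ?E)" by simp
  then have "openin (subtopology (mor_space G) Q') (Q' - ?E)"
    using openin_open_subtopology[OF Q'(1)] by blast
  moreover have "topspace (subtopology (mor_space G) Q') = Q'" using Q' QM by auto
  ultimately have "closedin (subtopology (mor_space G) Q') ?E" using EQ by (simp add: closedin_def)
  then have "completely_metrizable_space (subtopology (subtopology (mor_space G) Q') ?E)"
    using completely_metrizable_space_closedin cm by blast
  moreover have "subtopology (subtopology (mor_space G) Q') ?E = subtopology (mor_space G) ?E"
    using EQ by (simp add: subtopology_subtopology Int_absorb1)
  ultimately show ?thesis by simp
qed

lemma isometric_image_completely_metrizable:
  assumes Q: "open_mor Q" "completely_metrizable_space (subtopology (mor_space G) Q)"
    and y: "y \<in> Obj G"
    and f: "\<And>h. h \<in> topspace (S.sdom i) \<Longrightarrow> tgt h = y \<Longrightarrow> f h \<in> S.Compl i"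
    and iso: "\<And>h k. h \<in> topspace (S.sdom i) \<Longrightarrow> k \<in> topspace (S.sdom i) \<Longrightarrow> tgt h = y \<Longrightarrow> tgt k = y \<Longrightarrow>
       S.cdist i (f h) (f k) = S.ldist i h k"
  shows "completely_metrizable_space (subtopology (Metric_space.mtopology (S.Compl i) (S.cdist i))
     (f ` {h \<in> Q. src h \<in> U i \<and> tgt h = y}))"
proof -
  let ?E = "subtopology (mor_space G) {h \<in> Q. src h \<in> U i \<and> tgt h = y}"
  have QM: "Q \<subseteq> Mor G" using Q openin_subset by blast
  then have tE: "topspace ?E = {h \<in> Q. src h \<in> U i \<and> tgt h = y}" by auto
  have EY: "h \<in> topspace (S.sdom i)" "tgt h = y" if "h \<in> topspace ?E" for h
    using that tE QM by (auto simp: S.topspace_sdom)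
  have "completely_metrizable_space (subtopology (Metric_space.mtopology (S.Compl i) (S.cdist i)) (f ` topspace ?E))"
  proof (rule completely_metrizable_embedded_image[OF S.Metric_cdist])
    show "completely_metrizable_space ?E" using fiber_completely_metrizable Q y by blast
    show "f h \<in> S.Compl i" if "h \<in> topspace ?E" for h using f EY[OF that] by blast
    show "\<exists>S. openin ?E S \<and> h \<in> S \<and> (\<forall>k\<in>S. S.cdist i (f h) (f k) < r)" if h: "h \<in> topspace ?E" and r: "0 < r" for h r
    proof -
      obtain T where T: "open_mor T" "h \<in> T"
        "\<forall>k\<in>T. k \<in> topspace (S.sdom i) \<and> (tgt k = tgt h \<longrightarrow> S.ldist i h k < r)"
        using S.ldist_continuous[OF EY(1)[OF h] r] by blast
      have "openin ?E (T \<inter> topspace ?E)"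
        unfolding tE by (rule openin_subtopology_Int[OF T(1)])
      moreover have "S.cdist i (f h) (f k) < r" if "k \<in> T \<inter> topspace ?E" for k
        using T(3) that iso[OF EY(1)[OF h], of k] EY[OF h] EY[of k] by auto
      ultimately show ?thesis using T(2) h by blast
    qed
    show "\<exists>r>0. \<forall>k\<in>topspace ?E. S.cdist i (f h) (f k) < r \<longrightarrow> k \<in> W" if W: "openin ?E W" "h \<in> W" for h W
    proof -
      have h: "h \<in> topspace ?E" using W openin_subset by blast
      obtain V where V: "open_mor V" "W = V \<inter> {h \<in> Q. src h \<in> U i \<and> tgt h = y}"
        using W(1) unfolding openin_subtopology by blast
      obtain r where r: "0 < r" "\<forall>k\<in>topspace (S.sdom i). S.ldist i h k < r \<longrightarrow> k \<in> V"
        using S.ldist_small_imp[OF EY(1)[OF h] V(1)] V W by blast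
      have "k \<in> W" if k: "k \<in> topspace ?E" "S.cdist i (f h) (f k) < r" for k
      proof -
        have "S.ldist i h k < r" using iso[of h k] EY[OF h] EY[OF k(1)] k by simp
        then have "k \<in> V" using r EY[OF k(1)] by blast
        then show ?thesis using V k tE by blast
      qed
      then show ?thesis using r by blast
    qed
  qed
  then show ?thesis using tE by simp
qed

text \<open>
The space of arrows is merely locally completely metrizable, so the images of
completely metrizable neighbourhoods of \<open>h0\<close> and \<open>b0\<close> are compared, in a ball \<open>Z\<close> in which both are dense.
\<close>
lemma isometry_meets_groupoid:
  assumes x: "x \<in> Obj G" "x \<in> U i" and y: "y \<in> Obj G"
    and bij: "bij_betw \<phi> (fiber lstr i x) (fiber lstr i y)"
    and iso: "\<And>a b. a \<in> fiber lstr i x \<Longrightarrow> b \<in> fiber lstr i x \<Longrightarrow> S.cdist i (\<phi> a) (\<phi> b) = S.cdist i a b"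
  shows "\<exists>a b. a \<in> topspace (S.sdom i) \<and> b \<in> topspace (S.sdom i) \<and> tgt a = x \<and> tgt b = y \<and> \<phi> (S.embed i a) = S.embed i b"
proof -
  let ?Y = "topspace (S.sdom i)" and ?k = "S.embed i"
  interpret Metric_space "S.Compl i" "S.cdist i" by (rule S.Metric_cdist)
  have kf: "?k h \<in> fiber lstr i (tgt h)" if "h \<in> ?Y" for h
    using S.embed_in[OF that] S.cproj_embed[OF that] by (simp add: fiber_lstr)
  have phif: "\<phi> a \<in> fiber lstr i y" if "a \<in> fiber lstr i x" for a
    using bij that by (auto simp: bij_betw_def)
  have FC: "a \<in> S.Compl i" if "a \<in> fiber lstr i z" for a z using that by (simp add: fiber_lstr)
  have phik: "S.cdist i (\<phi> (?k h)) (\<phi> (?k l)) = S.ldist i h l" if "h \<in> ?Y" "l \<in> ?Y" "tgt h = x" "tgt l = x" for h l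
    using iso[of "?k h" "?k l"] kf[of h] kf[of l] that S.cdist_embed_embed[of h i l] by simp
  define h0 where "h0 = un x"
  have h0: "h0 \<in> ?Y" "h0 \<in> Mor G" "tgt h0 = x" using x by (simp_all add: h0_def S.topspace_sdom grp_simps)
  (* Completely metrizable neighbourhoods of the unit at x, and of an arrow b0 close to the image of this unit. *)
  obtain Q0 where Q0: "open_mor Q0" "h0 \<in> Q0" "completely_metrizable_space (subtopology (mor_space G) Q0)"
    using locally_complete[OF h0(2)] by blast
  obtain r0 where r0: "0 < r0" "r0 \<le> 1" "\<forall>k\<in>?Y. S.ldist i h0 k < r0 \<longrightarrow> k \<in> Q0"
    using S.ldist_small_imp[OF h0(1) Q0(1,2)] by blast
  define \<beta> where "\<beta> = \<phi> (?k h0)"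
  have \<beta>: "\<beta> \<in> S.Compl i" "S.cproj i \<beta> = y" using phif kf[OF h0(1)] h0(3) by (auto simp: \<beta>_def fiber_lstr)
  obtain b0 where b0: "b0 \<in> ?Y" "\<beta> b0 < r0" "tgt b0 = y"
    using S.Compl_small_fiber[OF \<beta>(1) r0(1)] \<beta>(2) by auto
  obtain Q1 where Q1: "open_mor Q1" "b0 \<in> Q1" "completely_metrizable_space (subtopology (mor_space G) Q1)"
    using locally_complete[of b0] S.sdom_Mor[OF b0(1)] by blast
  obtain r1 where r1: "0 < r1" "r1 \<le> 1" "\<forall>k\<in>?Y. S.ldist i b0 k < r1 \<longrightarrow> k \<in> Q1"
    using S.ldist_small_imp[OF b0(1) Q1(1,2)] by blast
  have kb0: "?k b0 \<in> S.Compl i" using S.embed_in[OF b0(1)] .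
  define A where "A = (\<lambda>h. \<phi> (?k h)) ` {h \<in> Q0. src h \<in> U i \<and> tgt h = x}"
  define C where "C = ?k ` {h \<in> Q1. src h \<in> U i \<and> tgt h = y}"
  (* The first radius keeps the preimages of points of Z within r0 of h0, the second keeps Z within r1 of b0. *)
  define Z where "Z = mball (?k b0) (min (r0 - \<beta> b0) r1)"
  have cmA: "completely_metrizable_space (subtopology mtopology A)"
    unfolding A_def
  proof (rule isometric_image_completely_metrizable[OF Q0(1,3) x(1)])
    show "\<phi> (?k h) \<in> S.Compl i" if "h \<in> ?Y" "tgt h = x" for h using FC phif kf[of h] that by blast
  qed (rule phik; assumption)
  have cmC: "completely_metrizable_space (subtopology mtopology C)"
    unfolding C_def
    by (rule isometric_image_completely_metrizable[OF Q1(1,3) y]) (use S.embed_in S.cdist_embed_embed in auto)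
  have sub: "{h \<in> Q0. src h \<in> U i \<and> tgt h = x} \<subseteq> ?Y" "{h \<in> Q1. src h \<in> U i \<and> tgt h = y} \<subseteq> ?Y"
    using Q0(1) Q1(1) openin_subset by (fastforce simp: S.topspace_sdom)+
  have AM: "A \<subseteq> S.Compl i" "C \<subseteq> S.Compl i"
    using sub FC phif kf S.embed_in unfolding A_def C_def by blast+
  have Zy: "z \<in> S.Compl i \<and> S.cproj i z = y \<and> S.cdist i (?k b0) z < r1 \<and> S.cdist i (?k b0) z < r0 - \<beta> b0" if "z \<in> Z" for z
    using that S.cdist_less_1_cproj[OF kb0, of z] r1 S.cproj_embed[OF b0(1)] b0(3) by (auto simp: Z_def)
  have ZC: "Z \<subseteq> mtopology closure_of C"
    unfolding metric_closure_of
  proof (intro subsetI CollectI conjI allI impI)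
    fix z assume z: "z \<in> Z"
    then show "z \<in> S.Compl i" using Zy by blast
    fix e :: real assume e: "e > 0"
    have "min e (r1 - S.cdist i (?k b0) z) > 0" using Zy[OF z] e by simp
    then obtain b where b: "b \<in> ?Y" "z b < min e (r1 - S.cdist i (?k b0) z)" "tgt b = S.cproj i z"
      using S.Compl_small_fiber Zy[OF z] by blast
    have kb: "?k b \<in> S.Compl i" "S.cdist i z (?k b) = z b"
      using S.embed_in[OF b(1)] S.cdist_embed[of z i b] Zy[OF z] b(1) by (simp_all add: S.cdist_sym)
    have "S.ldist i b0 b < r1"
      using S.cdist_tri[OF kb0 _ kb(1), of z] Zy[OF z] kb(2) b S.cdist_embed_embed[OF b0(1) b(1)] by simp
    then have "b \<in> Q1" using r1 b by blast
    then have "?k b \<in> C" using b Zy[OF z] by (auto simp: C_def S.topspace_sdom)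
    moreover have "?k b \<in> mball z e" using kb b Zy[OF z] by simp
    ultimately show "\<exists>y\<in>C. y \<in> mball z e" by blast
  qed
  have ZA: "Z \<subseteq> mtopology closure_of A"
    unfolding metric_closure_of
  proof (intro subsetI CollectI conjI allI impI)
    fix z assume z: "z \<in> Z"
    then show zC: "z \<in> S.Compl i" using Zy by blast
    fix e :: real assume e: "e > 0"
    have "z \<in> fiber lstr i y" using Zy[OF z] by (simp add: fiber_lstr)
    then have "z \<in> \<phi> ` fiber lstr i x" using bij by (simp add: bij_betw_def)
    then obtain w where w: "w \<in> fiber lstr i x" "\<phi> w = z" by blast
    have wC: "w \<in> S.Compl i" "S.cproj i w = x" using w by (simp_all add: fiber_lstr)
    have "min e (r0 - \<beta> b0 - S.cdist i (?k b0) z) > 0" using Zy[OF z] e by simp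
    then obtain a where a: "a \<in> ?Y" "w a < min e (r0 - \<beta> b0 - S.cdist i (?k b0) z)" "tgt a = x"
      using S.Compl_small_fiber[OF wC(1)] wC(2) by blast
    have ka: "?k a \<in> fiber lstr i x" using kf a by blast
    have pa: "\<phi> (?k a) \<in> S.Compl i" using FC phif ka by blast
    have za: "S.cdist i z (\<phi> (?k a)) = w a"
      using iso[OF w(1) ka] w(2) S.cdist_embed[OF wC(1) a(1)] S.cdist_sym[of i w "?k a"] by simp
    have "S.cdist i \<beta> (\<phi> (?k a)) \<le> S.cdist i \<beta> (?k b0) + (S.cdist i (?k b0) z + S.cdist i z (\<phi> (?k a)))"
      using S.cdist_tri[OF \<beta>(1) kb0 pa] S.cdist_tri[OF kb0 zC pa] by linarith
    also have "S.cdist i \<beta> (?k b0) = \<beta> b0" using S.cdist_embed[OF \<beta>(1) b0(1)] S.cdist_sym[of i \<beta>] by simp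
    finally have "S.cdist i \<beta> (\<phi> (?k a)) < r0" using za a(2) by simp
    then have "S.ldist i h0 a < r0" using phik[OF h0(1) a(1) h0(3) a(3)] by (simp add: \<beta>_def)
    then have "a \<in> Q0" using r0 a by blast
    then have "\<phi> (?k a) \<in> A" using a by (auto simp: A_def S.topspace_sdom)
    moreover have "\<phi> (?k a) \<in> mball z e" using za a zC pa by simp
    ultimately show "\<exists>y\<in>A. y \<in> mball z e" by blast
  qed
  have "openin mtopology Z" by (simp add: Z_def)
  moreover have "?k b0 \<in> Z" using kb0 b0(2) r1(1) by (simp add: Z_def)
  then have "Z \<noteq> {}" by blast
  ultimately have "A \<inter> C \<noteq> {}"
    using dense_completely_metrizable_meet[OF S.Metric_cdist S.mcomplete_cdist AM(1) cmA AM(2) cmC _ _ ZA ZC] by blast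
  then obtain a b where "a \<in> {h \<in> Q0. src h \<in> U i \<and> tgt h = x}" "b \<in> {h \<in> Q1. src h \<in> U i \<and> tgt h = y}" "\<phi> (?k a) = ?k b"
    by (auto simp: A_def C_def)
  then show ?thesis using sub by blast
qed

lemma rel_val_embed_0:
  assumes "h \<in> topspace (S.sdom i)" "k \<in> topspace (S.sdom j)" "tgt h = tgt k" "iv h \<cdot> k \<in> B n"
  shows "rel_val i j n (S.embed i h) (S.embed j k) = 0"
proof -
  have "(h, k) \<in> rel_pairs i j n" using assms by (simp add: rel_pairs_def)
  then have "rel_val i j n (S.embed i h) (S.embed j k) \<le> 0"
    using rel_val_le[OF S.embed_in[OF assms(1)] S.embed_in[OF assms(2)], of h k n] S.d_refl assms
    by (simp add: S.embed_apply)
  then show ?thesis using rel_val_nonneg[OF S.embed_in[OF assms(1)] S.embed_in[OF assms(2)], of n] by simp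
qed

text \<open>
Let \<open>\<phi>\<close> send the arrow \<open>a\<close> to the arrow \<open>b\<close> in one sort.  If \<open>c\<close> is an arrow into \<open>x\<close>, then \<open>(a, c)\<close>
satisfies the relation for every basic neighbourhood \<open>B n\<close> of \<open>a\<inverse> c\<close>, and so does \<open>(b, e)\<close> with \<open>e = \<phi> c\<close>:
there are arrows \<open>h\<close> near \<open>b\<close> and \<open>k\<close> near \<open>e\<close> with \<open>h\<inverse> k \<in> B n\<close>.  In the limit \<open>k = h (h\<inverse> k)\<close> tends to
\<open>b a\<inverse> c\<close>, which must therefore be \<open>e\<close>.
\<close>
lemma Phi_surj:
  assumes z: "z \<in> Iso_mor lang (obj_space G) lstr"
  shows "z \<in> Phi ` Mor G"
proof -
  obtain x y \<phi> where zz: "z = (x, y, \<phi>)" by (cases z) auto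
  have x: "x \<in> Obj G" and y: "y \<in> Obj G" and phi: "\<phi> \<in> fiber_isos lang (obj_space G) lstr x y"
    using z zz by (auto simp: Iso_mor_def)
  have phi_ext: "\<phi> P \<in> extensional (fiber lstr P x)" and bij: "bij_betw (\<phi> P) (fiber lstr P x) (fiber lstr P y)" for P
    using phi by (auto simp: fiber_isos_def)
  have iso: "S.cdist P (\<phi> P a) (\<phi> P b) = S.cdist P a b" if "a \<in> fiber lstr P x" "b \<in> fiber lstr P x" for P a b
    using phi that by (auto simp: fiber_isos_def)
  have phif: "\<phi> P a \<in> fiber lstr P y" if "a \<in> fiber lstr P x" for P a
    using bij[of P] that by (auto simp: bij_betw_def)
  have FC: "a \<in> S.Compl P" "S.cproj P a = w" if "a \<in> fiber lstr P w" for a P w using that by (simp_all add: fiber_lstr)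
  have kf: "S.embed P h \<in> fiber lstr P (tgt h)" if "h \<in> topspace (S.sdom P)" for h P
    using S.embed_in[OF that] S.cproj_embed[OF that] by (simp add: fiber_lstr)
  have rel: "rel_val i j n (\<phi> i a) (\<phi> j b) = rel_val i j n a b" if ab: "a \<in> fiber lstr i x" "b \<in> fiber lstr j x" for i j n a b
  proof -
    obtain R where R: "ri R = i" "rj R = j" "rn R = n" using rel_index by blast
    define c where "c = (\<lambda>m\<in>{..<2::nat}. if m = 0 then a else b)"
    have "(x, c) \<in> topspace (rel_domain lang (obj_space G) lstr R)"
      unfolding rel_domain_iff using ab x R by (simp add: c_def fiber_lstr)
    then have "rel_interp lstr R (y, \<lambda>m\<in>{..<length (arity lang R)}. \<phi> (arity lang R ! m) (c m)) = rel_interp lstr R (x, c)"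
      using phi by (simp add: fiber_isos_def)
    then show ?thesis using R by (simp add: c_def)
  qed
  obtain i where i: "x \<in> U i" using cover x by blast
  obtain a b where a: "a \<in> topspace (S.sdom i)" "tgt a = x" and b: "b \<in> topspace (S.sdom i)" "tgt b = y"
    and ab: "\<phi> i (S.embed i a) = S.embed i b"
    using isometry_meets_groupoid[OF x i y bij[of i] iso] by blast
  have M: "a \<in> Mor G" "b \<in> Mor G" and sU: "src a \<in> U i" "src b \<in> U i" using a b by (simp_all add: S.topspace_sdom)
  have kb: "S.embed i b \<in> S.Compl i" using S.embed_in b by blast
  (* If the sources differed, a relation would place some arrow k near b with source near that of a. *)
  have src: "src a = src b"
  proof (rule ccontr)
    assume ne: "src a \<noteq> src b"
    have tU: "topspace (subtopology (obj_space G) (U i)) = U i" using S.U_open[of i] openin_subset by fastforce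
    obtain V W where VW: "openin (subtopology (obj_space G) (U i)) V" "openin (subtopology (obj_space G) (U i)) W"
      "src a \<in> V" "src b \<in> W" "disjnt V W"
      using S.U_Hausdorff[of i] sU ne tU unfolding Hausdorff_space_def by metis
    have oV: "open_obj V" "open_obj W" using VW S.U_open openin_trans_full by blast+
    have iva: "iv a \<cdot> a = un (src a)" "un (src a) \<in> Mor G" "src (un (src a)) = src a" using M by (simp_all add: grp_simps)
    obtain n where n: "iv a \<cdot> a \<in> B n" "B n \<subseteq> {g \<in> Mor G. src g \<in> V}"
      using B_base[OF open_src[OF oV(1)], of "iv a \<cdot> a"] iva VW by auto
    have "rel_val i i n (S.embed i a) (S.embed i a) = 0" using rel_val_embed_0[OF a(1) a(1) refl n(1)] .
    then have R0: "rel_val i i n (S.embed i b) (S.embed i b) = 0" using rel[of "S.embed i a" i "S.embed i a" i n] kf[OF a(1)] a(2) ab by simp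
    obtain r where r: "0 < r" "r \<le> 1" "\<forall>k\<in>topspace (S.sdom i). S.ldist i b k < r \<longrightarrow> k \<in> {g \<in> Mor G. src g \<in> W}"
      using S.ldist_small_imp[OF b(1) open_src[OF oV(2)]] M VW by blast
    have "rel_val i i n (S.embed i b) (S.embed i b) < r" using R0 r by simp
    then obtain h k where hk: "(h, k) \<in> rel_pairs i i n" "S.embed i b h + S.embed i b k < r"
      using rel_val_lt_iff[OF kb kb] r by fastforce
    then have Y: "h \<in> topspace (S.sdom i)" "k \<in> topspace (S.sdom i)" "iv h \<cdot> k \<in> B n" "tgt h = tgt k" by (auto simp: rel_pairs_def)
    have "src k \<in> V" using n(2) Y S.sdom_Mor[of h i] S.sdom_Mor[of k i] by (auto simp: grp_simps)
    moreover have "S.ldist i b k < r" using hk(2) S.embed_apply[OF b(1) Y(2)] S.Compl_nonneg[OF kb, of h] by simp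
    then have "src k \<in> W" using r Y by blast
    ultimately show False using VW(5) by (auto simp: disjnt_iff)
  qed
  define g where "g = b \<cdot> iv a"
  have g: "g \<in> Mor G" "src g = x" "tgt g = y" using M src a b by (simp_all add: g_def grp_simps)
  (* On arrows, the isomorphism is left translation by g. *)
  have gc: "\<phi> j (S.embed j c) = S.embed j (g \<cdot> c)" if c: "c \<in> topspace (S.sdom j)" "tgt c = x" for j c
  proof -
    have cM: "c \<in> Mor G" using c S.sdom_Mor by blast
    define w where "w = iv a \<cdot> c"
    have w: "w \<in> Mor G" "tgt w = src b" "g \<cdot> c = b \<cdot> w"
      using assoc[of b "iv a" c] M cM a c src by (simp_all add: w_def g_def grp_simps)
    have gcY: "g \<cdot> c \<in> topspace (S.sdom j)" "tgt (g \<cdot> c) = y" "g \<cdot> c \<in> Mor G"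
      using S.sdom_mul[OF g(1) c(1)] c g cM by (simp_all add: grp_simps)
    define e where "e = \<phi> j (S.embed j c)"
    have ef: "e \<in> fiber lstr j y" using phif kf[OF c(1)] c(2) by (simp add: e_def)
    note eC = FC[OF ef]
    have "e (g \<cdot> c) \<le> 0 + \<epsilon>" if \<epsilon>: "\<epsilon> > 0" for \<epsilon>
    proof -
      obtain S' where S': "open_mor S'" "g \<cdot> c \<in> S'"
        "\<forall>k\<in>S'. k \<in> topspace (S.sdom j) \<and> (tgt k = tgt (g \<cdot> c) \<longrightarrow> S.ldist j (g \<cdot> c) k < \<epsilon> / 2)"
        using S.ldist_continuous[OF gcY(1), of "\<epsilon> / 2"] \<epsilon> by auto
      obtain Q P where QP: "open_mor Q" "open_mor P" "b \<in> Q" "w \<in> P"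
        "\<And>a b. a \<in> Q \<Longrightarrow> b \<in> P \<Longrightarrow> src a = tgt b \<Longrightarrow> a \<cdot> b \<in> S'"
        by (rule mult_nbhd[of b w S']) (use M w S' in auto)
      obtain n where n: "w \<in> B n" "B n \<subseteq> P" using B_base[OF QP(2,4)] by blast
      obtain r where r: "0 < r" "r \<le> 1" "\<forall>k\<in>topspace (S.sdom i). S.ldist i b k < r \<longrightarrow> k \<in> Q"
        using S.ldist_small_imp[OF b(1) QP(1,3)] by blast
      have "rel_val i j n (S.embed i a) (S.embed j c) = 0" using rel_val_embed_0[OF a(1) c(1), of n] a c n by (simp add: w_def)
      then have "rel_val i j n (S.embed i b) e = 0"
        using rel[of "S.embed i a" i "S.embed j c" j n] kf[OF a(1)] kf[OF c(1)] a(2) c(2) ab by (simp add: e_def)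
      then have "rel_val i j n (S.embed i b) e < min r (\<epsilon> / 2)" using r \<epsilon> by simp
      moreover have "\<not> 1 < min r (\<epsilon> / 2)" using r by simp
      ultimately obtain h k where hk: "(h, k) \<in> rel_pairs i j n" "S.embed i b h + e k < min r (\<epsilon> / 2)"
        unfolding rel_val_lt_iff[OF kb eC(1)] by blast
      have Y: "h \<in> topspace (S.sdom i)" "k \<in> topspace (S.sdom j)" "iv h \<cdot> k \<in> B n" "tgt h = tgt k"
        using hk(1) by (auto simp: rel_pairs_def)
      have nn: "0 \<le> S.embed i b h" "0 \<le> e k" using S.Compl_nonneg[OF kb] S.Compl_nonneg[OF eC(1)] by blast+
      have dbh: "S.ldist i b h < r" and ek: "e k < \<epsilon> / 2" "e k < 1"
        using hk(2) nn S.embed_apply[OF b(1) Y(1)] r by auto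
      have hM: "h \<in> Mor G" "k \<in> Mor G" using Y S.sdom_Mor by blast+
      have "h \<in> Q" using r dbh Y by blast
      then have "h \<cdot> (iv h \<cdot> k) \<in> S'" using QP(5) n Y hM by (auto simp: grp_simps)
      then have kS: "k \<in> S'" using cancel_inv'[OF hM Y(4)] by simp
      have "tgt k = y" using S.cproj_eq[OF eC(1) Y(2) ek(2)] eC(2) by simp
      then have "S.ldist j (g \<cdot> c) k < \<epsilon> / 2" using S'(3) kS gcY by simp
      then show ?thesis using S.Compl_lip[OF eC(1) gcY(1) Y(2)] ek by simp
    qed
    then have "e (g \<cdot> c) \<le> 0" by (rule field_le_epsilon)
    then have "e (g \<cdot> c) = 0" using S.Compl_nonneg[OF eC(1), of "g \<cdot> c"] by simp
    then show ?thesis using S.eq_embedI[OF eC(1) gcY(1)] by (simp add: e_def)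
  qed
  have act: "\<phi> j f = S.act j g f" if f: "f \<in> fiber lstr j x" for j f
  proof -
    have gf: "S.act j g f \<in> fiber lstr j y" using act_fiber[OF g(1)] f g by simp
    have pf: "\<phi> j f \<in> fiber lstr j y" using phif f by blast
    have "S.cdist j (\<phi> j f) (S.act j g f) \<le> 0 + \<epsilon>" if \<epsilon>: "\<epsilon> > 0" for \<epsilon>
    proof -
      obtain c where c: "c \<in> topspace (S.sdom j)" "f c < \<epsilon> / 2" "tgt c = x"
        using S.Compl_small_fiber[OF FC(1)[OF f], of "\<epsilon> / 2"] FC(2)[OF f] \<epsilon> by auto
      have kc: "S.embed j c \<in> fiber lstr j x" using kf[OF c(1)] c(3) by simp
      have Dfc: "S.cdist j f (S.embed j c) = f c" using S.cdist_embed[OF FC(1)[OF f] c(1)] S.cdist_sym[of j f] by simp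
      have "S.cdist j (\<phi> j f) (\<phi> j (S.embed j c)) = f c" using iso[OF f kc] Dfc by simp
      moreover have "S.cdist j (S.act j g f) (S.act j g (S.embed j c)) = f c"
        using S.cdist_act[OF g(1), of f j "S.embed j c"] FC[OF f] FC[OF kc] g Dfc by simp
      moreover have "S.act j g (S.embed j c) = \<phi> j (S.embed j c)"
        using S.act_embed[OF g(1) c(1)] gc[OF c(1,3)] g c by simp
      ultimately show ?thesis
        using S.cdist_tri[OF FC(1)[OF pf] FC(1)[OF phif[OF kc]] FC(1)[OF gf]] c(2)
          S.cdist_sym[of j "S.act j g f" "\<phi> j (S.embed j c)"] by simp
    qed
    then have "S.cdist j (\<phi> j f) (S.act j g f) \<le> 0" by (rule field_le_epsilon)
    then have "S.cdist j (\<phi> j f) (S.act j g f) = 0" using S.cdist_nonneg[of j "\<phi> j f" "S.act j g f"] by simp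
    then show ?thesis using S.cdist_0[OF FC(1)[OF pf] FC(1)[OF gf]] by blast
  qed
  have "\<phi> = (\<lambda>j. \<lambda>f\<in>fiber lstr j x. S.act j g f)"
  proof (intro ext)
    fix j f k
    show "\<phi> j f k = (\<lambda>f\<in>fiber lstr j x. S.act j g f) f k"
      using act[of f j] phi_ext[of j] by (auto simp: extensional_def)
  qed
  then have "z = Phi g" using zz g by (simp add: Phi_def)
  then show ?thesis using g by blast
qed

text \<open>
By surjectivity, the subbasic open set of \<open>basic_neighbourhood\<close> consists of images of arrows, all of which are in \<open>Q\<close>.
\<close>
lemma Phi_open: "open_map (mor_space G) (Iso_topology lang (obj_space G) lstr) Phi"
  unfolding open_map_def
proof (intro allI impI)
  fix Q assume Q: "open_mor Q"
  have QM: "Q \<subseteq> Mor G" using Q openin_subset by blast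
  show "openin (Iso_topology lang (obj_space G) lstr) (Phi ` Q)"
  proof (subst openin_subopen, intro ballI)
    fix z assume "z \<in> Phi ` Q"
    then obtain g where g: "g \<in> Q" "z = Phi g" by blast
    have gM: "g \<in> Mor G" using g QM by blast
    obtain i S T where ST: "openin (S.ctop i) S" "openin (S.ctop i) T"
      "\<exists>a\<in>S \<inter> fiber lstr i (src g). S.act i g a \<in> T"
      "\<forall>g'\<in>Mor G. (\<exists>a\<in>S \<inter> fiber lstr i (src g'). S.act i g' a \<in> T) \<longrightarrow> g' \<in> Q"
      using basic_neighbourhood[OF Q g(1)] by (elim exE conjE) (rule that)
    let ?W = "{(x, y, f) \<in> Iso_mor lang (obj_space G) lstr. f i ` (S \<inter> fiber lstr i x) \<inter> (T \<inter> fiber lstr i y) \<noteq> {}}"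
    have "openin (Iso_topology lang (obj_space G) lstr) ?W"
      unfolding Iso_topology_def
      by (rule topology_generated_by_Basis) (use ST(1,2) in auto)
    moreover have "z \<in> ?W" using Phi_moves[OF gM, of i S T] ST(3) g(2) by (simp only:)
    moreover have "?W \<subseteq> Phi ` Q"
    proof
      fix w assume w: "w \<in> ?W"
      then have "w \<in> Iso_mor lang (obj_space G) lstr" by auto
      then obtain g' where g': "g' \<in> Mor G" "w = Phi g'" using Phi_surj by blast
      have "\<exists>a\<in>S \<inter> fiber lstr i (src g'). S.act i g' a \<in> T"
        using Phi_moves[OF g'(1), of i S T] w unfolding g'(2) by (simp only:)
      then show "w \<in> Phi ` Q" using ST(4) g' by blast
    qed
    ultimately show "\<exists>T. openin (Iso_topology lang (obj_space G) lstr) T \<and> z \<in> T \<and> T \<subseteq> Phi ` Q" by blast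
  qed
qed

lemma Phi_iso: "topological_groupoid_iso G (Iso_groupoid lang (obj_space G) lstr) (\<lambda>x. x) Phi"
  unfolding topological_groupoid_iso_def
proof (intro conjI ballI)
  show "homeomorphic_map (obj_space G) (obj_space (Iso_groupoid lang (obj_space G) lstr)) (\<lambda>x. x)"
    using homeomorphic_map_id[of "obj_space G"] by (simp add: Iso_groupoid_def id_def)
  have "Phi ` Mor G = Iso_mor lang (obj_space G) lstr" using Phi_in Phi_surj by blast
  then show "homeomorphic_map (mor_space G) (mor_space (Iso_groupoid lang (obj_space G) lstr)) Phi"
    using bijective_open_imp_homeomorphic_map[OF Phi_continuous Phi_open _ Phi_inj]
    by (simp add: Iso_groupoid_def topspace_Iso_topology)
  show "source (Iso_groupoid lang (obj_space G) lstr) (Phi g) = source G g" for g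
    by (simp add: Iso_groupoid_def Phi_def)
  show "target (Iso_groupoid lang (obj_space G) lstr) (Phi g) = target G g" for g
    by (simp add: Iso_groupoid_def Phi_def)
  show "Phi (unit_mor G x) = unit_mor (Iso_groupoid lang (obj_space G) lstr) x" if "x \<in> Obj G" for x
    using Phi_unit[OF that] .
  show "case z of (g, h) \<Rightarrow> Phi (mult G g h) = mult (Iso_groupoid lang (obj_space G) lstr) (Phi g) (Phi h)"
    if "z \<in> composable G" for z
    using that Phi_mult by (auto simp: composable_def)
qed

lemma lstr_second_countable:
  assumes "second_countable (obj_space G)" "second_countable (mor_space G)"
  shows "second_countable_structure lang (obj_space G) lstr"
  unfolding second_countable_structure_def countable_language_def
  using assms S.second_countable_ctop second_countable_subtopology by (auto simp: S.sdom_def)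

end

section \<open>The representation theorem\<close>

theorem theorem1p5:
  fixes G :: "('o, 'g) groupoid_data"
  assumes "open_topological_groupoid G"
    and "sigma_locally_Polish_groupoid G"
  shows "\<exists>(L :: (nat, nat) language) (M :: (nat, nat, 'o, 'g \<Rightarrow> real) metric_etale_data).
           countable_language L \<and>
           metric_etale_structure L (obj_space G) M \<and>
           second_countable_structure L (obj_space G) M \<and>
           (\<exists>\<Phi>. topological_groupoid_iso G (Iso_groupoid L (obj_space G) M) (\<lambda>x. x) \<Phi>)"
proof -
  interpret open_topological_groupoid G by fact
  have slP: "sigma_locally_Polish_space (obj_space G)" "sigma_locally_Polish_space (mor_space G)"
    using assms(2) by (simp_all add: sigma_locally_Polish_groupoid_def)
  have sco: "second_countable (obj_space G)" and scm: "second_countable (mor_space G)"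
    using slP sigma_locally_Polish_imp_second_countable by blast+
  obtain \<U> where U: "countable \<U>" "\<forall>U\<in>\<U>. open_obj U \<and> Polish_space (subtopology (obj_space G) U)"
    "\<Union>\<U> = Obj G"
    using slP(1) unfolding sigma_locally_Polish_space_def by (elim exE conjE) (rule that)
  (* The empty set is added so that the enumeration makes sense when there are no objects. *)
  define V where "V = from_nat_into (insert {} \<U>)"
  have Vin: "V i \<in> insert {} \<U>" for i unfolding V_def by (rule from_nat_into) simp
  have met: "open_obj (V i) \<and> metrizable_space (subtopology (obj_space G) (V i))" for i
  proof (cases "V i = {}")
    case True
    have "metrizable_space (trivial_topology :: 'o topology)"
      using metrizable_space_discrete_topology[of "{} :: 'o set"] by simp
    then show ?thesis using True by simp
  next
    case False
    then have "V i \<in> \<U>" using Vin by blast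
    then show ?thesis
      using U(2) completely_metrizable_imp_metrizable_space unfolding Polish_space_def by blast
  qed
  then have "\<forall>i. \<exists>\<rho>. normed_open G (V i) \<rho>" using exists_norm sco scm by blast
  then obtain \<rho> where \<rho>: "\<And>i. normed_open G (V i) (\<rho> i)" by metis
  obtain BB where BB: "countable BB" "\<forall>W\<in>BB. open_mor W"
    "\<forall>Q g. open_mor Q \<and> g \<in> Q \<longrightarrow> (\<exists>W\<in>BB. g \<in> W \<and> W \<subseteq> Q)"
    using scm unfolding second_countable_def by (elim exE conjE) (rule that)
  define B where "B = from_nat_into (insert {} BB)"
  interpret R: groupoid_representation G V \<rho> B
  proof (intro groupoid_representation.intro groupoid_representation_axioms.intro)
    show "open_topological_groupoid G" by fact
    show "normed_open G (V i) (\<rho> i)" for i by (rule \<rho>)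
    show "\<exists>i. x \<in> V i" if x: "x \<in> Obj G" for x
    proof -
      obtain W where W: "W \<in> \<U>" "x \<in> W" using x U(3) by blast
      then obtain i where "V i = W"
        using from_nat_into_surj[of "insert {} \<U>" W] U(1) unfolding V_def by auto
      then show ?thesis using W by blast
    qed
    show "open_mor (B n)" for n
      using from_nat_into[of "insert {} BB" n] BB(2) unfolding B_def by auto
    show "\<exists>n. g \<in> B n \<and> B n \<subseteq> Q" if Q: "open_mor Q" "g \<in> Q" for Q g
    proof -
      obtain W where W: "W \<in> BB" "g \<in> W" "W \<subseteq> Q" using BB(3) Q by blast
      then obtain n where "B n = W"
        using from_nat_into_surj[of "insert {} BB" W] BB(1) unfolding B_def by auto
      then show ?thesis using W by blast
    qed
    show "\<exists>Q. open_mor Q \<and> g \<in> Q \<and> completely_metrizable_space (subtopology (mor_space G) Q)"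
      if "g \<in> Mor G" for g
      using slP(2) that unfolding sigma_locally_Polish_space_def Polish_space_def by blast
  qed
  show ?thesis
  proof (intro exI conjI)
    show "countable_language R.lang" by (simp add: countable_language_def)
    show "metric_etale_structure R.lang (obj_space G) R.lstr" by (rule R.lstr_metric_etale)
    show "second_countable_structure R.lang (obj_space G) R.lstr" using R.lstr_second_countable sco scm .
    show "topological_groupoid_iso G (Iso_groupoid R.lang (obj_space G) R.lstr) (\<lambda>x. x) R.Phi" by (rule R.Phi_iso)
  qed
qed

end
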